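(* Let $\mathcal X$ be a Banach algebra of functions on $\mathbb T$ satisfying the following properties: (i) $\mathcal X$ is continuously embedded in $C(\mathbb T)$; (ii) $P_+(\mathcal X)\subseteq L^\infty(\mathbb T)$; (iii) every multiplicative linear functional on $\mathcal X$ coincides with the evaluation $f\mapsto f(\zeta)$ at some point $\zeta\in\mathbb T$. Let $F\in\mathcal X$, and let $T_F$ be the Toeplitz operator with symbol $F$ on $H^2$. Suppose that there exists an open disk $D$, contained in the unbounded connected component of $\mathbb C\setminus\sigma(T_F)$, such that $0\in\partial D$. Then $T_F$ is embeddable into a $C_0$-semigroup of operators on $H^2$.
   Context: $\mathbb T$ is the unit circle, $H^2$ the Hardy space of the unit disk, $P_+$ the Riesz projection of $L^2(\mathbb T)$ onto $H^2$, $T_Ff=P_+(Ff)$, and $\sigma(T_F)$ its spectrum. Multiplicative linear functionals are understood to be nonzero. A $C_0$-semigroup on a Banach space $X$ is a family $(T_t)_{t>0}$ of bounded operators with $T_tT_s=T_{t+s}$ for $t,s>0$ and $\|T_tx-x\|\to0$ as $t\to0^+$ for every $x\in X$. $T$ is embeddable into a $C_0$-semigroup if there is a $C_0$-semigroup $(T_t)_{t>0}$ with $T_1=T$. *)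

theory Defs
  imports "HOL-Analysis.Analysis" "HOL-Probability.Probability"
begin

section \<open>Complex Banach spaces, spectrum, semigroups\<close>

text \<open>The library classes \<^class>\<open>real_normed_vector\<close> and \<^class>\<open>banach\<close> are over the reals; a
  complex scalar multiplication extending the real one is added here.\<close>

class complex_normed_vector = real_normed_vector +
  fixes scaleC :: "complex \<Rightarrow> 'a \<Rightarrow> 'a"  (infixr "*\<^sub>C" 75)
  assumes scaleC_add_right: "a *\<^sub>C (x + y) = a *\<^sub>C x + a *\<^sub>C y"
    and scaleC_add_left: "(a + b) *\<^sub>C x = a *\<^sub>C x + b *\<^sub>C x"
    and scaleC_scaleC: "a *\<^sub>C (b *\<^sub>C x) = (a * b) *\<^sub>C x"
    and scaleC_of_real: "complex_of_real r *\<^sub>C x = r *\<^sub>R x"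
    and norm_scaleC: "norm (a *\<^sub>C x) = cmod a * norm x"

class complex_banach = complex_normed_vector + banach

definition bounded_clinear :: "('a::complex_normed_vector \<Rightarrow> 'b::complex_normed_vector) \<Rightarrow> bool" where
  "bounded_clinear f \<longleftrightarrow> bounded_linear f \<and> (\<forall>a x. f (a *\<^sub>C x) = a *\<^sub>C f x)"

definition op_spectrum :: "('a::complex_normed_vector \<Rightarrow> 'a) \<Rightarrow> complex set" where
  "op_spectrum A = {l. \<not> (\<exists>B. bounded_clinear B \<and>
      (\<forall>x. B (A x - l *\<^sub>C x) = x) \<and> (\<forall>x. A (B x) - l *\<^sub>C B x = x))}"

text \<open>Only the values at positive times matter.\<close>

definition C0_semigroup :: "(real \<Rightarrow> 'a::complex_banach \<Rightarrow> 'a) \<Rightarrow> bool" where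
  "C0_semigroup T \<longleftrightarrow>
     (\<forall>t>0. bounded_clinear (T t)) \<and>
     (\<forall>t>0. \<forall>s>0. T t \<circ> T s = T (t + s)) \<and>
     (\<forall>x. ((\<lambda>t. norm (T t x - x)) \<longlongrightarrow> 0) (at_right 0))"

definition C0_embeddable :: "('a::complex_banach \<Rightarrow> 'a) \<Rightarrow> bool" where
  "C0_embeddable A \<longleftrightarrow> (\<exists>T. C0_semigroup T \<and> T 1 = A)"

section \<open>The unit circle\<close>

typedef circle = "sphere (0::complex) 1" morphisms of_circle Abs_circle
  by (rule exI[of _ 1]) simp

lemma norm_of_circle [simp]: "cmod (of_circle z) = 1"
  using of_circle[of z] by simp

lemma of_circle_nonzero [simp]: "of_circle z \<noteq> 0"
  using norm_of_circle[of z] by (metis norm_zero zero_neq_one)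

instantiation circle :: metric_space
begin

definition dist_circle :: "circle \<Rightarrow> circle \<Rightarrow> real" where
  "dist_circle z w = dist (of_circle z) (of_circle w)"

definition uniformity_circle :: "(circle \<times> circle) filter" where
  "uniformity_circle = (INF e\<in>{0<..}. principal {(x, y). dist x y < e})"

definition open_circle :: "circle set \<Rightarrow> bool" where
  "open_circle U \<longleftrightarrow> (\<forall>x\<in>U. \<forall>\<^sub>F (x', y) in uniformity. x' = x \<longrightarrow> y \<in> U)"

instance
proof
  fix x y z :: circle
  show "(dist x y = 0) = (x = y)"
    by (simp add: dist_circle_def of_circle_inject)
  show "dist x y \<le> dist x z + dist y z"
    by (simp add: dist_circle_def dist_triangle2)
qed (simp_all add: uniformity_circle_def open_circle_def)

end

lemma continuous_of_circle: "continuous_on UNIV of_circle"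
  unfolding continuous_on_iff by (auto simp: dist_circle_def)

lemma measurable_of_circle [measurable]: "of_circle \<in> borel_measurable borel"
  by (intro borel_measurable_continuous_onI continuous_of_circle)

lemma of_circle_Abs_cis [simp]: "of_circle (Abs_circle (cis t)) = cis t"
  by (rule Abs_circle_inverse) simp

lemma continuous_Abs_cis: "continuous_on UNIV (\<lambda>t. Abs_circle (cis t))"
proof -
  have "continuous_on UNIV cis"
    by (intro continuous_intros)
  thus ?thesis
    unfolding continuous_on_iff by (simp add: dist_circle_def)
qed

lemma measurable_Abs_cis [measurable]: "(\<lambda>t. Abs_circle (cis t)) \<in> borel_measurable borel"
  by (intro borel_measurable_continuous_onI continuous_Abs_cis)

text \<open>Normalised arc length.\<close>

definition circle_measure :: "circle measure" where
  "circle_measure =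
     distr (uniform_measure lborel {0..2 * pi}) borel (\<lambda>t. Abs_circle (cis t))"

lemma sets_circle_measure [measurable_cong, simp]: "sets circle_measure = sets borel"
  by (simp add: circle_measure_def)

lemma space_circle_measure [simp]: "space circle_measure = UNIV"
  by (simp add: circle_measure_def)

lemma prob_space_circle_measure: "prob_space circle_measure"
proof -
  have "prob_space (uniform_measure lborel {0..2 * pi})"
    by (rule prob_space_uniform_measure) auto
  thus ?thesis
    unfolding circle_measure_def by (rule prob_space.prob_space_distr) simp
qed

interpretation circle_measure: prob_space circle_measure
  by (rule prob_space_circle_measure)

section \<open>The space $L^2(\mathbb T)$\<close>

definition sq_int :: "(circle \<Rightarrow> complex) \<Rightarrow> bool" where
  "sq_int f \<longleftrightarrow> f \<in> borel_measurable borel \<and> integrable circle_measure (\<lambda>z. (cmod (f z))\<^sup>2)"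

definition ae_eq :: "(circle \<Rightarrow> complex) \<Rightarrow> (circle \<Rightarrow> complex) \<Rightarrow> bool" where
  "ae_eq f g \<longleftrightarrow> sq_int f \<and> sq_int g \<and> (AE z in circle_measure. f z = g z)"

lemma measurable_circle_eq: "borel_measurable circle_measure = borel_measurable borel"
  by (rule measurable_cong_sets) auto

lemma sq_int_0: "sq_int (\<lambda>_. 0)"
  by (simp add: sq_int_def)

lemma sq_int_measurable: "sq_int f \<Longrightarrow> f \<in> borel_measurable circle_measure"
  by (simp add: sq_int_def measurable_circle_eq)

lemma sq_int_iff: "sq_int f \<longleftrightarrow> f \<in> borel_measurable circle_measure \<and> integrable circle_measure (\<lambda>z. (cmod (f z))\<^sup>2)"
  by (simp add: sq_int_def measurable_circle_eq)

lemma norm_add_sq_le: "(cmod (a + b))\<^sup>2 \<le> 2 * (cmod a)\<^sup>2 + 2 * (cmod b)\<^sup>2"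
proof -
  have "(cmod (a + b))\<^sup>2 \<le> (cmod a + cmod b)\<^sup>2"
    by (intro power_mono norm_triangle_ineq) auto
  also have "\<dots> \<le> 2 * (cmod a)\<^sup>2 + 2 * (cmod b)\<^sup>2"
    using sum_squares_bound[of "cmod a" "cmod b"] by (simp add: power2_sum)
  finally show ?thesis .
qed

lemma sq_int_add: assumes "sq_int f" "sq_int g" shows "sq_int (\<lambda>z. f z + g z)"
proof -
  note [measurable] = sq_int_measurable[OF assms(1)] sq_int_measurable[OF assms(2)]
  have i: "integrable circle_measure (\<lambda>z. 2 * (cmod (f z))\<^sup>2 + 2 * (cmod (g z))\<^sup>2)"
    using assms by (simp add: sq_int_def)
  have "integrable circle_measure (\<lambda>z. (cmod (f z + g z))\<^sup>2)"
    by (rule Bochner_Integration.integrable_bound[OF i])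
       (use norm_add_sq_le in \<open>auto simp: abs_of_nonneg\<close>)
  thus ?thesis by (simp add: sq_int_iff)
qed

lemma sq_int_mult: assumes "f \<in> borel_measurable borel" "\<And>z. cmod (f z) \<le> C" "sq_int g"
  shows "sq_int (\<lambda>z. f z * g z)"
proof -
  note [measurable] = assms(1) sq_int_measurable[OF assms(3)]
  have i: "integrable circle_measure (\<lambda>z. C\<^sup>2 * (cmod (g z))\<^sup>2)"
    using assms by (simp add: sq_int_def)
  have "integrable circle_measure (\<lambda>z. (cmod (f z * g z))\<^sup>2)"
    by (rule Bochner_Integration.integrable_bound[OF i])
       (use assms(2) in \<open>auto simp: norm_mult power_mult_distrib intro!: mult_right_mono power_mono\<close>)
  thus ?thesis by (simp add: sq_int_iff)
qed

lemma sq_int_cmult: "sq_int f \<Longrightarrow> sq_int (\<lambda>z. c * f z)"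
  by (rule sq_int_mult[of "\<lambda>_. c" "cmod c"]) auto

lemma sq_int_uminus: "sq_int f \<Longrightarrow> sq_int (\<lambda>z. - f z)"
  using sq_int_cmult[of f "-1"] by simp

lemma sq_int_diff: "sq_int f \<Longrightarrow> sq_int g \<Longrightarrow> sq_int (\<lambda>z. f z - g z)"
  using sq_int_add[OF _ sq_int_uminus, of f g] by simp

lemma sq_int_bounded: assumes "f \<in> borel_measurable borel" "\<And>z. cmod (f z) \<le> C" shows "sq_int f"
  using sq_int_mult[OF assms, of "\<lambda>_. 1"] by (simp add: sq_int_def)

lemma sq_int_imp_integrable: assumes "sq_int f" shows "integrable circle_measure f"
proof -
  note [measurable] = sq_int_measurable[OF assms]
  have "integrable circle_measure (\<lambda>z. cmod (f z))"
    by (rule circle_measure.square_integrable_imp_integrable) (use assms in \<open>auto simp: sq_int_def\<close>)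
  thus ?thesis by (rule Bochner_Integration.integrable_norm_cancel) measurable
qed

lemma sq_int_integrable_prod: assumes "sq_int f" "sq_int g"
  shows "integrable circle_measure (\<lambda>z. f z * cnj (g z))"
proof -
  note [measurable] = sq_int_measurable[OF assms(1)] sq_int_measurable[OF assms(2)]
  have [measurable]: "cnj \<in> borel_measurable borel"
    by (intro borel_measurable_continuous_onI continuous_intros)
  have i: "integrable circle_measure (\<lambda>z. (cmod (f z))\<^sup>2 + (cmod (g z))\<^sup>2)"
    using assms by (simp add: sq_int_def)
  show ?thesis
  proof (rule Bochner_Integration.integrable_bound[OF i])
    show "AE z in circle_measure. cmod (f z * cnj (g z)) \<le> norm ((cmod (f z))\<^sup>2 + (cmod (g z))\<^sup>2)"
    proof (rule AE_I2)
      fix z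
      have "2 * (cmod (f z) * cmod (g z)) \<le> (cmod (f z))\<^sup>2 + (cmod (g z))\<^sup>2"
        using sum_squares_bound[of "cmod (f z)" "cmod (g z)"] by (simp add: mult.assoc)
      moreover have "0 \<le> cmod (f z) * cmod (g z)" by simp
      ultimately have "cmod (f z) * cmod (g z) \<le> (cmod (f z))\<^sup>2 + (cmod (g z))\<^sup>2" by linarith
      thus "cmod (f z * cnj (g z)) \<le> norm ((cmod (f z))\<^sup>2 + (cmod (g z))\<^sup>2)"
        by (simp add: norm_mult)
    qed
  qed measurable
qed

quotient_type L2 = "circle \<Rightarrow> complex" / partial: ae_eq
proof (rule part_equivpI)
  show "\<exists>x. ae_eq x x" using sq_int_0 by (auto simp: ae_eq_def)
  show "symp ae_eq" by (auto simp: symp_def ae_eq_def)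
  show "transp ae_eq" by (auto simp: transp_def ae_eq_def)
qed

instantiation L2 :: ab_group_add
begin

lift_definition zero_L2 :: L2 is "\<lambda>_. 0" by (simp add: ae_eq_def sq_int_0)
lift_definition plus_L2 :: "L2 \<Rightarrow> L2 \<Rightarrow> L2" is "\<lambda>f g z. f z + g z"
  by (auto simp: ae_eq_def sq_int_add)
lift_definition minus_L2 :: "L2 \<Rightarrow> L2 \<Rightarrow> L2" is "\<lambda>f g z. f z - g z"
  by (auto simp: ae_eq_def sq_int_diff)
lift_definition uminus_L2 :: "L2 \<Rightarrow> L2" is "\<lambda>f z. - f z"
  by (auto simp: ae_eq_def sq_int_uminus)

instance
proof
  fix x y z :: L2
  show "x + y + z = x + (y + z)"
    by transfer (simp add: ae_eq_def add.assoc sq_int_add)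
  show "x + y = y + x"
    by transfer (simp add: ae_eq_def add.commute sq_int_add)
  show "0 + x = x"
    by transfer (simp add: ae_eq_def)
  show "- x + x = 0"
    by transfer (simp add: ae_eq_def sq_int_0)
  show "x - y = x + - y"
    by transfer (simp add: ae_eq_def sq_int_diff)
qed

end

instantiation L2 :: real_vector
begin

lift_definition scaleR_L2 :: "real \<Rightarrow> L2 \<Rightarrow> L2" is "\<lambda>r f z. complex_of_real r * f z"
  by (auto simp: ae_eq_def sq_int_cmult)

instance
proof
  fix x y :: L2 and a b :: real
  show "a *\<^sub>R (x + y) = a *\<^sub>R x + a *\<^sub>R y"
    by transfer (simp add: ae_eq_def distrib_left sq_int_add sq_int_cmult)
  show "(a + b) *\<^sub>R x = a *\<^sub>R x + b *\<^sub>R x"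
    by transfer (simp add: ae_eq_def distrib_right sq_int_add sq_int_cmult)
  show "a *\<^sub>R b *\<^sub>R x = (a * b) *\<^sub>R x"
    by transfer (simp add: ae_eq_def mult.assoc sq_int_cmult)
  show "1 *\<^sub>R x = x"
    by transfer (simp add: ae_eq_def)
qed

end

lemma measurable_cnj [measurable]: "cnj \<in> borel_measurable borel"
  by (intro borel_measurable_continuous_onI continuous_intros)

lemma Re_mult_cnj_self: "Re (a * cnj a) = (cmod a)\<^sup>2"
  by (simp only: complex_norm_square[symmetric] of_real_power[symmetric] Re_complex_of_real)

lemma Re_integral_self:
  assumes "sq_int f"
  shows "Re (LINT z|circle_measure. f z * cnj (f z)) = (LINT z|circle_measure. (cmod (f z))\<^sup>2)"
proof -
  have "Re (LINT z|circle_measure. f z * cnj (f z)) = (LINT z|circle_measure. Re (f z * cnj (f z)))"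
    by (rule integral_Re[symmetric]) (rule sq_int_integrable_prod[OF assms assms])
  thus ?thesis by (simp only: Re_mult_cnj_self)
qed

instantiation L2 :: real_inner
begin

lift_definition inner_L2 :: "L2 \<Rightarrow> L2 \<Rightarrow> real" is
  "\<lambda>f g. Re (LINT z|circle_measure. f z * cnj (g z))"
proof -
  fix f f' g g' assume a: "ae_eq f f'" "ae_eq g g'"
  note [measurable] = sq_int_measurable[of f] sq_int_measurable[of f']
    sq_int_measurable[of g] sq_int_measurable[of g']
  have "(LINT z|circle_measure. f z * cnj (g z)) = (LINT z|circle_measure. f' z * cnj (g' z))"
    using a by (intro integral_cong_AE) (auto simp: ae_eq_def)
  thus "Re (LINT z|circle_measure. f z * cnj (g z)) = Re (LINT z|circle_measure. f' z * cnj (g' z))"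
    by simp
qed

definition norm_L2 :: "L2 \<Rightarrow> real" where "norm_L2 f = sqrt (inner f f)"
definition sgn_L2 :: "L2 \<Rightarrow> L2" where "sgn_L2 f = f /\<^sub>R norm f"
definition dist_L2 :: "L2 \<Rightarrow> L2 \<Rightarrow> real" where "dist_L2 f g = norm (f - g)"
definition uniformity_L2 :: "(L2 \<times> L2) filter" where
  "uniformity_L2 = (INF e\<in>{0<..}. principal {(x, y). dist x y < e})"
definition open_L2 :: "L2 set \<Rightarrow> bool" where
  "open_L2 U \<longleftrightarrow> (\<forall>x\<in>U. \<forall>\<^sub>F (x', y) in uniformity. x' = x \<longrightarrow> y \<in> U)"

instance
proof
  fix x y z :: L2 and r :: real
  show "inner x y = inner y x"
  proof (transfer, goal_cases)
    case (1 f g)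
    hence fg: "sq_int f" "sq_int g" by (auto simp: ae_eq_def)
    have "(LINT z|circle_measure. g z * cnj (f z)) = (LINT z|circle_measure. cnj (f z * cnj (g z)))"
      by (intro Bochner_Integration.integral_cong) (auto simp: mult.commute)
    also have "\<dots> = cnj (LINT z|circle_measure. f z * cnj (g z))"
      by (rule Bochner_Integration.integral_cnj)
    finally show ?case by simp
  qed
  show "inner (x + y) z = inner x z + inner y z"
  proof (transfer, goal_cases)
    case (1 f g h)
    hence "sq_int f" "sq_int g" "sq_int h" by (auto simp: ae_eq_def)
    thus ?case
      unfolding distrib_right
      by (subst Bochner_Integration.integral_add) (auto intro: sq_int_integrable_prod)
  qed
  show "inner (r *\<^sub>R x) y = r * inner x y"
    by transfer (simp only: mult.assoc integral_mult_right_zero times_complex.sel, simp)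
  show "0 \<le> inner x x"
  proof (transfer, goal_cases)
    case (1 f)
    hence "sq_int f" by (simp add: ae_eq_def)
    from Re_integral_self[OF this] show ?case by simp
  qed
  show "(inner x x = 0) = (x = 0)"
  proof (transfer, goal_cases)
    case (1 f)
    hence f: "sq_int f" by (simp add: ae_eq_def)
    hence "integrable circle_measure (\<lambda>z. (cmod (f z))\<^sup>2)" by (simp add: sq_int_def)
    from integral_nonneg_eq_0_iff_AE[OF this]
    have "(LINT z|circle_measure. (cmod (f z))\<^sup>2) = 0 \<longleftrightarrow> (AE z in circle_measure. f z = 0)"
      by simp
    thus ?case unfolding Re_integral_self[OF f] using f sq_int_0 by (simp add: ae_eq_def)
  qed
qed (rule dist_L2_def sgn_L2_def uniformity_L2_def open_L2_def norm_L2_def)+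

end

lemma ae_eq_rep_L2: "ae_eq (rep_L2 x) (rep_L2 x)"
  using Quotient3_rep_reflp[OF Quotient3_L2] by simp

lemma sq_int_rep_L2: "sq_int (rep_L2 x)"
  using ae_eq_rep_L2[of x] by (simp add: ae_eq_def)

lemma abs_rep_L2: "abs_L2 (rep_L2 x) = x"
  by (rule Quotient3_abs_rep[OF Quotient3_L2])

lemma ae_eq_rep_abs: "sq_int f \<Longrightarrow> ae_eq (rep_L2 (abs_L2 f)) f"
  by (rule Quotient3_rep_abs[OF Quotient3_L2]) (simp add: ae_eq_def)

lemma abs_L2_minus: "sq_int f \<Longrightarrow> sq_int g \<Longrightarrow> abs_L2 f - abs_L2 g = abs_L2 (\<lambda>z. f z - g z)"
  by (rule minus_L2.abs_eq) (auto simp: ae_eq_def)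

lemma norm_abs_L2:
  assumes "sq_int f" shows "(norm (abs_L2 f))\<^sup>2 = (LINT z|circle_measure. (cmod (f z))\<^sup>2)"
proof -
  have "ae_eq f f" using assms by (simp add: ae_eq_def)
  hence "(norm (abs_L2 f))\<^sup>2 = Re (LINT z|circle_measure. f z * cnj (f z))"
    unfolding power2_norm_eq_inner by (intro inner_L2.abs_eq)
  thus ?thesis unfolding Re_integral_self[OF assms] .
qed

instantiation L2 :: complex_normed_vector
begin

lift_definition scaleC_L2 :: "complex \<Rightarrow> L2 \<Rightarrow> L2" is "\<lambda>c f z. c * f z"
  by (auto simp: ae_eq_def sq_int_cmult)

instance
proof
  fix x y :: L2 and a b :: complex and r :: real
  show "a *\<^sub>C (x + y) = a *\<^sub>C x + a *\<^sub>C y"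
    by transfer (simp add: ae_eq_def distrib_left distrib_right mult.assoc sq_int_add sq_int_cmult)
  show "(a + b) *\<^sub>C x = a *\<^sub>C x + b *\<^sub>C x"
    by transfer (simp add: ae_eq_def distrib_left distrib_right mult.assoc sq_int_add sq_int_cmult)
  show "a *\<^sub>C (b *\<^sub>C x) = (a * b) *\<^sub>C x"
    by transfer (simp add: ae_eq_def distrib_left distrib_right mult.assoc sq_int_add sq_int_cmult)
  show "complex_of_real r *\<^sub>C x = r *\<^sub>R x"
    by transfer (simp add: ae_eq_def sq_int_cmult)
  have ax: "a *\<^sub>C x = abs_L2 (\<lambda>z. a * rep_L2 x z)"
    using scaleC_L2.abs_eq[OF ae_eq_rep_L2] by (simp add: abs_rep_L2)
  have "(norm (a *\<^sub>C x))\<^sup>2 = (LINT z|circle_measure. (cmod (a * rep_L2 x z))\<^sup>2)"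
    unfolding ax by (intro norm_abs_L2 sq_int_cmult sq_int_rep_L2)
  also have "\<dots> = (cmod a)\<^sup>2 * (LINT z|circle_measure. (cmod (rep_L2 x z))\<^sup>2)"
    by (simp add: norm_mult power_mult_distrib)
  also have "\<dots> = (cmod a * norm x)\<^sup>2"
    using norm_abs_L2[OF sq_int_rep_L2, of x] by (simp add: abs_rep_L2 power_mult_distrib)
  finally show "norm (a *\<^sub>C x) = cmod a * norm x"
    by (rule power2_eq_imp_eq) auto
qed

end

lemma nn_integral_sq:
  assumes "sq_int f"
  shows "(\<integral>\<^sup>+z. ennreal ((cmod (f z))\<^sup>2) \<partial>circle_measure) = ennreal ((norm (abs_L2 f))\<^sup>2)"
  using assms unfolding norm_abs_L2[OF assms]
  by (intro nn_integral_eq_integral) (auto simp: sq_int_def)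

lemma nn_integral_norm_le:
  assumes f: "sq_int f"
  shows "(\<integral>\<^sup>+z. ennreal (cmod (f z)) \<partial>circle_measure) \<le> ennreal (norm (abs_L2 f))"
proof -
  note [measurable] = sq_int_measurable[OF f]
  let ?I = "\<integral>\<^sup>+z. ennreal (cmod (f z)) \<partial>circle_measure"
  have "?I\<^sup>2 \<le> (\<integral>\<^sup>+z. (ennreal (cmod (f z)))\<^sup>2 \<partial>circle_measure) * (\<integral>\<^sup>+z. 1\<^sup>2 \<partial>circle_measure)"
    using Cauchy_Schwarz_nn_integral[of "\<lambda>z. ennreal (cmod (f z))" circle_measure "\<lambda>_. 1"] by simp
  also have "\<dots> = (ennreal (norm (abs_L2 f)))\<^sup>2"
    using nn_integral_sq[OF f] circle_measure.emeasure_space_1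
    by (simp add: ennreal_power)
  finally have le: "?I\<^sup>2 \<le> (ennreal (norm (abs_L2 f)))\<^sup>2" .
  define c where "c = (LINT z|circle_measure. cmod (f z))"
  have c0: "0 \<le> c" by (simp add: c_def)
  have I: "?I = ennreal c"
    unfolding c_def using sq_int_imp_integrable[OF f] by (intro nn_integral_eq_integral) auto
  have "ennreal (c\<^sup>2) \<le> ennreal ((norm (abs_L2 f))\<^sup>2)"
    using le c0 unfolding I by (simp only: ennreal_power norm_ge_zero)
  hence "c\<^sup>2 \<le> (norm (abs_L2 f))\<^sup>2" by (subst (asm) ennreal_le_iff) auto
  hence "c \<le> norm (abs_L2 f)" by (rule power2_le_imp_le) auto
  thus ?thesis unfolding I by (rule ennreal_leI)
qed

lemma L2_Cauchy_convergent:
  fixes X :: "nat \<Rightarrow> L2" assumes X: "Cauchy X" shows "convergent X"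
proof -
  define f where "f n = rep_L2 (X n)" for n
  have sq: "sq_int (f n)" for n by (simp add: f_def sq_int_rep_L2)
  have [measurable]: "f n \<in> borel_measurable circle_measure" for n by (rule sq_int_measurable[OF sq])
  have Xf: "X n = abs_L2 (f n)" for n by (simp add: f_def abs_rep_L2)
  have diff: "abs_L2 (\<lambda>z. f m z - f n z) = X m - X n" for m n
    by (simp add: Xf abs_L2_minus sq)
  have "\<exists>N. \<forall>m\<ge>N. \<forall>n\<ge>N. norm (X m - X n) < (1/2)^k" for k :: nat
    using X unfolding Cauchy_iff by (meson half_gt_zero zero_less_one zero_less_power)
  then obtain N where N: "\<And>k m n. m \<ge> N k \<Longrightarrow> n \<ge> N k \<Longrightarrow> norm (X m - X n) < (1/2)^k" by metis
  define r where "r k = (\<Sum>i\<le>k. N i) + k" for k :: nat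
  have rN: "N k \<le> r k" for k
    unfolding r_def using member_le_sum[of k "{..k}" N] by simp
  have r_suc: "r k \<le> r (Suc k)" for k by (simp add: r_def)
  have r_ge: "k \<le> r k" for k by (simp add: r_def)
  define g where "g k z = f (r (Suc k)) z - f (r k) z" for k z
  have [measurable]: "g k \<in> borel_measurable circle_measure" for k unfolding g_def by measurable
  have gint: "(\<integral>\<^sup>+z. ennreal (cmod (g k z)) \<partial>circle_measure) \<le> ennreal ((1/2)^k)" for k
  proof -
    have "(\<integral>\<^sup>+z. ennreal (cmod (g k z)) \<partial>circle_measure) \<le> ennreal (norm (X (r (Suc k)) - X (r k)))"
      unfolding g_def
      using nn_integral_norm_le[OF sq_int_diff[OF sq[of "r (Suc k)"] sq[of "r k"]]] by (simp only: diff)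
    also have "\<dots> \<le> ennreal ((1/2)^k)"
      by (intro ennreal_leI less_imp_le N rN order_trans[OF rN r_suc])
    finally show ?thesis .
  qed
  have "(\<integral>\<^sup>+z. (\<Sum>k. ennreal (cmod (g k z))) \<partial>circle_measure)
      = (\<Sum>k. \<integral>\<^sup>+z. ennreal (cmod (g k z)) \<partial>circle_measure)"
    by (rule nn_integral_suminf) measurable
  also have "\<dots> \<le> (\<Sum>k. ennreal ((1/2)^k))"
    by (intro suminf_le gint) auto
  also have "\<dots> = ennreal (\<Sum>k. (1/2)^k)"
    by (rule suminf_ennreal2) (auto intro: summable_geometric)
  finally have "(\<integral>\<^sup>+z. (\<Sum>k. ennreal (cmod (g k z))) \<partial>circle_measure) \<noteq> \<infinity>"
    by (auto simp: top_unique)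
  hence "AE z in circle_measure. (\<Sum>k. ennreal (cmod (g k z))) \<noteq> \<infinity>"
    by (intro nn_integral_PInf_AE) measurable
  hence conv: "AE z in circle_measure. convergent (\<lambda>k. f (r k) z)"
  proof (rule AE_mp, intro AE_I2 impI)
    fix z assume "(\<Sum>k. ennreal (cmod (g k z))) \<noteq> \<infinity>"
    hence "summable (\<lambda>k. cmod (g k z))"
      by (intro summable_suminf_not_top) auto
    hence "summable (\<lambda>k. g k z)" by (rule summable_norm_cancel)
    hence "convergent (\<lambda>n. \<Sum>k<n. g k z)" by (simp add: summable_iff_convergent)
    hence "convergent (\<lambda>n. f (r n) z - f (r 0) z)"
      unfolding g_def by (subst (asm) sum_lessThan_telescope)
    from convergent_add[OF this convergent_const[of "f (r 0) z"]]
    show "convergent (\<lambda>k. f (r k) z)" by simp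
  qed
  define h where "h z = lim (\<lambda>k. f (r k) z)" for z
  have h_meas [measurable]: "h \<in> borel_measurable circle_measure"
    unfolding h_def by measurable
  have fatou: "(\<integral>\<^sup>+z. ennreal ((cmod (h z - f n z))\<^sup>2) \<partial>circle_measure) \<le> ennreal (((1/2)^k)\<^sup>2)"
    if n: "n \<ge> N k" for n k
  proof -
    have "AE z in circle_measure. ennreal ((cmod (h z - f n z))\<^sup>2)
        = liminf (\<lambda>j. ennreal ((cmod (f (r j) z - f n z))\<^sup>2))"
      using conv
    proof (rule AE_mp, intro AE_I2 impI)
      fix z assume "convergent (\<lambda>k. f (r k) z)"
      hence "(\<lambda>k. f (r k) z) \<longlonglongrightarrow> h z" by (simp add: h_def convergent_LIMSEQ_iff)
      hence "(\<lambda>j. ennreal ((cmod (f (r j) z - f n z))\<^sup>2)) \<longlonglongrightarrow> ennreal ((cmod (h z - f n z))\<^sup>2)"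
        by (intro tendsto_intros)
      thus "ennreal ((cmod (h z - f n z))\<^sup>2) = liminf (\<lambda>j. ennreal ((cmod (f (r j) z - f n z))\<^sup>2))"
        by (intro lim_imp_Liminf[symmetric]) auto
    qed
    hence "(\<integral>\<^sup>+z. ennreal ((cmod (h z - f n z))\<^sup>2) \<partial>circle_measure)
        = (\<integral>\<^sup>+z. liminf (\<lambda>j. ennreal ((cmod (f (r j) z - f n z))\<^sup>2)) \<partial>circle_measure)"
      by (rule nn_integral_cong_AE)
    also have "\<dots> \<le> liminf (\<lambda>j. \<integral>\<^sup>+z. ennreal ((cmod (f (r j) z - f n z))\<^sup>2) \<partial>circle_measure)"
      by (rule nn_integral_liminf) measurable
    also have "\<dots> \<le> ennreal (((1/2)^k)\<^sup>2)"
    proof (rule order_trans[OF Liminf_mono Liminf_le])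
      show "\<forall>\<^sub>F j in sequentially. (\<integral>\<^sup>+z. ennreal ((cmod (f (r j) z - f n z))\<^sup>2) \<partial>circle_measure)
          \<le> ennreal (((1/2)^k)\<^sup>2)"
      proof (rule eventually_sequentiallyI[of "N k"])
        fix j assume "N k \<le> j"
        hence "N k \<le> r j" using r_ge order_trans by blast
        hence "(norm (X (r j) - X n))\<^sup>2 \<le> ((1/2)^k)\<^sup>2"
          using less_imp_le[OF N[OF _ n]] by (intro power_mono) auto
        thus "(\<integral>\<^sup>+z. ennreal ((cmod (f (r j) z - f n z))\<^sup>2) \<partial>circle_measure) \<le> ennreal (((1/2)^k)\<^sup>2)"
          unfolding nn_integral_sq[OF sq_int_diff[OF sq sq]] diff
          by (simp add: ennreal_power ennreal_leI)
      qed
    qed auto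
    finally show ?thesis .
  qed
  have "integrable circle_measure (\<lambda>z. (cmod (h z - f (N 0) z))\<^sup>2)"
  proof (rule integrableI_bounded)
    have "(\<integral>\<^sup>+z. ennreal ((cmod (h z - f (N 0) z))\<^sup>2) \<partial>circle_measure) < \<infinity>"
      using fatou[of 0 "N 0"] by (rule le_less_trans) auto
    thus "(\<integral>\<^sup>+z. ennreal (norm ((cmod (h z - f (N 0) z))\<^sup>2)) \<partial>circle_measure) < \<infinity>" by simp
  qed measurable
  hence "sq_int (\<lambda>z. h z - f (N 0) z)" by (simp add: sq_int_iff)
  from sq_int_add[OF this sq[of "N 0"]] have sqh: "sq_int h" by simp
  have bound: "norm (X n - abs_L2 h) \<le> (1/2)^k" if "n \<ge> N k" for n k
  proof -
    have "ennreal ((norm (abs_L2 h - X n))\<^sup>2) \<le> ennreal (((1/2)^k)\<^sup>2)"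
      using fatou[OF that] nn_integral_sq[OF sq_int_diff[OF sqh sq[of n]]]
      by (simp add: Xf abs_L2_minus sqh sq ennreal_power)
    hence "(norm (abs_L2 h - X n))\<^sup>2 \<le> ((1/2)^k)\<^sup>2" by (subst (asm) ennreal_le_iff) auto
    hence "norm (abs_L2 h - X n) \<le> (1/2)^k" by (rule power2_le_imp_le) auto
    thus ?thesis by (simp add: norm_minus_commute)
  qed
  have "X \<longlonglongrightarrow> abs_L2 h"
  proof (rule LIMSEQ_I)
    fix e :: real assume "e > 0"
    then obtain k where "(1/2)^k < e" using real_arch_pow_inv[of e "1/2"] by auto
    thus "\<exists>M. \<forall>n\<ge>M. norm (X n - abs_L2 h) < e" using bound[of k] by (meson le_less_trans)
  qed
  thus ?thesis by (rule convergentI)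
qed

instance L2 :: complex_banach
proof
  fix X :: "nat \<Rightarrow> L2" assume "Cauchy X"
  thus "convergent X" by (rule L2_Cauchy_convergent)
qed


section \<open>Fourier coefficients, the Riesz projection and $H^2$\<close>

lemma measurable_powi [measurable]: "(\<lambda>z. of_circle z powi n) \<in> borel_measurable borel"
  by (intro borel_measurable_continuous_onI continuous_intros continuous_of_circle) auto

lift_definition fourier_coeff :: "L2 \<Rightarrow> int \<Rightarrow> complex" is
  "\<lambda>f n. LINT z|circle_measure. f z * (of_circle z powi (- n))"
proof -
  fix f g assume a: "ae_eq f g"
  note [measurable] = sq_int_measurable[of f] sq_int_measurable[of g]
  have "(LINT z|circle_measure. f z * (of_circle z powi (- n))) =
      (LINT z|circle_measure. g z * (of_circle z powi (- n)))" for n :: int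
    using a by (intro integral_cong_AE) (auto simp: ae_eq_def)
  thus "(\<lambda>n::int. LINT z|circle_measure. f z * (of_circle z powi (- n))) =
      (\<lambda>n. LINT z|circle_measure. g z * (of_circle z powi (- n)))"
    by (rule ext)
qed

definition char_L2 :: "int \<Rightarrow> L2" where
  "char_L2 n = abs_L2 (\<lambda>z. of_circle z powi n)"

text \<open>$P_+\colon \sum_{n\in\mathbb Z} a_n z^n \mapsto \sum_{n\ge 0} a_n z^n$, the series converging
  in $L^2$.\<close>

definition riesz_proj :: "L2 \<Rightarrow> L2" where
  "riesz_proj f = (\<Sum>n. fourier_coeff f (int n) *\<^sub>C char_L2 (int n))"

lemma sq_int_powi: "sq_int (\<lambda>z. of_circle z powi n)"
  by (rule sq_int_bounded[of _ 1]) (auto simp: norm_power_int)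

lemma of_circle_powi_minus: "of_circle z powi (- n) = cnj (of_circle z powi n)"
proof -
  have "of_circle z powi n * cnj (of_circle z powi n) = 1"
    by (simp add: complex_norm_square[symmetric] norm_power_int del: complex_cnj_power_int)
  thus ?thesis by (simp add: power_int_minus field_simps del: complex_cnj_power_int)
qed

lemma fourier_coeff_abs:
  "sq_int f \<Longrightarrow> fourier_coeff (abs_L2 f) n = (LINT z|circle_measure. f z * cnj (of_circle z powi n))"
  by (subst fourier_coeff.abs_eq) (auto simp: ae_eq_def of_circle_powi_minus)

lemma fourier_coeff_add: "fourier_coeff (f + g) n = fourier_coeff f n + fourier_coeff g n"
proof -
  define u v where "u = rep_L2 f" "v = rep_L2 g"
  have uv: "f = abs_L2 u" "g = abs_L2 v" "sq_int u" "sq_int v"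
    by (auto simp: u_v_def abs_rep_L2 sq_int_rep_L2)
  have "abs_L2 u + abs_L2 v = abs_L2 (\<lambda>z. u z + v z)"
    using uv by (intro plus_L2.abs_eq) (auto simp: ae_eq_def)
  thus ?thesis
    unfolding uv(1,2)
    by (simp add: fourier_coeff_abs uv(3,4) sq_int_add distrib_right
        Bochner_Integration.integral_add sq_int_integrable_prod sq_int_powi
        del: complex_cnj_power_int)
qed

lemma fourier_coeff_scaleC: "fourier_coeff (c *\<^sub>C f) n = c * fourier_coeff f n"
proof -
  define u where "u = rep_L2 f"
  have u: "f = abs_L2 u" "sq_int u"
    by (auto simp: u_def abs_rep_L2 sq_int_rep_L2)
  have "c *\<^sub>C abs_L2 u = abs_L2 (\<lambda>z. c * u z)"
    using u by (intro scaleC_L2.abs_eq) (auto simp: ae_eq_def)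
  thus ?thesis
    unfolding u(1) by (simp add: fourier_coeff_abs u(2) sq_int_cmult mult.assoc)
qed

lemma fourier_coeff_0: "fourier_coeff 0 n = 0"
  using fourier_coeff_add[of 0 0 n] by simp

lemma fourier_coeff_scaleR: "fourier_coeff (r *\<^sub>R f) n = complex_of_real r * fourier_coeff f n"
  by (simp only: scaleC_of_real[symmetric] fourier_coeff_scaleC)

lemma fourier_coeff_uminus: "fourier_coeff (- f) n = - fourier_coeff f n"
  using fourier_coeff_scaleR[of "-1" f n] by simp

lemma fourier_coeff_diff: "fourier_coeff (f - g) n = fourier_coeff f n - fourier_coeff g n"
  using fourier_coeff_add[of f "-g" n] by (simp add: fourier_coeff_uminus)

lemma norm_fourier_coeff_le: "cmod (fourier_coeff f n) \<le> norm f"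
proof -
  define u where "u = rep_L2 f"
  have u: "f = abs_L2 u" "sq_int u"
    by (auto simp: u_def abs_rep_L2 sq_int_rep_L2)
  have "ennreal (cmod (fourier_coeff f n)) \<le> (\<integral>\<^sup>+z. ennreal (cmod (u z * cnj (of_circle z powi n))) \<partial>circle_measure)"
    unfolding u(1) fourier_coeff_abs[OF u(2)]
    by (rule integral_norm_bound_ennreal) (rule sq_int_integrable_prod[OF u(2) sq_int_powi])
  also have "\<dots> \<le> ennreal (norm f)"
    using nn_integral_norm_le[OF u(2)] by (simp add: norm_mult norm_power_int u(1))
  finally show ?thesis by simp
qed

lemma bounded_linear_fourier_coeff: "bounded_linear (\<lambda>f. fourier_coeff f n)"
  by (rule bounded_linear_intro[of _ 1])
     (simp_all add: fourier_coeff_add fourier_coeff_scaleR norm_fourier_coeff_le scaleR_conv_of_real)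

lemma integral_circle_measure:
  fixes f :: "circle \<Rightarrow> complex" assumes [measurable]: "f \<in> borel_measurable borel"
  shows "(LINT z|circle_measure. f z) =
    (LINT t|lborel. indicator {0..2 * pi} t *\<^sub>R f (Abs_circle (cis t))) / (2 * pi)"
proof -
  have d: "uniform_measure lborel {0..2 * pi} =
      density lborel (\<lambda>t. ennreal (indicator {0..2 * pi} t / (2 * pi)))"
    unfolding uniform_measure_def
    by (intro density_cong) (auto simp: indicator_def divide_ennreal[symmetric])
  have "(LINT z|circle_measure. f z) =
      (LINT t|uniform_measure lborel {0..2 * pi}. f (Abs_circle (cis t)))"
    unfolding circle_measure_def by (rule integral_distr) measurable
  also have "\<dots> = (LINT t|lborel. (indicator {0..2 * pi} t / (2 * pi)) *\<^sub>R f (Abs_circle (cis t)))"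
    unfolding d by (rule integral_density) auto
  also have "\<dots> = (LINT t|lborel. (1 / (2 * pi)) *\<^sub>R (indicator {0..2 * pi} t *\<^sub>R f (Abs_circle (cis t))))"
    by simp
  also have "\<dots> = (1 / (2 * pi)) *\<^sub>R (LINT t|lborel. indicator {0..2 * pi} t *\<^sub>R f (Abs_circle (cis t)))"
    by (rule integral_scaleR_right)
  finally show ?thesis by (simp add: scaleR_conv_of_real)
qed

lemma integral_circle_powi:
  "(LINT z|circle_measure. of_circle z powi n) = (if n = 0 then 1 else 0)"
proof (cases "n = 0")
  case True
  thus ?thesis using circle_measure.prob_space by simp
next
  case False
  have "(LINT t|lborel. indicator {0..2 * pi} t *\<^sub>R cis (of_int n * t)) =
      cis (of_int n * (2 * pi)) / (\<i> * of_int n) - cis (of_int n * 0) / (\<i> * of_int n)"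
  proof (rule integral_FTC_atLeastAtMost)
    show "continuous_on {0..2 * pi} (\<lambda>t. cis (of_int n * t))" by (intro continuous_intros)
    fix t :: real
    show "((\<lambda>t. cis (of_int n * t) / (\<i> * of_int n)) has_vector_derivative cis (of_int n * t))
        (at t within {0..2 * pi})"
      using False by (auto intro!: derivative_eq_intros simp: has_vector_derivative_def
        scaleR_conv_of_real fun_eq_iff mult.left_commute[of "complex_of_real _" \<i>])
  qed simp
  also have "cis (of_int n * (2 * pi)) = 1"
    using cis_multiple_2pi[of "of_int n"] by (simp add: mult.commute mult.left_commute)
  finally have "(LINT t|lborel. indicator {0..2 * pi} t *\<^sub>R cis (of_int n * t)) = 0" by simp
  thus ?thesis
    using False by (simp add: integral_circle_measure cis_power_int)
qed

lemma fourier_coeff_char: "fourier_coeff (char_L2 m) n = (if m = n then 1 else 0)"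
proof -
  have "fourier_coeff (char_L2 m) n = (LINT z|circle_measure. of_circle z powi (m - n))"
    unfolding char_L2_def fourier_coeff_abs[OF sq_int_powi]
    by (intro Bochner_Integration.integral_cong)
       (simp_all add: of_circle_powi_minus[symmetric] power_int_add[symmetric]
         del: complex_cnj_power_int)
  also have "\<dots> = (if m = n then 1 else 0)"
    by (simp add: integral_circle_powi)
  finally show ?thesis .
qed

lemma inner_char: "inner f (char_L2 n) = Re (fourier_coeff f n)"
proof -
  define u where "u = rep_L2 f"
  have u: "f = abs_L2 u" "sq_int u"
    by (auto simp: u_def abs_rep_L2 sq_int_rep_L2)
  have "inner (abs_L2 u) (abs_L2 (\<lambda>z. of_circle z powi n)) =
      Re (LINT z|circle_measure. u z * cnj (of_circle z powi n))"
    using u(2) sq_int_powi by (intro inner_L2.abs_eq) (auto simp: ae_eq_def)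
  thus ?thesis
    unfolding char_L2_def u(1) by (simp add: fourier_coeff_abs u(2))
qed

lemma inner_scaleC_left: fixes f g :: L2 shows "inner (c *\<^sub>C f) g = inner f (cnj c *\<^sub>C g)"
proof -
  define u v where "u = rep_L2 f" "v = rep_L2 g"
  have uv: "f = abs_L2 u" "g = abs_L2 v" "sq_int u" "sq_int v"
    by (auto simp: u_v_def abs_rep_L2 sq_int_rep_L2)
  have "c *\<^sub>C abs_L2 u = abs_L2 (\<lambda>z. c * u z)"
    using uv by (intro scaleC_L2.abs_eq) (auto simp: ae_eq_def)
  moreover have "cnj c *\<^sub>C abs_L2 v = abs_L2 (\<lambda>z. cnj c * v z)"
    using uv by (intro scaleC_L2.abs_eq) (auto simp: ae_eq_def)
  moreover have "inner (abs_L2 (\<lambda>z. c * u z)) (abs_L2 v) =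
      Re (LINT z|circle_measure. (c * u z) * cnj (v z))"
    using uv by (intro inner_L2.abs_eq) (auto simp: ae_eq_def sq_int_cmult)
  moreover have "inner (abs_L2 u) (abs_L2 (\<lambda>z. cnj c * v z)) =
      Re (LINT z|circle_measure. u z * cnj (cnj c * v z))"
    using uv by (intro inner_L2.abs_eq) (auto simp: ae_eq_def sq_int_cmult)
  moreover have "(\<lambda>z. u z * cnj (cnj c * v z)) = (\<lambda>z. (c * u z) * cnj (v z))"
    by (simp add: fun_eq_iff)
  ultimately show ?thesis unfolding uv(1,2) by simp
qed

lemma inner_scaleC_char: "inner f (c *\<^sub>C char_L2 n) = Re (cnj c * fourier_coeff f n)"
  using inner_scaleC_left[of "cnj c" f "char_L2 n"] by (simp add: inner_char fourier_coeff_scaleC)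

lemma fourier_coeff_sum: "fourier_coeff (\<Sum>i\<in>A. f i) n = (\<Sum>i\<in>A. fourier_coeff (f i) n)"
  by (rule Real_Vector_Spaces.linear_sum)
     (rule bounded_linear.linear[OF bounded_linear_fourier_coeff])

lemma norm_partial_sum:
  fixes A :: "nat set" assumes "finite A"
  shows "(norm (\<Sum>k\<in>A. a k *\<^sub>C char_L2 (int k)))\<^sup>2 = (\<Sum>k\<in>A. (cmod (a k))\<^sup>2)"
proof -
  let ?S = "\<Sum>k\<in>A. a k *\<^sub>C char_L2 (int k)"
  have c: "fourier_coeff ?S (int n) = a n" if "n \<in> A" for n
    using that assms
    by (simp add: fourier_coeff_sum fourier_coeff_scaleC fourier_coeff_char if_distrib sum.delta'
        cong: if_cong)
  have "(norm ?S)\<^sup>2 = (\<Sum>k\<in>A. inner ?S (a k *\<^sub>C char_L2 (int k)))"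
    by (simp add: power2_norm_eq_inner inner_sum_right)
  also have "\<dots> = (\<Sum>k\<in>A. Re (cnj (a k) * a k))"
    by (intro sum.cong refl) (simp add: inner_scaleC_char c del: times_complex.sel)
  also have "\<dots> = (\<Sum>k\<in>A. (cmod (a k))\<^sup>2)"
    by (intro sum.cong refl) (simp only: mult.commute[of "cnj _"] Re_mult_cnj_self)
  finally show ?thesis .
qed

lemma bessel:
  fixes A :: "nat set" assumes "finite A"
  shows "(\<Sum>k\<in>A. (cmod (fourier_coeff f (int k)))\<^sup>2) \<le> (norm f)\<^sup>2"
proof -
  let ?a = "\<lambda>k. fourier_coeff f (int k)"
  let ?S = "\<Sum>k\<in>A. ?a k *\<^sub>C char_L2 (int k)"
  let ?q = "\<Sum>k\<in>A. (cmod (?a k))\<^sup>2"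
  have "inner f ?S = (\<Sum>k\<in>A. Re (cnj (?a k) * ?a k))"
    by (simp add: inner_sum_right inner_scaleC_char del: times_complex.sel)
  also have "\<dots> = ?q"
    by (intro sum.cong refl) (simp only: mult.commute[of "cnj _"] Re_mult_cnj_self)
  finally have i: "inner f ?S = ?q" .
  have "0 \<le> (norm (f - ?S))\<^sup>2" by simp
  also have "\<dots> = (norm f)\<^sup>2 - 2 * inner f ?S + (norm ?S)\<^sup>2"
    by (simp add: power2_norm_eq_inner inner_diff inner_commute)
  also have "\<dots> = (norm f)\<^sup>2 - ?q"
    unfolding i norm_partial_sum[OF assms] by simp
  finally show ?thesis by simp
qed

lemma riesz_proj_sums:
  "(\<lambda>n. fourier_coeff f (int n) *\<^sub>C char_L2 (int n)) sums riesz_proj f"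
proof -
  let ?t = "\<lambda>n. fourier_coeff f (int n) *\<^sub>C char_L2 (int n)"
  have sq: "summable (\<lambda>k. (cmod (fourier_coeff f (int k)))\<^sup>2)"
    by (rule bounded_imp_summable[of _ "(norm f)\<^sup>2"]) (auto intro: bessel)
  have "summable ?t"
    unfolding summable_Cauchy
  proof (intro allI impI)
    fix e :: real assume "e > 0"
    then obtain N where N: "\<And>m n. m \<ge> N \<Longrightarrow>
        norm (\<Sum>k\<in>{m..<n}. (cmod (fourier_coeff f (int k)))\<^sup>2) < e\<^sup>2"
      using sq unfolding summable_Cauchy by (meson zero_less_power)
    have "norm (sum ?t {m..<n}) < e" if "m \<ge> N" for m n
    proof (rule power2_less_imp_less)
      show "(norm (sum ?t {m..<n}))\<^sup>2 < e\<^sup>2"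
        using N[OF that, of n] by (subst norm_partial_sum) auto
    qed (use \<open>e > 0\<close> in simp)
    thus "\<exists>N. \<forall>m\<ge>N. \<forall>n. norm (sum ?t {m..<n}) < e" by blast
  qed
  thus ?thesis unfolding riesz_proj_def by (rule summable_sums)
qed

lemma fourier_coeff_riesz_proj:
  "fourier_coeff (riesz_proj f) n = (if n \<ge> 0 then fourier_coeff f n else 0)"
proof -
  let ?t = "\<lambda>k. fourier_coeff f (int k) * (if int k = n then 1 else 0)"
  have "?t sums fourier_coeff (riesz_proj f) n"
    using bounded_linear.sums[OF bounded_linear_fourier_coeff riesz_proj_sums]
    by (simp add: fourier_coeff_scaleC fourier_coeff_char)
  moreover have "?t sums (if n \<ge> 0 then fourier_coeff f n else 0)"
  proof (cases "n \<ge> 0")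
    case True
    have "?t = (\<lambda>k. if k = nat n then fourier_coeff f n else 0)"
      using True by (auto simp: fun_eq_iff)
    thus ?thesis using True sums_single[of "nat n" "\<lambda>_. fourier_coeff f n"] by simp
  next
    case False
    hence "?t = (\<lambda>_. 0)" by (auto simp: fun_eq_iff)
    thus ?thesis using False by simp
  qed
  ultimately show ?thesis by (rule sums_unique2)
qed

text \<open>$H^2$ is identified with the closed subspace of $L^2(\mathbb T)$ of boundary values.\<close>

typedef H2 = "{f :: L2. \<forall>n<0. fourier_coeff f n = 0}"
  morphisms of_H2 Abs_H2
  by (rule exI[of _ 0]) (simp add: fourier_coeff_0)

setup_lifting type_definition_H2

instantiation H2 :: ab_group_add
begin

lift_definition zero_H2 :: H2 is 0 by (simp add: fourier_coeff_0)
lift_definition plus_H2 :: "H2 \<Rightarrow> H2 \<Rightarrow> H2" is "(+)" by (simp add: fourier_coeff_add)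
lift_definition minus_H2 :: "H2 \<Rightarrow> H2 \<Rightarrow> H2" is "(-)" by (simp add: fourier_coeff_diff)
lift_definition uminus_H2 :: "H2 \<Rightarrow> H2" is uminus by (simp add: fourier_coeff_uminus)

instance
proof
  fix x y z :: H2
  show "x + y + z = x + (y + z)" by transfer (rule add.assoc)
  show "x + y = y + x" by transfer (rule add.commute)
  show "0 + x = x" by transfer simp
  show "- x + x = 0" by transfer simp
  show "x - y = x + - y" by transfer simp
qed

end

instantiation H2 :: real_vector
begin

lift_definition scaleR_H2 :: "real \<Rightarrow> H2 \<Rightarrow> H2" is scaleR by (simp add: fourier_coeff_scaleR)

instance
proof
  fix x y :: H2 and a b :: real
  show "a *\<^sub>R (x + y) = a *\<^sub>R x + a *\<^sub>R y" by transfer (rule scaleR_add_right)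
  show "(a + b) *\<^sub>R x = a *\<^sub>R x + b *\<^sub>R x" by transfer (rule scaleR_add_left)
  show "a *\<^sub>R b *\<^sub>R x = (a * b) *\<^sub>R x" by transfer simp
  show "1 *\<^sub>R x = x" by transfer simp
qed

end

instantiation H2 :: real_inner
begin

lift_definition inner_H2 :: "H2 \<Rightarrow> H2 \<Rightarrow> real" is inner .
lift_definition norm_H2 :: "H2 \<Rightarrow> real" is norm .
definition sgn_H2 :: "H2 \<Rightarrow> H2" where "sgn_H2 f = f /\<^sub>R norm f"
definition dist_H2 :: "H2 \<Rightarrow> H2 \<Rightarrow> real" where "dist_H2 f g = norm (f - g)"
definition uniformity_H2 :: "(H2 \<times> H2) filter" where
  "uniformity_H2 = (INF e\<in>{0<..}. principal {(x, y). dist x y < e})"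
definition open_H2 :: "H2 set \<Rightarrow> bool" where
  "open_H2 U \<longleftrightarrow> (\<forall>x\<in>U. \<forall>\<^sub>F (x', y) in uniformity. x' = x \<longrightarrow> y \<in> U)"

instance
proof
  fix x y z :: H2 and r :: real
  show "inner x y = inner y x" by transfer (rule inner_commute)
  show "inner (x + y) z = inner x z + inner y z" by transfer (rule inner_add_left)
  show "inner (r *\<^sub>R x) y = r * inner x y" by transfer simp
  show "0 \<le> inner x x" by transfer simp
  show "(inner x x = 0) = (x = 0)" by transfer simp
  show "norm x = sqrt (inner x x)" by transfer (rule norm_eq_sqrt_inner)
qed (rule dist_H2_def sgn_H2_def uniformity_H2_def open_H2_def)+

end

instantiation H2 :: complex_normed_vector
begin

lift_definition scaleC_H2 :: "complex \<Rightarrow> H2 \<Rightarrow> H2" is scaleC by (simp add: fourier_coeff_scaleC)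

instance
proof
  fix x y :: H2 and a b :: complex and r :: real
  show "a *\<^sub>C (x + y) = a *\<^sub>C x + a *\<^sub>C y" by transfer (rule scaleC_add_right)
  show "(a + b) *\<^sub>C x = a *\<^sub>C x + b *\<^sub>C x" by transfer (rule scaleC_add_left)
  show "a *\<^sub>C (b *\<^sub>C x) = (a * b) *\<^sub>C x" by transfer (rule scaleC_scaleC)
  show "complex_of_real r *\<^sub>C x = r *\<^sub>R x" by transfer (rule scaleC_of_real)
  show "norm (a *\<^sub>C x) = cmod a * norm x" by transfer (rule norm_scaleC)
qed

end

lemma norm_of_H2: "norm (of_H2 x) = norm x" by transfer simp

lemma dist_of_H2: "dist (of_H2 x) (of_H2 y) = dist x y"
  by (simp add: dist_norm minus_H2.rep_eq[symmetric] norm_of_H2)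

instance H2 :: complex_banach
proof
  fix X :: "nat \<Rightarrow> H2" assume "Cauchy X"
  hence "Cauchy (\<lambda>n. of_H2 (X n))" by (simp add: Cauchy_def dist_of_H2)
  then obtain l where l: "(\<lambda>n. of_H2 (X n)) \<longlonglongrightarrow> l"
    using Cauchy_convergent_iff convergent_def by blast
  have "fourier_coeff l n = 0" if "n < 0" for n
  proof -
    have "(\<lambda>k. fourier_coeff (of_H2 (X k)) n) \<longlonglongrightarrow> fourier_coeff l n"
      by (rule bounded_linear.tendsto[OF bounded_linear_fourier_coeff l])
    moreover have "fourier_coeff (of_H2 (X k)) n = 0" for k
      using of_H2[of "X k"] that by simp
    ultimately show ?thesis by (simp add: LIMSEQ_const_iff)
  qed
  hence "of_H2 (Abs_H2 l) = l" by (intro Abs_H2_inverse) simp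
  hence "X \<longlonglongrightarrow> Abs_H2 l"
    using l unfolding tendsto_iff by (simp add: dist_of_H2[symmetric])
  thus "convergent X" by (rule convergentI)
qed

section \<open>Toeplitz operators\<close>

text \<open>For bounded measurable \<open>F\<close>; the choice of representative of \<open>g\<close> is immaterial.\<close>

definition mult_op :: "(circle \<Rightarrow> complex) \<Rightarrow> L2 \<Rightarrow> L2" where
  "mult_op F g = abs_L2 (\<lambda>z. F z * rep_L2 g z)"

definition toeplitz :: "(circle \<Rightarrow> complex) \<Rightarrow> H2 \<Rightarrow> H2" where
  "toeplitz F f = Abs_H2 (riesz_proj (mult_op F (of_H2 f)))"

lemma mult_op_abs:
  assumes "F \<in> borel_measurable borel" "\<And>z. cmod (F z) \<le> C" "sq_int g"
  shows "mult_op F (abs_L2 g) = abs_L2 (\<lambda>z. F z * g z)"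
  unfolding mult_op_def
proof (rule Quotient3_rel_abs[OF Quotient3_L2])
  from ae_eq_rep_abs[OF assms(3)] sq_int_mult[OF assms(1,2)]
  show "ae_eq (\<lambda>z. F z * rep_L2 (abs_L2 g) z) (\<lambda>z. F z * g z)"
    by (auto simp: ae_eq_def)
qed

lemma of_H2_toeplitz: "of_H2 (toeplitz F f) = riesz_proj (mult_op F (of_H2 f))"
  unfolding toeplitz_def by (rule Abs_H2_inverse) (simp add: fourier_coeff_riesz_proj)

definition ess_bounded :: "L2 \<Rightarrow> bool" where
  "ess_bounded f \<longleftrightarrow> (\<exists>C. AE z in circle_measure. cmod (rep_L2 f z) \<le> C)"


section \<open>Banach algebras of functions on the circle\<close>

text \<open>A set of functions under pointwise operations, complete in the submultiplicative norm \<open>N\<close>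
  (whose values outside \<open>X\<close> are irrelevant). No unit is required.\<close>

definition banach_function_algebra ::
    "(circle \<Rightarrow> complex) set \<Rightarrow> ((circle \<Rightarrow> complex) \<Rightarrow> real) \<Rightarrow> bool" where
  "banach_function_algebra X N \<longleftrightarrow>
     (\<lambda>_. 0) \<in> X \<and>
     (\<forall>f\<in>X. \<forall>g\<in>X. (\<lambda>z. f z + g z) \<in> X) \<and>
     (\<forall>c. \<forall>f\<in>X. (\<lambda>z. c * f z) \<in> X) \<and>
     (\<forall>f\<in>X. \<forall>g\<in>X. (\<lambda>z. f z * g z) \<in> X) \<and>
     (\<forall>f\<in>X. 0 \<le> N f) \<and>
     (\<forall>f\<in>X. N f = 0 \<longrightarrow> f = (\<lambda>_. 0)) \<and>
     (\<forall>c. \<forall>f\<in>X. N (\<lambda>z. c * f z) = cmod c * N f) \<and>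
     (\<forall>f\<in>X. \<forall>g\<in>X. N (\<lambda>z. f z + g z) \<le> N f + N g) \<and>
     (\<forall>f\<in>X. \<forall>g\<in>X. N (\<lambda>z. f z * g z) \<le> N f * N g) \<and>
     (\<forall>s. (\<forall>n::nat. s n \<in> X) \<longrightarrow>
          (\<forall>e>0. \<exists>M. \<forall>m\<ge>M. \<forall>n\<ge>M. N (\<lambda>z. s m z - s n z) < e) \<longrightarrow>
          (\<exists>f\<in>X. (\<lambda>n. N (\<lambda>z. s n z - f z)) \<longlonglongrightarrow> 0))"

definition cont_embedded_in_C ::
    "(circle \<Rightarrow> complex) set \<Rightarrow> ((circle \<Rightarrow> complex) \<Rightarrow> real) \<Rightarrow> bool" where
  "cont_embedded_in_C X N \<longleftrightarrow>
     (\<forall>f\<in>X. continuous_on UNIV f) \<and> (\<exists>C. \<forall>f\<in>X. \<forall>z. cmod (f z) \<le> C * N f)"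

definition multiplicative_functional ::
    "(circle \<Rightarrow> complex) set \<Rightarrow> ((circle \<Rightarrow> complex) \<Rightarrow> complex) \<Rightarrow> bool" where
  "multiplicative_functional X \<phi> \<longleftrightarrow>
     (\<forall>f\<in>X. \<forall>g\<in>X. \<phi> (\<lambda>z. f z + g z) = \<phi> f + \<phi> g) \<and>
     (\<forall>c. \<forall>f\<in>X. \<phi> (\<lambda>z. c * f z) = c * \<phi> f) \<and>
     (\<forall>f\<in>X. \<forall>g\<in>X. \<phi> (\<lambda>z. f z * g z) = \<phi> f * \<phi> g) \<and>
     (\<exists>f\<in>X. \<phi> f \<noteq> 0)"

end

theory Submission
  imports Defs "HOL-Library.Function_Algebras"
begin

text \<open>Write \<open>A\<close> for the Toeplitz operator \<open>T\<^sub>F\<close> and \<open>c\<close> for the centre of the disk \<open>D\<close>; since \<open>0\<close> lies on the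
boundary circle, the radius of \<open>D\<close> is \<open>|c|\<close>. Put \<open>W = - c (A - c)\<^sup>-\<^sup>1\<close>. Then \<open>A = (1 - W) (A - c)\<close>, and
the semigroup is \<open>T\<^sub>t = (1 - W)\<^sup>t (A - c)\<^sup>t\<close>, where both factors are built from binomial series.

The factor \<open>(A - c)\<^sup>t\<close> is continuous in norm. For large \<open>|l|\<close> the operator \<open>A - l = - l (1 - A / l)\<close>
has powers given by the binomial series. The existence of powers is a locally constant property of
\<open>l\<close> in the resolvent set, so it holds on the whole unbounded component, in particular at \<open>c\<close>
(\<open>has_powers_at_outside\<close>).

The factor \<open>(1 - W)\<^sup>t\<close> is only strongly continuous at \<open>t = 0\<close>. Its binomial coefficients are absolutely
summable for \<open>t > 0\<close>, with sum at most \<open>2\<close> when \<open>t \<le> 1\<close>, so the series makes sense as soon as the powers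
of \<open>W\<close> are bounded. It converges strongly to the identity as \<open>t\<close> tends to \<open>0\<close> if \<open>1 - W\<close> has dense
range (\<open>C0_embeddable_of_power_bounded\<close>).

Both properties of \<open>W\<close> come from a Wiener-Hopf factorisation. The hypotheses on the algebra give a
logarithm \<open>F - c = - c e\<^sup>g\<close> with \<open>g\<close> in the algebra (\<open>logarithm_on_connected_set\<close>, which rests on Gelfand
theory), and \<open>g = u + v\<close> with \<open>u = P\<^sub>+ g\<close> bounded. Hence \<open>A - c = - c T\<^sub>b T\<^sub>a\<close> for \<open>a = e\<^sup>u\<close> analytic and
\<open>b = e\<^sup>v\<close> co-analytic, and \<open>W = T\<^sub>a\<^sup>-\<^sup>1 T\<^sub>b\<^sup>-\<^sup>1\<close>. Exchanging the two factors is a similarity, and in the other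
order the product is again a Toeplitz operator: \<open>W\<close> is similar to \<open>V = T\<^sub>b\<^sup>-\<^sup>1 T\<^sub>a\<^sup>-\<^sup>1\<close>, the Toeplitz operator
with symbol \<open>e\<^sup>-\<^sup>g = c / (c - F)\<close>. The values of \<open>F\<close> belong to the spectrum
(\<open>symbol_value_in_spectrum\<close>) and so avoid \<open>D\<close>. Hence this symbol has modulus at most \<open>1\<close>, \<open>V\<close> is a
contraction, and \<open>W\<close> is power bounded.

A vector orthogonal to the range of \<open>1 - V\<close> is fixed by the contraction \<open>V\<close>, and therefore
annihilated by multiplication by \<open>F\<close>. If \<open>F\<close> is not identically \<open>0\<close>, the vector is a Hardy function that
vanishes on an arc, so it is \<open>0\<close> (\<open>hardy_uniqueness\<close>) and the range is dense. If \<open>F = 0\<close> then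
\<open>T\<^sub>F = 0\<close>, which is embedded in a nilpotent semigroup of truncated translations
(\<open>C0_embeddable_zero\<close>).\<close>

section \<open>Binomial series in a Banach algebra\<close>

text \<open>The coefficients of \<open>(1 - x)\<^sup>t\<close>.\<close>

definition binom_coeff :: "real \<Rightarrow> nat \<Rightarrow> real" where
  "binom_coeff t n = (-1) ^ n * (t gchoose n)"

lemma binom_coeff_0 [simp]: "binom_coeff t 0 = 1"
  by (simp add: binom_coeff_def)

lemma binom_coeff_Suc:
  "binom_coeff t (Suc n) = binom_coeff t n * ((real n - t) / (real n + 1))"
proof -
  have "t * (t gchoose n) = real n * (t gchoose n) + (real n + 1) * (t gchoose Suc n)"
    using gbinomial_mult_1[of t n] by (simp add: algebra_simps)
  hence "(t gchoose Suc n) = (t gchoose n) * ((t - real n) / (real n + 1))"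
    by (simp add: field_simps)
  moreover have "(real n - t) / (real n + 1) = - ((t - real n) / (real n + 1))"
    by (metis minus_diff_eq minus_divide_left)
  ultimately show ?thesis by (simp only: binom_coeff_def power_Suc)
qed

text \<open>For exponents between \<open>0\<close> and \<open>1\<close> only the constant coefficient is positive. This sign
pattern, together with the monotonicity below, gives bounds that are uniform in \<open>t\<close>.\<close>

lemma binom_coeff_nonpos:
  assumes "0 \<le> t" "t \<le> 1" shows "binom_coeff t (Suc n) \<le> 0"
proof (induction n)
  case (Suc n)
  have "0 \<le> (real (Suc n) - t) / (real (Suc n) + 1)"
    using assms by simp
  with Suc show ?case by (subst binom_coeff_Suc) (rule mult_nonpos_nonneg)
qed (use assms in \<open>simp add: binom_coeff_Suc\<close>)

lemma binom_coeff_mono: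
  assumes "0 \<le> t" "t \<le> 1" shows "binom_coeff t (Suc n) \<le> binom_coeff t (Suc (Suc n))"
proof -
  have "(real (Suc n) - t) / (real (Suc n) + 1) \<le> 1"
    using assms by simp
  from mult_left_mono_neg[OF this binom_coeff_nonpos[OF assms, of n]]
  show ?thesis by (subst (2) binom_coeff_Suc) simp
qed

lemma binom_coeff_nonneg:
  assumes "t \<le> 0" shows "binom_coeff t n \<ge> 0"
  using assms by (induction n) (auto simp: binom_coeff_Suc)

lemma sum_binom_coeff: "(\<Sum>k\<le>n. binom_coeff t k) = binom_coeff (t - 1) n"
  using gbinomial_sum_lower_neg[of t n] by (simp add: binom_coeff_def mult.commute)

lemma abs_binom_coeff_le:
  assumes "\<bar>t\<bar> \<le> 1" shows "\<bar>binom_coeff t (Suc n)\<bar> \<le> \<bar>t\<bar>"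
proof (induction n)
  case (Suc n)
  have "\<bar>(real (Suc n) - t) / (real (Suc n) + 1)\<bar> \<le> 1"
    using assms by simp
  hence "\<bar>binom_coeff t (Suc n) * ((real (Suc n) - t) / (real (Suc n) + 1))\<bar> \<le> \<bar>t\<bar> * 1"
    unfolding abs_mult using Suc by (intro mult_mono) auto
  thus ?case by (subst binom_coeff_Suc) simp
qed (simp add: binom_coeff_Suc)

text \<open>By the sign pattern the sum is \<open>2\<close> minus the partial sum of the signed coefficients, which is a
coefficient of \<open>(1 - x)\<^sup>t\<^sup>-\<^sup>1\<close> and hence nonnegative.\<close>

lemma sum_abs_binom_coeff_le:
  assumes "0 \<le> t" "t \<le> 1" shows "(\<Sum>k\<le>n. \<bar>binom_coeff t k\<bar>) \<le> 2"
proof -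
  have *: "\<bar>binom_coeff t k\<bar> = (if k = 0 then 2 else 0) - binom_coeff t k" for k
    using binom_coeff_nonpos[OF assms] by (cases k) auto
  have "(\<Sum>k\<le>n. \<bar>binom_coeff t k\<bar>) = 2 - binom_coeff (t - 1) n"
    unfolding * sum_subtractf sum_binom_coeff by simp
  thus ?thesis using binom_coeff_nonneg[of "t - 1" n] assms by simp
qed

lemma binom_coeff_Vandermonde:
  "(\<Sum>i\<le>n. binom_coeff s i * binom_coeff t (n - i)) = binom_coeff (s + t) n"
proof -
  have "(\<Sum>i\<le>n. binom_coeff s i * binom_coeff t (n - i)) =
      (\<Sum>i\<le>n. (-1) ^ n * ((s gchoose i) * (t gchoose (n - i))))"
  proof (intro sum.cong refl)
    fix i assume "i \<in> {..n}"
    hence "(-1::real) ^ n = (-1) ^ i * (-1) ^ (n - i)" by (simp flip: power_add)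
    thus "binom_coeff s i * binom_coeff t (n - i) = (-1) ^ n * ((s gchoose i) * (t gchoose (n - i)))"
      by (simp add: binom_coeff_def)
  qed
  also have "\<dots> = (-1) ^ n * (s + t gchoose n)"
    using gbinomial_Vandermonde[of s t n]
    by (simp add: sum_distrib_left[symmetric] atLeast0AtMost)
  finally show ?thesis by (simp add: binom_coeff_def)
qed

text \<open>This is \<open>(1 - x)\<^sup>t\<close>. Absolute convergence is kept as a separate predicate because it holds in two
different situations: for every \<open>t\<close> if \<open>x\<close> has norm less than \<open>1\<close>, and for \<open>t > 0\<close> if the powers of \<open>x\<close>
are bounded.\<close>

definition binom_power :: "real \<Rightarrow> 'a::{real_normed_algebra_1,banach} \<Rightarrow> 'a" where
  "binom_power t x = (\<Sum>n. binom_coeff t n *\<^sub>R x ^ n)"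

definition binom_summable :: "real \<Rightarrow> 'a::{real_normed_algebra_1,banach} \<Rightarrow> bool" where
  "binom_summable t x \<longleftrightarrow> summable (\<lambda>n. \<bar>binom_coeff t n\<bar> * norm (x ^ n))"

lemma binom_summable_norm:
  "binom_summable t x \<Longrightarrow> summable (\<lambda>n. norm (binom_coeff t n *\<^sub>R x ^ n))"
  by (simp add: binom_summable_def)

lemma binom_power_sums:
  "binom_summable t x \<Longrightarrow> (\<lambda>n. binom_coeff t n *\<^sub>R x ^ n) sums binom_power t x"
  unfolding binom_power_def
  by (intro summable_sums summable_norm_cancel[OF binom_summable_norm])

text \<open>The coefficients for \<open>s + t\<close> are the Cauchy product of those for \<open>s\<close> and \<open>t\<close> (Vandermonde), and
\<open>norm (x ^ n)\<close> is submultiplicative in \<open>n\<close>. Thus summability only has to be checked for small exponents.\<close>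

lemma binom_summable_add:
  assumes "binom_summable s x" "binom_summable t x" shows "binom_summable (s + t) x"
  unfolding binom_summable_def
proof (rule summable_comparison_test')
  let ?p = "\<lambda>s n. \<bar>binom_coeff s n\<bar> * norm (x ^ n)"
  show "summable (\<lambda>n. \<Sum>i\<le>n. ?p s i * ?p t (n - i))"
    using assms unfolding binom_summable_def by (intro summable_Cauchy_product) auto
  fix n :: nat
  have "\<bar>binom_coeff (s + t) n\<bar> * norm (x ^ n) \<le>
      (\<Sum>i\<le>n. \<bar>binom_coeff s i * binom_coeff t (n - i)\<bar>) * norm (x ^ n)"
    unfolding binom_coeff_Vandermonde[symmetric] by (intro mult_right_mono sum_abs) auto
  also have "\<dots> = (\<Sum>i\<le>n. \<bar>binom_coeff s i\<bar> * \<bar>binom_coeff t (n - i)\<bar> * norm (x ^ n))"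
    by (simp add: sum_distrib_right abs_mult)
  also have "\<dots> \<le> (\<Sum>i\<le>n. \<bar>binom_coeff s i\<bar> * \<bar>binom_coeff t (n - i)\<bar> * (norm (x ^ i) * norm (x ^ (n - i))))"
  proof (intro sum_mono mult_left_mono)
    fix i assume "i \<in> {..n}"
    hence "x ^ n = x ^ i * x ^ (n - i)" by (simp flip: power_add)
    thus "norm (x ^ n) \<le> norm (x ^ i) * norm (x ^ (n - i))" by (simp add: norm_mult_ineq)
  qed auto
  finally show "norm (\<bar>binom_coeff (s + t) n\<bar> * norm (x ^ n)) \<le> (\<Sum>i\<le>n. ?p s i * ?p t (n - i))"
    by (simp add: mult_ac)
qed

lemma binom_summable_of_unit:
  assumes "\<And>s. 0 < s \<Longrightarrow> s \<le> 1 \<Longrightarrow> binom_summable (e * s) x" "t > 0"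
  shows "binom_summable (e * t) x"
proof -
  \<comment> \<open>Write \<open>t = n * s\<close> with \<open>s\<close> at most \<open>1\<close>, and add up \<open>n\<close> times.\<close>
  define n where "n = nat \<lceil>t\<rceil>"
  define s where "s = t / real n"
  have n: "real n \<ge> t" "n > 0" using assms(2) by (auto simp: n_def)
  hence s: "s > 0" "s \<le> 1" using assms(2) by (auto simp: s_def)
  have "binom_summable (real (Suc k) * (e * s)) x" for k
  proof (induction k)
    case (Suc k)
    from binom_summable_add[OF Suc assms(1)[OF s]]
    show ?case by (simp add: algebra_simps)
  qed (use assms(1)[OF s] in simp)
  from this[of "n - 1"] n show ?thesis by (simp add: s_def)
qed

lemma binom_summable_small:
  assumes "norm x < 1" shows "binom_summable t x"
proof -
  have unit: "binom_summable s x" if "\<bar>s\<bar> \<le> 1" for s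
    unfolding binom_summable_def
  proof (rule summable_comparison_test')
    show "summable (\<lambda>n. norm x ^ n)" using assms by (intro summable_geometric) simp
    fix n :: nat
    have "\<bar>binom_coeff s n\<bar> \<le> 1"
      using that abs_binom_coeff_le[OF that] by (cases n) (auto intro: order_trans)
    from mult_mono[OF this norm_power_ineq[of x n]]
    show "norm (\<bar>binom_coeff s n\<bar> * norm (x ^ n)) \<le> norm x ^ n" by simp
  qed
  consider "t = 0" | "t > 0" | "t < 0" by linarith
  thus ?thesis
  proof cases
    case 1 thus ?thesis by (auto intro: unit)
  next
    case 2 thus ?thesis using binom_summable_of_unit[of 1 x t] unit by simp
  next
    case 3 thus ?thesis using binom_summable_of_unit[of "-1" x "-t"] unit by simp
  qed
qed

lemma binom_summable_power_bounded:
  assumes "\<And>n. norm (x ^ n) \<le> M" "t > 0" shows "binom_summable t x"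
proof -
  have "binom_summable s x" if "0 < s" "s \<le> 1" for s
    unfolding binom_summable_def
  proof (rule bounded_imp_summable)
    fix n
    have "(\<Sum>k\<le>n. \<bar>binom_coeff s k\<bar> * norm (x ^ k)) \<le> (\<Sum>k\<le>n. \<bar>binom_coeff s k\<bar>) * M"
      unfolding sum_distrib_right using assms(1) by (intro sum_mono mult_left_mono) auto
    also have "\<dots> \<le> 2 * M"
      using sum_abs_binom_coeff_le[of s n] that order_trans[OF norm_ge_zero assms(1)[of 0]]
      by (intro mult_right_mono) auto
    finally show "(\<Sum>k\<le>n. \<bar>binom_coeff s k\<bar> * norm (x ^ k)) \<le> 2 * M" .
  qed auto
  thus ?thesis using binom_summable_of_unit[of 1 x t] assms(2) by simp
qed

lemma binom_power_add:
  assumes "binom_summable s x" "binom_summable t x"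
  shows "binom_power (s + t) x = binom_power s x * binom_power t x"
proof -
  have "binom_power s x * binom_power t x =
      (\<Sum>n. \<Sum>i\<le>n. (binom_coeff s i *\<^sub>R x ^ i) * (binom_coeff t (n - i) *\<^sub>R x ^ (n - i)))"
    unfolding binom_power_def by (intro Cauchy_product binom_summable_norm assms)
  also have "(\<lambda>n. \<Sum>i\<le>n. (binom_coeff s i *\<^sub>R x ^ i) * (binom_coeff t (n - i) *\<^sub>R x ^ (n - i))) =
      (\<lambda>n. binom_coeff (s + t) n *\<^sub>R x ^ n)"
    unfolding binom_coeff_Vandermonde[symmetric] scaleR_sum_left
    by (intro ext sum.cong refl) (simp flip: power_add)
  finally show ?thesis by (simp add: binom_power_def)
qed

lemma binom_power_finite:
  assumes "\<And>n. n > N \<Longrightarrow> binom_coeff t n = 0"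
  shows "binom_power t x = (\<Sum>n\<le>N. binom_coeff t n *\<^sub>R x ^ n)"
  unfolding binom_power_def by (rule suminf_finite) (use assms in \<open>auto simp: not_le\<close>)

lemma binom_power_0 [simp]: "binom_power 0 x = 1"
proof -
  have "binom_coeff 0 n = 0" if "n > 0" for n using that by (auto simp: binom_coeff_def gbinomial_0_left)
  from binom_power_finite[of 0, OF this] show ?thesis by simp
qed

lemma binom_power_1 [simp]: "binom_power 1 x = 1 - x"
proof -
  have "binom_coeff 1 (Suc (Suc n)) = 0" for n
    by (induction n) (simp_all add: binom_coeff_Suc)
  moreover have "n = Suc (Suc (n - 2))" if "n > 1" for n :: nat using that by simp
  ultimately have "binom_coeff 1 n = 0" if "n > 1" for n using that by metis
  from binom_power_finite[of 1, OF this] show ?thesis by (simp add: binom_coeff_Suc)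
qed

lemma binom_power_commute:
  assumes "binom_summable t x" "y * x = x * y"
  shows "y * binom_power t x = binom_power t x * y"
proof -
  have *: "y * x ^ n = x ^ n * y" for n using power_commuting_commutes[of x y n] assms(2) by simp
  have "(\<lambda>n. y * (binom_coeff t n *\<^sub>R x ^ n)) sums (y * binom_power t x)"
    by (intro sums_mult binom_power_sums assms)
  moreover have "(\<lambda>n. (binom_coeff t n *\<^sub>R x ^ n) * y) sums (binom_power t x * y)"
    by (intro sums_mult2 binom_power_sums assms)
  ultimately show ?thesis by (simp add: * sums_unique2)
qed

lemma norm_binom_power_small:
  assumes "norm x < 1" "\<bar>t\<bar> \<le> 1"
  shows "norm (binom_power t x - 1) \<le> \<bar>t\<bar> * (norm x / (1 - norm x))"
proof -
  have b: "(\<lambda>n. binom_coeff t (Suc n) *\<^sub>R x ^ Suc n) sums (binom_power t x - 1)"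
    using binom_power_sums[OF binom_summable_small[OF assms(1), of t]]
    by (subst sums_Suc_iff) simp
  have g: "(\<lambda>n. \<bar>t\<bar> * (norm x * norm x ^ n)) sums (\<bar>t\<bar> * (norm x * (1 / (1 - norm x))))"
    using assms by (intro sums_mult geometric_sums) simp
  have "norm (binom_coeff t (Suc n) *\<^sub>R x ^ Suc n) \<le> \<bar>t\<bar> * (norm x * norm x ^ n)" for n
    using mult_mono[OF abs_binom_coeff_le[OF assms(2), of n] norm_power_ineq[of x "Suc n"]] by simp
  hence "norm (\<Sum>n. binom_coeff t (Suc n) *\<^sub>R x ^ Suc n) \<le> (\<Sum>n. \<bar>t\<bar> * (norm x * norm x ^ n))"
    using sums_summable[OF g] by (intro norm_suminf_le)
  thus ?thesis using sums_unique[OF g] sums_unique[OF b] by simp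
qed

lemma norm_binom_power_bounded:
  assumes "\<And>n. norm (x ^ n) \<le> M" "0 < t" "t \<le> 1"
  shows "norm (binom_power t x) \<le> 2 * M"
proof -
  have ok: "binom_summable t x" by (rule binom_summable_power_bounded[OF assms(1,2)])
  have "norm (\<Sum>k\<le>n. binom_coeff t k *\<^sub>R x ^ k) \<le> 2 * M" for n
  proof -
    have "norm (\<Sum>k\<le>n. binom_coeff t k *\<^sub>R x ^ k) \<le> (\<Sum>k\<le>n. \<bar>binom_coeff t k\<bar>) * M"
      unfolding sum_distrib_right
      by (intro sum_norm_le) (auto intro: mult_left_mono assms)
    also have "\<dots> \<le> 2 * M"
      using sum_abs_binom_coeff_le[of t n] assms order_trans[OF norm_ge_zero assms(1)[of 0]]
      by (intro mult_right_mono) auto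
    finally show ?thesis .
  qed
  moreover have "(\<lambda>n. norm (\<Sum>k\<le>n. binom_coeff t k *\<^sub>R x ^ k)) \<longlonglongrightarrow> norm (binom_power t x)"
    using binom_power_sums[OF ok] unfolding sums_def_le by (rule tendsto_norm)
  ultimately show ?thesis by (intro LIMSEQ_le_const2) auto
qed

text \<open>On the range of \<open>1 - x\<close> the powers \<open>(1 - x)\<^sup>t\<close> tend to the identity in norm. After a summation by
parts the coefficients of \<open>((1 - x)\<^sup>t - 1) (1 - x)\<close> are differences of consecutive binomial
coefficients. These differences have constant sign from the second one on, so their sum telescopes to at
most \<open>t\<close>.\<close>

lemma norm_binom_power_minus_one_mult:
  assumes "\<And>n. norm (x ^ n) \<le> M" "0 < t" "t \<le> 1"
  shows "norm ((binom_power t x - 1) * (1 - x)) \<le> 3 * t * M"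
proof -
  have ok: "binom_summable t x" by (rule binom_summable_power_bounded[OF assms(1,2)])
  let ?a = "binom_coeff t"
  have M0: "M \<ge> 0" using order_trans[OF norm_ge_zero assms(1)[of 0]] .
  \<comment> \<open>Summation by parts; the last term is the boundary term.\<close>
  have eq: "(\<Sum>k\<le>n. ?a (Suc k) *\<^sub>R x ^ Suc k) * (1 - x) =
      ?a 1 *\<^sub>R x + (\<Sum>k<n. (?a (Suc (Suc k)) - ?a (Suc k)) *\<^sub>R x ^ Suc (Suc k)) - ?a (Suc n) *\<^sub>R x ^ Suc (Suc n)" for n
  proof (induction n)
    case (Suc n)
    have "(\<Sum>k\<le>Suc n. ?a (Suc k) *\<^sub>R x ^ Suc k) * (1 - x) =
        (\<Sum>k\<le>n. ?a (Suc k) *\<^sub>R x ^ Suc k) * (1 - x) + (?a (Suc (Suc n)) *\<^sub>R x ^ Suc (Suc n)) * (1 - x)"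
      by (simp only: sum.atMost_Suc distrib_right)
    also have "(?a (Suc (Suc n)) *\<^sub>R x ^ Suc (Suc n)) * (1 - x) =
        ?a (Suc (Suc n)) *\<^sub>R x ^ Suc (Suc n) - ?a (Suc (Suc n)) *\<^sub>R x ^ Suc (Suc (Suc n))"
      by (simp add: right_diff_distrib power_commutes mult.assoc)
    finally show ?case unfolding Suc.IH by (simp add: algebra_simps)
  qed (simp add: algebra_simps)
  have mono: "\<bar>?a (Suc (Suc k)) - ?a (Suc k)\<bar> = ?a (Suc (Suc k)) - ?a (Suc k)" for k
    using binom_coeff_mono[of t k] assms by simp
  have tele: "(\<Sum>k<n. \<bar>?a (Suc (Suc k)) - ?a (Suc k)\<bar>) \<le> t" for n
  proof -
    have "(\<Sum>k<n. \<bar>?a (Suc (Suc k)) - ?a (Suc k)\<bar>) = ?a (Suc n) - ?a (Suc 0)"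
      unfolding mono by (rule sum_lessThan_telescope)
    thus ?thesis using binom_coeff_nonpos[of t n] assms by (simp add: binom_coeff_Suc)
  qed
  have bound: "norm ((\<Sum>k\<le>n. ?a (Suc k) *\<^sub>R x ^ Suc k) * (1 - x)) \<le> 3 * t * M" for n
  proof -
    have tri: "norm (a + b - c) \<le> norm a + norm b + norm c" for a b c :: 'a
      using norm_triangle_ineq4[of "a + b" c] norm_triangle_ineq[of a b] by linarith
    have "norm (?a 1 *\<^sub>R x) \<le> t * M"
      using assms(1)[of 1] assms(2) by (simp add: binom_coeff_Suc mult_left_mono)
    moreover have "norm (\<Sum>k<n. (?a (Suc (Suc k)) - ?a (Suc k)) *\<^sub>R x ^ Suc (Suc k)) \<le> t * M"
    proof -
      have "norm (\<Sum>k<n. (?a (Suc (Suc k)) - ?a (Suc k)) *\<^sub>R x ^ Suc (Suc k)) \<le>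
          (\<Sum>k<n. \<bar>?a (Suc (Suc k)) - ?a (Suc k)\<bar>) * M"
        unfolding sum_distrib_right
        by (intro sum_norm_le) (simp only: norm_scaleR, intro mult_left_mono assms(1), auto)
      also have "\<dots> \<le> t * M" using tele M0 by (rule mult_right_mono)
      finally show ?thesis .
    qed
    moreover have "norm (?a (Suc n) *\<^sub>R x ^ Suc (Suc n)) \<le> t * M"
      unfolding norm_scaleR
      by (intro mult_mono assms(1)) (use abs_binom_coeff_le[of t n] assms(2,3) in auto)
    moreover note tri[of "?a 1 *\<^sub>R x" "\<Sum>k<n. (?a (Suc (Suc k)) - ?a (Suc k)) *\<^sub>R x ^ Suc (Suc k)"
        "?a (Suc n) *\<^sub>R x ^ Suc (Suc n)"]
    ultimately show ?thesis unfolding eq by linarith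
  qed
  have "(\<lambda>n. ?a (Suc n) *\<^sub>R x ^ Suc n) sums (binom_power t x - 1)"
    using binom_power_sums[OF ok] by (subst sums_Suc_iff) simp
  hence "(\<lambda>n. norm ((\<Sum>k\<le>n. ?a (Suc k) *\<^sub>R x ^ Suc k) * (1 - x))) \<longlonglongrightarrow> norm ((binom_power t x - 1) * (1 - x))"
    unfolding sums_def_le by (intro tendsto_norm tendsto_mult tendsto_const)
  thus ?thesis using bound by (intro LIMSEQ_le_const2) auto
qed

section \<open>Fractional powers of operators\<close>

text \<open>Bounded complex-linear operators as a type of their own: on a nonzero space it is a unital Banach
algebra in the sense of the type classes, so that power series and binomial powers apply to
operators.\<close>

typedef (overloaded) 'a cop =
  "{f :: 'a::complex_banach \<Rightarrow>\<^sub>L 'a. \<forall>c x. blinfun_apply f (c *\<^sub>C x) = c *\<^sub>C blinfun_apply f x}"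
  morphisms blinfun_of_cop Abs_cop
  by (rule exI[of _ id_blinfun]) simp

setup_lifting type_definition_cop

lemma scaleC_zero_right [simp]: "c *\<^sub>C (0::'a::complex_normed_vector) = 0"
  using scaleC_add_right[of c "0::'a" 0] by simp

lemma scaleC_zero_left [simp]: "0 *\<^sub>C (x::'a::complex_normed_vector) = 0"
  using scaleC_add_left[of 0 0 x] by simp

lemma scaleC_one [simp]: "1 *\<^sub>C (x::'a::complex_normed_vector) = x"
  using scaleC_of_real[of 1 x] by simp

lemma scaleC_minus_right: "c *\<^sub>C (- x) = - (c *\<^sub>C (x::'a::complex_normed_vector))"
  using scaleC_add_right[of c x "- x"] by (simp add: eq_neg_iff_add_eq_0 add.commute)

lemma scaleC_diff_right: "c *\<^sub>C (x - y) = c *\<^sub>C x - c *\<^sub>C (y::'a::complex_normed_vector)"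
  using scaleC_add_right[of c x "- y"] by (simp add: scaleC_minus_right)

lemma scaleC_scaleR: "c *\<^sub>C (r *\<^sub>R x) = r *\<^sub>R (c *\<^sub>C (x::'a::complex_normed_vector))"
  by (simp only: scaleC_of_real[symmetric] scaleC_scaleC mult.commute)

lemma bounded_linear_scaleC_right: "bounded_linear (\<lambda>x::'a::complex_normed_vector. c *\<^sub>C x)"
  by (rule bounded_linear_intro[of _ "cmod c"])
     (simp_all add: scaleC_add_right scaleC_scaleR norm_scaleC mult.commute)

instantiation cop :: (complex_banach) ring
begin

lift_definition zero_cop :: "'a cop" is 0 by simp
lift_definition plus_cop :: "'a cop \<Rightarrow> 'a cop \<Rightarrow> 'a cop" is "(+)"
  by (simp add: blinfun.add_left scaleC_add_right)
lift_definition minus_cop :: "'a cop \<Rightarrow> 'a cop \<Rightarrow> 'a cop" is "(-)"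
  by (simp add: blinfun.diff_left scaleC_diff_right)
lift_definition uminus_cop :: "'a cop \<Rightarrow> 'a cop" is uminus
  by (simp add: blinfun.minus_left scaleC_minus_right)
lift_definition times_cop :: "'a cop \<Rightarrow> 'a cop \<Rightarrow> 'a cop" is "(o\<^sub>L)"
  by simp

instance
proof
  fix a b c :: "'a cop"
  show "a + b + c = a + (b + c)" by transfer (rule add.assoc)
  show "a + b = b + a" by transfer (rule add.commute)
  show "0 + a = a" by transfer simp
  show "- a + a = 0" by transfer simp
  show "a - b = a + - b" by transfer simp
  show "a * b * c = a * (b * c)" by transfer (rule blinfun_eqI, simp)
  show "(a + b) * c = a * c + b * c" by transfer (rule bounded_bilinear.add_left[OF bounded_bilinear_blinfun_compose])
  show "a * (b + c) = a * b + a * c" by transfer (rule bounded_bilinear.add_right[OF bounded_bilinear_blinfun_compose])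
qed

end

instantiation cop :: (complex_banach) real_algebra
begin

lift_definition scaleR_cop :: "real \<Rightarrow> 'a cop \<Rightarrow> 'a cop" is scaleR
  by (simp add: blinfun.scaleR_left scaleC_scaleR)

instance
proof
  fix x y :: "'a cop" and a b :: real
  show "a *\<^sub>R (x + y) = a *\<^sub>R x + a *\<^sub>R y" by transfer (rule scaleR_add_right)
  show "(a + b) *\<^sub>R x = a *\<^sub>R x + b *\<^sub>R x" by transfer (rule scaleR_add_left)
  show "a *\<^sub>R b *\<^sub>R x = (a * b) *\<^sub>R x" by transfer simp
  show "1 *\<^sub>R x = x" by transfer simp
  show "a *\<^sub>R x * y = a *\<^sub>R (x * y)"
    by transfer (rule bounded_bilinear.scaleR_left[OF bounded_bilinear_blinfun_compose])
  show "x * a *\<^sub>R y = a *\<^sub>R (x * y)"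
    by transfer (rule bounded_bilinear.scaleR_right[OF bounded_bilinear_blinfun_compose])
qed

end

instantiation cop :: (complex_banach) real_normed_algebra
begin

lift_definition norm_cop :: "'a cop \<Rightarrow> real" is norm .
definition sgn_cop :: "'a cop \<Rightarrow> 'a cop" where "sgn_cop f = f /\<^sub>R norm f"
definition dist_cop :: "'a cop \<Rightarrow> 'a cop \<Rightarrow> real" where "dist_cop f g = norm (f - g)"
definition uniformity_cop :: "('a cop \<times> 'a cop) filter" where
  "uniformity_cop = (INF e\<in>{0<..}. principal {(x, y). dist x y < e})"
definition open_cop :: "'a cop set \<Rightarrow> bool" where
  "open_cop U \<longleftrightarrow> (\<forall>x\<in>U. \<forall>\<^sub>F (x', y) in uniformity. x' = x \<longrightarrow> y \<in> U)"

instance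
proof
  fix x y :: "'a cop" and a b :: real
  show "(norm x = 0) = (x = 0)" by transfer simp
  show "norm (x + y) \<le> norm x + norm y" by transfer (rule norm_triangle_ineq)
  show "norm (a *\<^sub>R x) = \<bar>a\<bar> * norm x" by transfer simp
  show "norm (x * y) \<le> norm x * norm y" by transfer (rule norm_blinfun_compose)
qed (rule sgn_cop_def dist_cop_def uniformity_cop_def open_cop_def)+

end

lift_definition cop_apply :: "'a::complex_banach cop \<Rightarrow> 'a \<Rightarrow> 'a" is blinfun_apply .

lemma norm_cop_apply: "norm (cop_apply A x) \<le> norm A * norm x"
  by transfer (rule norm_blinfun)

lemma norm_cop_le: "0 \<le> M \<Longrightarrow> (\<And>x. norm (cop_apply A x) \<le> M * norm x) \<Longrightarrow> norm A \<le> M"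
  by transfer (rule norm_blinfun_bound)

lemma cop_eqI: "(\<And>x. cop_apply A x = cop_apply B x) \<Longrightarrow> A = B"
  by transfer (rule blinfun_eqI)

lemma cop_apply_mult [simp]: "cop_apply (A * B) x = cop_apply A (cop_apply B x)"
  by transfer simp

lemma cop_apply_add: "cop_apply (A + B) x = cop_apply A x + cop_apply B x"
  by transfer (rule blinfun.add_left)

lemma cop_apply_diff: "cop_apply (A - B) x = cop_apply A x - cop_apply B x"
  by transfer (rule blinfun.diff_left)

lemma cop_apply_diff_right: "cop_apply A (x - y) = cop_apply A x - cop_apply A y"
  by transfer (rule blinfun.diff_right)

lemma bounded_clinear_cop_apply: "bounded_clinear (cop_apply A)"
  unfolding bounded_clinear_def by transfer (simp add: blinfun.bounded_linear_right)

lemma cop_of_bounded_clinear: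
  assumes "bounded_clinear f" obtains A where "cop_apply A = f"
proof
  have "bounded_linear f" "\<And>c x. f (c *\<^sub>C x) = c *\<^sub>C f x"
    using assms by (auto simp: bounded_clinear_def)
  thus "cop_apply (Abs_cop (Blinfun f)) = f"
    by (simp add: cop_apply.rep_eq Abs_cop_inverse bounded_linear_Blinfun_apply)
qed

instance cop :: (complex_banach) banach
proof
  fix X :: "nat \<Rightarrow> 'a cop" assume "Cauchy X"
  have d: "dist (blinfun_of_cop A) (blinfun_of_cop B) = dist A B" for A B :: "'a cop"
    unfolding dist_norm by transfer simp
  have "Cauchy (\<lambda>n. blinfun_of_cop (X n))"
    using \<open>Cauchy X\<close> by (simp add: Cauchy_def d)
  then obtain L where L: "(\<lambda>n. blinfun_of_cop (X n)) \<longlonglongrightarrow> L"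
    using Cauchy_convergent_iff convergent_def by blast
  have app: "(\<lambda>n. blinfun_apply (blinfun_of_cop (X n)) x) \<longlonglongrightarrow> blinfun_apply L x" for x
    by (intro tendsto_intros L)
  have "blinfun_apply L (c *\<^sub>C x) = c *\<^sub>C blinfun_apply L x" for c x
  proof (rule LIMSEQ_unique[OF app])
    have "(\<lambda>n. c *\<^sub>C blinfun_apply (blinfun_of_cop (X n)) x) \<longlonglongrightarrow> c *\<^sub>C blinfun_apply L x"
      by (rule bounded_linear.tendsto[OF bounded_linear_scaleC_right app])
    thus "(\<lambda>n. blinfun_apply (blinfun_of_cop (X n)) (c *\<^sub>C x)) \<longlonglongrightarrow> c *\<^sub>C blinfun_apply L x"
      using blinfun_of_cop[of "X _"] by simp
  qed
  hence "blinfun_of_cop (Abs_cop L) = L" by (intro Abs_cop_inverse) simp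
  hence "X \<longlonglongrightarrow> Abs_cop L"
    using L unfolding tendsto_iff by (simp add: d[symmetric])
  thus "convergent X" by (rule convergentI)
qed

instantiation cop :: ("{complex_banach,perfect_space}") real_normed_algebra_1
begin

lift_definition one_cop :: "'a cop" is id_blinfun by simp

instance
proof
  fix a :: "'a cop"
  show "1 * a = a" by transfer (rule blinfun_eqI, simp)
  show "a * 1 = a" by transfer (rule blinfun_eqI, simp)
  show n: "norm (1::'a cop) = 1" by transfer (rule norm_blinfun_id)
  show "(0::'a cop) \<noteq> 1"
  proof
    assume "(0::'a cop) = 1"
    hence "norm (0::'a cop) = 1" using n by simp
    thus False by (simp only: norm_zero)
  qed
qed

end

lemma cop_apply_one [simp]: "cop_apply 1 x = x"
  by transfer simp

definition scalar_cop :: "complex \<Rightarrow> 'a::{complex_banach,perfect_space} cop" where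
  "scalar_cop c = Abs_cop (Blinfun (\<lambda>x. c *\<^sub>C x))"

lemma cop_apply_scalar [simp]: "cop_apply (scalar_cop c) x = c *\<^sub>C x"
  unfolding scalar_cop_def cop_apply.rep_eq
  by (subst Abs_cop_inverse)
     (simp_all add: bounded_linear_Blinfun_apply[OF bounded_linear_scaleC_right] scaleC_scaleC mult.commute)

lemma cop_apply_scaleC: "cop_apply A (c *\<^sub>C x) = c *\<^sub>C cop_apply A x"
  using bounded_clinear_cop_apply[of A] by (simp add: bounded_clinear_def)

lemma scalar_cop_commute: "A * scalar_cop c = scalar_cop c * A"
  by (rule cop_eqI) (simp add: cop_apply_scaleC)

lemma scalar_cop_mult: "scalar_cop a * scalar_cop b = scalar_cop (a * b)"
  by (rule cop_eqI) (simp add: scaleC_scaleC)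

lemma scalar_cop_add: "scalar_cop a + scalar_cop b = scalar_cop (a + b)"
  by (rule cop_eqI) (simp add: cop_apply_add scaleC_add_left)

lemma scalar_cop_diff: "scalar_cop a - scalar_cop b = scalar_cop (a - b)"
  by (simp add: diff_eq_eq scalar_cop_add)

lemma scalar_cop_minus: "scalar_cop (- c) = - scalar_cop c"
proof -
  have "scalar_cop 0 = (0 :: 'a cop)"
    by (rule cop_eqI) (simp, transfer, simp)
  thus ?thesis using scalar_cop_add[of "- c" c, where 'a = 'a] by (simp add: eq_neg_iff_add_eq_0)
qed

lemma scalar_cop_1 [simp]: "scalar_cop 1 = 1"
  by (rule cop_eqI) simp

lemma norm_scalar_cop_mult: "norm (scalar_cop c * A) \<le> cmod c * norm A"
  by (rule norm_cop_le)
     (auto simp: norm_scaleC mult.assoc intro: mult_left_mono norm_cop_apply)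

lemma norm_scalar_cop: "norm (scalar_cop c :: 'a::{complex_banach,perfect_space} cop) \<le> cmod c"
  using norm_scalar_cop_mult[of c "1 :: 'a cop"] by simp

lemma notin_op_spectrum_iff:
  "l \<notin> op_spectrum (cop_apply A) \<longleftrightarrow>
     (\<exists>R. R * (A - scalar_cop l) = 1 \<and> (A - scalar_cop l) * R = 1)"
proof
  assume "l \<notin> op_spectrum (cop_apply A)"
  then obtain B where B: "bounded_clinear B" "\<And>x. B (cop_apply A x - l *\<^sub>C x) = x"
      "\<And>x. cop_apply A (B x) - l *\<^sub>C B x = x"
    by (auto simp: op_spectrum_def)
  from cop_of_bounded_clinear[OF B(1)] obtain R where R: "cop_apply R = B" .
  have "R * (A - scalar_cop l) = 1" "(A - scalar_cop l) * R = 1"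
    by (rule cop_eqI; simp add: R B cop_apply_diff)+
  thus "\<exists>R. R * (A - scalar_cop l) = 1 \<and> (A - scalar_cop l) * R = 1" by blast
next
  assume "\<exists>R. R * (A - scalar_cop l) = 1 \<and> (A - scalar_cop l) * R = 1"
  then obtain R where R: "R * (A - scalar_cop l) = 1" "(A - scalar_cop l) * R = 1" by blast
  have "cop_apply R (cop_apply A x - l *\<^sub>C x) = x" "cop_apply A (cop_apply R x) - l *\<^sub>C cop_apply R x = x" for x
    using arg_cong[OF R(1), of "\<lambda>B. cop_apply B x"] arg_cong[OF R(2), of "\<lambda>B. cop_apply B x"]
    by (simp_all add: cop_apply_diff)
  thus "l \<notin> op_spectrum (cop_apply A)"
    unfolding op_spectrum_def using bounded_clinear_cop_apply[of R] by blast
qed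

text \<open>If \<open>R\<close> is the resolvent at \<open>m\<close> then \<open>A - l = (1 - (l - m) R) (A - m)\<close>, and the first factor is
inverted by the binomial power of exponent \<open>-1\<close>.\<close>

lemma open_resolvent_set: "open (- op_spectrum (cop_apply (A :: 'a::{complex_banach,perfect_space} cop)))"
proof (rule openI)
  fix m assume "m \<in> - op_spectrum (cop_apply A)"
  then obtain R where R: "R * (A - scalar_cop m) = 1" "(A - scalar_cop m) * R = 1"
    by (auto simp: notin_op_spectrum_iff)
  have "l \<notin> op_spectrum (cop_apply A)" if "l \<in> ball m (1 / (norm R + 1))" for l
  proof -
    define x where "x = scalar_cop (l - m) * R"
    have "norm x \<le> cmod (l - m) * norm R" unfolding x_def by (rule norm_scalar_cop_mult)
    also have "\<dots> \<le> cmod (l - m) * (norm R + 1)" by (intro mult_left_mono) auto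
    also have "\<dots> < 1"
      using that by (simp add: dist_norm norm_minus_commute field_simps add_pos_nonneg)
    finally have x: "norm x < 1" .
    let ?B = "binom_power (- 1) x"
    have B: "?B * (1 - x) = 1" "(1 - x) * ?B = 1"
      using binom_power_add[OF binom_summable_small binom_summable_small, OF x x, of 1 "-1"]
        binom_power_add[OF binom_summable_small binom_summable_small, OF x x, of "-1" 1] by simp_all
    have "A - scalar_cop l = A - scalar_cop m - scalar_cop (l - m)"
      by (simp flip: scalar_cop_diff)
    moreover have "x * (A - scalar_cop m) = scalar_cop (l - m)"
      by (simp only: x_def mult.assoc R mult_1_right)
    moreover have "(A - scalar_cop m) * x = scalar_cop (l - m)"
      using R(2) by (simp only: x_def scalar_cop_commute[of R, symmetric]) (simp only: mult.assoc[symmetric] mult_1_left)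
    ultimately have f: "A - scalar_cop l = (1 - x) * (A - scalar_cop m)" "A - scalar_cop l = (A - scalar_cop m) * (1 - x)"
      by (simp_all only: left_diff_distrib[of 1] right_diff_distrib[of _ 1] mult_1_left mult_1_right)
    have "(R * ?B) * (A - scalar_cop l) = 1"
      unfolding f(1) by (metis B(1) R(1) mult.assoc mult.right_neutral)
    moreover have "(A - scalar_cop l) * (?B * R) = 1"
      unfolding f(2) by (metis B(2) R(2) mult.assoc mult.right_neutral)
    moreover have "R * ?B = ?B * R"
    proof (rule binom_power_commute[OF binom_summable_small[OF x]])
      show "R * x = x * R" by (metis x_def mult.assoc scalar_cop_commute)
    qed
    ultimately show ?thesis by (auto simp: notin_op_spectrum_iff)
  qed
  thus "\<exists>e>0. ball m e \<subseteq> - op_spectrum (cop_apply A)"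
    by (intro exI[of _ "1 / (norm R + 1)"]) (auto intro: add_nonneg_pos)
qed

text \<open>The commutation clause puts the semigroup in the bicommutant of \<open>A\<close>. Without it, products of
such semigroups need not be semigroups.\<close>

definition power_semigroup :: "'a::{complex_banach,perfect_space} cop \<Rightarrow> (real \<Rightarrow> 'a cop) \<Rightarrow> bool" where
  "power_semigroup A U \<longleftrightarrow> (\<forall>s>0. \<forall>t>0. U (s + t) = U s * U t) \<and> (U \<longlongrightarrow> 1) (at_right 0) \<and>
     (\<forall>Y t. t > 0 \<longrightarrow> Y * A = A * Y \<longrightarrow> Y * U t = U t * Y)"

lemma power_semigroup_add: "power_semigroup A U \<Longrightarrow> s > 0 \<Longrightarrow> t > 0 \<Longrightarrow> U (s + t) = U s * U t"
  and power_semigroup_tendsto: "power_semigroup A U \<Longrightarrow> (U \<longlongrightarrow> 1) (at_right 0)"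
  and power_semigroup_commute: "power_semigroup A U \<Longrightarrow> Y * A = A * Y \<Longrightarrow> t > 0 \<Longrightarrow> Y * U t = U t * Y"
  unfolding power_semigroup_def by blast+

lemma tendsto_binom_power_small:
  assumes "norm x < 1"
  shows "((\<lambda>t. binom_power (e * t) x) \<longlongrightarrow> 1) (at_right 0)"
proof (rule Lim_null[THEN iffD2], rule Lim_null_comparison)
  have "((\<lambda>t. \<bar>e * t\<bar>) \<longlongrightarrow> \<bar>e * 0\<bar>) (at_right 0)" by (intro tendsto_intros)
  hence lim: "((\<lambda>t. \<bar>e * t\<bar>) \<longlongrightarrow> 0) (at_right 0)" by simp
  hence "eventually (\<lambda>t. \<bar>e * t\<bar> < 1) (at_right 0)" by (rule order_tendstoD) simp
  thus "eventually (\<lambda>t. norm (binom_power (e * t) x - 1) \<le> \<bar>e * t\<bar> * (norm x / (1 - norm x))) (at_right 0)"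
    by eventually_elim (rule norm_binom_power_small[OF assms], simp)
  show "((\<lambda>t. \<bar>e * t\<bar> * (norm x / (1 - norm x))) \<longlongrightarrow> 0) (at_right 0)"
    by (rule tendsto_mult_left_zero[OF lim])
qed

lemma power_semigroup_mult_binom_power:
  assumes U: "power_semigroup A U" and x: "norm x < 1" and comm: "\<And>Y. Y * A = A * Y \<Longrightarrow> Y * x = x * Y"
  shows "power_semigroup A (\<lambda>t. U t * binom_power (e * t) x)"
  unfolding power_semigroup_def
proof (intro conjI allI impI)
  note ok = binom_summable_small[OF x]
  have xU: "U t * binom_power s x = binom_power s x * U t" if "t > 0" for s t
  proof (rule binom_power_commute[OF ok])
    have "x * A = A * x" using comm[of A] by simp
    thus "U t * x = x * U t" using power_semigroup_commute[OF U _ that, of x] by simp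
  qed
  {
    fix s t :: real assume st: "s > 0" "t > 0"
    have "U (s + t) * binom_power (e * (s + t)) x = U s * U t * (binom_power (e * s) x * binom_power (e * t) x)"
      using power_semigroup_add[OF U st] binom_power_add[OF ok ok, of "e * s" "e * t"] by (simp add: distrib_left)
    also have "\<dots> = U s * (U t * binom_power (e * s) x) * binom_power (e * t) x" by (simp add: mult.assoc)
    also have "U t * binom_power (e * s) x = binom_power (e * s) x * U t" by (rule xU[OF st(2)])
    finally show "U (s + t) * binom_power (e * (s + t)) x =
        U s * binom_power (e * s) x * (U t * binom_power (e * t) x)" by (simp add: mult.assoc)
  }
  have "((\<lambda>t. U t * binom_power (e * t) x) \<longlongrightarrow> 1 * 1) (at_right 0)"
    by (intro tendsto_mult tendsto_binom_power_small x power_semigroup_tendsto[OF U])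
  thus "((\<lambda>t. U t * binom_power (e * t) x) \<longlongrightarrow> 1) (at_right 0)" by simp
  fix Y and t :: real assume t: "t > 0" and Y: "Y * A = A * Y"
  have "Y * U t = U t * Y" by (rule power_semigroup_commute[OF U Y t])
  moreover have "Y * binom_power (e * t) x = binom_power (e * t) x * Y"
    by (rule binom_power_commute[OF ok comm[OF Y]])
  ultimately show "Y * (U t * binom_power (e * t) x) = U t * binom_power (e * t) x * Y"
    by (metis mult.assoc)
qed

definition has_powers_at :: "'a::{complex_banach,perfect_space} cop \<Rightarrow> complex \<Rightarrow> bool" where
  "has_powers_at A l \<longleftrightarrow> (\<exists>U. power_semigroup A U \<and> U 1 = A - scalar_cop l)"

text \<open>Multiply or divide by the powers of \<open>1 - (l - m) R\<close>, where \<open>R\<close> is the resolvent at \<open>m\<close>. This uses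
only the resolvent at \<open>m\<close>, so both implications are available at every point \<open>l\<close> near \<open>m\<close>.\<close>

lemma has_powers_at_near:
  assumes R: "R * (A - scalar_cop m) = 1" "(A - scalar_cop m) * R = 1"
    and near: "cmod (l - m) * norm R < 1"
  shows "has_powers_at A l \<longleftrightarrow> has_powers_at A m"
proof -
  define x where "x = scalar_cop (l - m) * R"
  have x: "norm x < 1" unfolding x_def by (rule le_less_trans[OF norm_scalar_cop_mult near])
  have comm: "Y * x = x * Y" if "Y * A = A * Y" for Y
  proof -
    have Y: "Y * (A - scalar_cop m) = (A - scalar_cop m) * Y"
      using that by (simp add: algebra_simps scalar_cop_commute)
    have "Y * R = R * (A - scalar_cop m) * Y * R" by (simp add: R)
    also have "\<dots> = R * (Y * (A - scalar_cop m)) * R" unfolding Y by (simp add: mult.assoc)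
    also have "\<dots> = R * Y * ((A - scalar_cop m) * R)" by (simp only: mult.assoc)
    finally have "Y * R = R * Y" by (simp add: R)
    thus ?thesis by (metis x_def mult.assoc scalar_cop_commute)
  qed
  have "A - scalar_cop l = A - scalar_cop m - scalar_cop (l - m)"
    by (simp flip: scalar_cop_diff)
  moreover have "(A - scalar_cop m) * x = scalar_cop (l - m)"
    using R(2) by (simp only: x_def scalar_cop_commute[of R, symmetric]) (simp only: mult.assoc[symmetric] mult_1_left)
  ultimately have f: "A - scalar_cop l = (A - scalar_cop m) * (1 - x)"
    by (simp only: right_diff_distrib[of _ 1] mult_1_right)
  hence g: "A - scalar_cop m = (A - scalar_cop l) * binom_power (- 1) x"
    using binom_power_add[OF binom_summable_small binom_summable_small, OF x x, of 1 "-1"]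
    by (simp add: mult.assoc)
  show ?thesis
  proof
    assume "has_powers_at A l"
    then obtain U where U: "power_semigroup A U" "U 1 = A - scalar_cop l" by (auto simp: has_powers_at_def)
    show "has_powers_at A m" unfolding has_powers_at_def
      using power_semigroup_mult_binom_power[OF U(1) x comm, of "-1"] U(2) g
      by (intro exI[of _ "\<lambda>t. U t * binom_power (- 1 * t) x"]) simp
  next
    assume "has_powers_at A m"
    then obtain U where U: "power_semigroup A U" "U 1 = A - scalar_cop m" by (auto simp: has_powers_at_def)
    show "has_powers_at A l" unfolding has_powers_at_def
      using power_semigroup_mult_binom_power[OF U(1) x comm, of 1] U(2) f
      by (intro exI[of _ "\<lambda>t. U t * binom_power (1 * t) x"]) simp
  qed
qed

lemma has_powers_at_large:
  fixes A :: "'a::{complex_banach,perfect_space} cop"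
  assumes "norm A < cmod l" shows "has_powers_at A l"
proof -
  define x where "x = scalar_cop (1 / l) * A"
  have l: "l \<noteq> 0" using assms by auto
  have "norm x \<le> cmod (1 / l) * norm A" unfolding x_def by (rule norm_scalar_cop_mult)
  also have "\<dots> < 1" using assms l by (simp add: norm_divide field_simps)
  finally have x: "norm x < 1" .
  have comm: "Y * x = x * Y" if "Y * A = A * Y" for Y
    using that by (metis x_def mult.assoc scalar_cop_commute)
  let ?U = "\<lambda>t. scalar_cop (exp (of_real t * Ln (- l)))"
  have U: "power_semigroup A ?U"
    unfolding power_semigroup_def
  proof (intro conjI allI impI scalar_cop_commute)
    show "?U (s + t) = ?U s * ?U t" for s t by (simp add: scalar_cop_mult distrib_right exp_add)
    have "((\<lambda>t. exp (of_real t * Ln (- l))) \<longlongrightarrow> exp (of_real 0 * Ln (- l))) (at_right 0)"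
      by (intro tendsto_intros)
    hence "((\<lambda>t. exp (of_real t * Ln (- l)) - 1) \<longlongrightarrow> 0) (at_right 0)"
      by (simp add: LIM_zero_iff)
    hence "((\<lambda>t. cmod (exp (of_real t * Ln (- l)) - 1)) \<longlongrightarrow> 0) (at_right 0)"
      by (rule tendsto_norm_zero)
    moreover have "\<forall>t. norm (?U t - 1 :: 'a cop) \<le> cmod (exp (of_real t * Ln (- l)) - 1)"
    proof
      fix t
      show "norm (?U t - 1 :: 'a cop) \<le> cmod (exp (of_real t * Ln (- l)) - 1)"
        using norm_scalar_cop[of "exp (of_real t * Ln (- l)) - 1", where 'a = 'a] by (simp flip: scalar_cop_diff)
    qed
    ultimately have "((\<lambda>t. ?U t - 1 :: 'a cop) \<longlongrightarrow> 0) (at_right 0)"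
      by (rule Lim_null_comparison[OF always_eventually, rotated])
    thus "(?U \<longlongrightarrow> (1 :: 'a cop)) (at_right 0)" by (rule LIM_zero_cancel)
  qed
  from power_semigroup_mult_binom_power[OF U x comm, of 1]
  have "power_semigroup A (\<lambda>t. ?U t * binom_power (1 * t) x)" by simp
  moreover have "?U 1 * binom_power (1 * 1) x = A - scalar_cop l"
  proof -
    have "?U 1 * binom_power (1 * 1) x = scalar_cop (- l) - scalar_cop (- l) * x"
      using l by (simp add: right_diff_distrib)
    also have "scalar_cop (- l) * x = - A"
      using l by (simp add: x_def scalar_cop_mult scalar_cop_minus flip: mult.assoc)
    finally show ?thesis by (simp add: scalar_cop_minus)
  qed
  ultimately show ?thesis unfolding has_powers_at_def by (intro exI conjI)
qed

text \<open>A locally constant property is constant on the component of \<open>l\<close>, which contains points of large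
modulus.\<close>

lemma has_powers_at_outside:
  assumes "l \<in> outside (op_spectrum (cop_apply (A :: 'a::{complex_banach,perfect_space} cop)))"
  shows "has_powers_at A l"
proof -
  define C where "C = connected_component_set (- op_spectrum (cop_apply A)) l"
  have l: "l \<notin> op_spectrum (cop_apply A)" "\<not> bounded C" using assms by (auto simp: outside_def C_def)
  have sub: "C \<subseteq> - op_spectrum (cop_apply A)" unfolding C_def by (rule connected_component_subset)
  obtain k where k: "k \<in> C" "cmod k > norm A"
    using l(2) unfolding bounded_iff by (metis not_le)
  have "has_powers_at A l = has_powers_at A k"
  proof (rule connected_local_const[of C])
    show "connected C" unfolding C_def by (rule connected_connected_component)
    show "l \<in> C" unfolding C_def using l by simp
    show "k \<in> C" by fact
    show "\<forall>a\<in>C. \<forall>\<^sub>F b in at a within C. has_powers_at A a = has_powers_at A b"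
    proof
      fix m assume "m \<in> C"
      then obtain R where R: "R * (A - scalar_cop m) = 1" "(A - scalar_cop m) * R = 1"
        using sub by (metis ComplD in_mono notin_op_spectrum_iff)
      have "((\<lambda>b. cmod (b - m) * norm R) \<longlongrightarrow> cmod (m - m) * norm R) (at m within C)"
        by (intro tendsto_intros)
      hence "\<forall>\<^sub>F b in at m within C. cmod (b - m) * norm R < 1"
        by (rule order_tendstoD) simp
      thus "\<forall>\<^sub>F b in at m within C. has_powers_at A m = has_powers_at A b"
        by eventually_elim (rule has_powers_at_near[OF R, symmetric])
    qed
  qed
  thus ?thesis using has_powers_at_large[OF k(2)] by simp
qed

text \<open>Here \<open>A = (1 - W) (A - c)\<close>, and the semigroup is \<open>(1 - W)\<^sup>t (A - c)\<^sup>t\<close>. The powers of \<open>1 - W\<close> are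
bounded for \<open>0 < t \<le> 1\<close> and converge to the identity on the range of \<open>1 - W\<close>; density of this
range gives strong convergence.\<close>

theorem C0_embeddable_of_power_bounded:
  fixes A :: "'a::{complex_banach,perfect_space} cop"
  assumes pow: "has_powers_at A c"
    and R: "R * (A - scalar_cop c) = 1" "(A - scalar_cop c) * R = 1"
    and W: "W = - (scalar_cop c * R)" "\<And>n. norm (W ^ n) \<le> M"
    and dense: "closure (range (cop_apply (1 - W))) = UNIV"
  shows "C0_embeddable (cop_apply A)"
proof -
  obtain U where U: "power_semigroup A U" "U 1 = A - scalar_cop c" using pow by (auto simp: has_powers_at_def)
  have M: "M \<ge> 1" using W(2)[of 0] by simp
  note ok = binom_summable_power_bounded[OF W(2)]
  have "A * W = W * A"
  proof -
    have "(A - scalar_cop c) * R = R * (A - scalar_cop c)" using R by simp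
    hence "A * R = R * A" by (simp add: algebra_simps scalar_cop_commute)
    thus ?thesis by (simp add: W(1)) (metis mult.assoc scalar_cop_commute)
  qed
  hence UW: "U t * W = W * U t" if "t > 0" for t
    using power_semigroup_commute[OF U(1) _ that, of W] by simp
  define T where "T t = binom_power t W * U t" for t
  have B: "cop_apply (binom_power t W) x - x = cop_apply (binom_power t W - 1) x" for t x
    by (simp add: cop_apply_diff)
  have Blim: "((\<lambda>t. cop_apply (binom_power t W) x) \<longlongrightarrow> x) (at_right 0)" for x
    unfolding tendsto_iff
  proof (intro allI impI)
    fix e :: real assume "e > 0"
    define d where "d = e / (2 * (2 * M + 1))"
    have d: "d > 0" using \<open>e > 0\<close> M by (simp add: d_def)
    have "x \<in> closure (range (cop_apply (1 - W)))" using dense by simp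
    then obtain z where z: "dist (cop_apply (1 - W) z) x < d"
      using d unfolding closure_approachable by auto
    have "((\<lambda>t. 3 * t * M * norm z) \<longlongrightarrow> 3 * 0 * M * norm z) (at_right 0)" by (intro tendsto_intros)
    hence "\<forall>\<^sub>F t in at_right 0. 3 * t * M * norm z < e / 2" using \<open>e > 0\<close> by (intro order_tendstoD) auto
    moreover have "\<forall>\<^sub>F t in at_right (0::real). t < 1 \<and> t > 0"
      using eventually_at_right_real[OF zero_less_one[where 'a = real]] by (auto elim: eventually_mono)
    ultimately show "\<forall>\<^sub>F t in at_right 0. dist (cop_apply (binom_power t W) x) x < e"
    proof eventually_elim
      case (elim t)
      let ?D = "binom_power t W - 1"
      have nD: "norm ?D \<le> 2 * M + 1"
        using norm_triangle_ineq4[of "binom_power t W" 1] norm_binom_power_bounded[OF W(2), of t] elim by simp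
      have "cop_apply ?D x = cop_apply ?D (x - cop_apply (1 - W) z) + cop_apply (?D * (1 - W)) z"
        by (simp add: cop_apply_diff_right)
      also have "norm \<dots> \<le> norm ?D * norm (x - cop_apply (1 - W) z) + norm (?D * (1 - W)) * norm z"
        by (intro norm_triangle_mono norm_cop_apply)
      also have "\<dots> \<le> (2 * M + 1) * d + 3 * t * M * norm z"
        using nD z elim M norm_binom_power_minus_one_mult[OF W(2), of t]
        by (intro add_mono mult_mono) (auto simp: dist_norm norm_minus_commute)
      also have "(2 * M + 1) * d = e / 2" using M by (simp add: d_def field_simps)
      also have "e / 2 + 3 * t * M * norm z < e" using elim by simp
      finally show ?case by (simp add: dist_norm B)
    qed
  qed
  have "C0_semigroup (\<lambda>t. cop_apply (T t))"
    unfolding C0_semigroup_def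
  proof (intro conjI allI impI bounded_clinear_cop_apply)
    fix t s :: real assume ts: "t > 0" "s > 0"
    have "T t * T s = binom_power t W * (U t * binom_power s W) * U s" by (simp add: T_def mult.assoc)
    also have "U t * binom_power s W = binom_power s W * U t"
      by (rule binom_power_commute[OF ok[OF ts(2)] UW[OF ts(1)]])
    finally have "T t * T s = (binom_power t W * binom_power s W) * (U t * U s)" by (simp add: mult.assoc)
    also have "\<dots> = T (t + s)"
      using power_semigroup_add[OF U(1) ts] binom_power_add[OF ok ok, OF ts] by (simp only: T_def)
    finally show "cop_apply (T t) \<circ> cop_apply (T s) = cop_apply (T (t + s))"
      by (auto simp: fun_eq_iff simp flip: cop_apply_mult)
  next
    fix x
    have "((\<lambda>t. 2 * M * (norm (U t - 1) * norm x) + norm (cop_apply (binom_power t W) x - x)) \<longlongrightarrow>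
        2 * M * (norm (1 - 1 :: 'a cop) * norm x) + norm (x - x)) (at_right 0)"
      by (intro tendsto_intros Blim power_semigroup_tendsto[OF U(1)])
    hence lim: "((\<lambda>t. 2 * M * (norm (U t - 1) * norm x) + norm (cop_apply (binom_power t W) x - x)) \<longlongrightarrow> 0) (at_right 0)"
      by simp
    have "\<forall>\<^sub>F t in at_right 0. norm (norm (cop_apply (T t) x - x)) \<le>
        2 * M * (norm (U t - 1) * norm x) + norm (cop_apply (binom_power t W) x - x)"
      using eventually_at_right_real[OF zero_less_one[where 'a = real]]
    proof eventually_elim
      case (elim t)
      have "cop_apply (T t) x - x = cop_apply (binom_power t W) (cop_apply (U t - 1) x) + (cop_apply (binom_power t W) x - x)"
        by (simp add: T_def cop_apply_diff cop_apply_diff_right)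
      also have "norm \<dots> \<le> norm (binom_power t W) * norm (cop_apply (U t - 1) x) + norm (cop_apply (binom_power t W) x - x)"
        by (intro norm_triangle_mono norm_cop_apply order_refl)
      also have "norm (binom_power t W) * norm (cop_apply (U t - 1) x) \<le> 2 * M * (norm (U t - 1) * norm x)"
        using elim M by (intro mult_mono norm_cop_apply norm_binom_power_bounded[OF W(2)]) auto
      finally show ?case by simp
    qed
    from Lim_null_comparison[OF this lim]
    show "((\<lambda>t. norm (cop_apply (T t) x - x)) \<longlongrightarrow> 0) (at_right 0)" by simp
  qed
  moreover have "T 1 = A"
  proof -
    have "T 1 = (1 + scalar_cop c * R) * (A - scalar_cop c)" by (simp add: T_def U(2) W(1))
    also have "\<dots> = A" by (simp add: distrib_right mult.assoc R)
    finally show ?thesis .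
  qed
  ultimately show ?thesis unfolding C0_embeddable_def by (intro exI[of _ "\<lambda>t. cop_apply (T t)"]) simp
qed

section \<open>Fourier series in $L^2(\mathbb T)$\<close>

lemma circle_eq_Abs_cis_Arg2pi: "z = Abs_circle (cis (Arg2pi (of_circle z)))"
proof -
  have "cis (Arg2pi (of_circle z)) = of_circle z"
    using complex_norm_eq_1_exp[of "of_circle z"] by (simp add: cis_conv_exp)
  thus ?thesis by (simp add: of_circle_inverse)
qed

lemma compact_UNIV_circle: "compact (UNIV :: circle set)"
proof -
  have "compact ((\<lambda>t. Abs_circle (cis t)) ` {0..2 * pi})"
    by (intro compact_continuous_image continuous_on_subset[OF continuous_Abs_cis]) auto
  moreover have "(\<lambda>t. Abs_circle (cis t)) ` {0..2 * pi} = UNIV"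
  proof (rule UNIV_eq_I[symmetric])
    fix z show "z \<in> (\<lambda>t. Abs_circle (cis t)) ` {0..2 * pi}"
      using Arg2pi[of "of_circle z"] by (intro image_eqI[where x = "Arg2pi (of_circle z)"] circle_eq_Abs_cis_Arg2pi) auto
  qed
  ultimately show ?thesis by simp
qed

inductive_set trig_poly :: "(circle \<Rightarrow> complex) set" where
  powi: "(\<lambda>z. of_circle z powi n) \<in> trig_poly"
| add: "f \<in> trig_poly \<Longrightarrow> g \<in> trig_poly \<Longrightarrow> (\<lambda>z. f z + g z) \<in> trig_poly"
| scale: "f \<in> trig_poly \<Longrightarrow> (\<lambda>z. c * f z) \<in> trig_poly"

lemma trig_poly_powi_mult: "g \<in> trig_poly \<Longrightarrow> (\<lambda>z. of_circle z powi n * g z) \<in> trig_poly"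
proof (induction rule: trig_poly.induct)
  case (powi m)
  have "(\<lambda>z. of_circle z powi n * of_circle z powi m) = (\<lambda>z. of_circle z powi (n + m))"
    by (simp add: power_int_add)
  thus ?case using trig_poly.powi by simp
next
  case (add f g) thus ?case using trig_poly.add by (simp add: distrib_left)
next
  case (scale f c) thus ?case using trig_poly.scale[OF scale(2), of c] by (simp add: mult_ac)
qed

lemma trig_poly_mult: "f \<in> trig_poly \<Longrightarrow> g \<in> trig_poly \<Longrightarrow> (\<lambda>z. f z * g z) \<in> trig_poly"
proof (induction rule: trig_poly.induct)
  case (powi n) thus ?case by (rule trig_poly_powi_mult)
next
  case (add f h) thus ?case using trig_poly.add by (simp add: distrib_right)
next
  case (scale f c) thus ?case using trig_poly.scale[of "\<lambda>z. f z * g z" c] by (simp add: mult_ac)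
qed

lemma trig_poly_const: "(\<lambda>_. c) \<in> trig_poly"
  using trig_poly.scale[OF trig_poly.powi[of 0], of c] by simp

lemma trig_poly_continuous: "f \<in> trig_poly \<Longrightarrow> continuous_on UNIV f"
  by (induction rule: trig_poly.induct) (auto intro!: continuous_intros continuous_of_circle)

lemma trig_poly_Re_Im:
  "(\<lambda>z. complex_of_real (Re (of_circle z))) \<in> trig_poly" "(\<lambda>z. complex_of_real (Im (of_circle z))) \<in> trig_poly"
proof -
  have c: "of_circle z powi (- 1) = cnj (of_circle z)" for z
    using of_circle_powi_minus[of z 1] by simp
  have "(\<lambda>z. complex_of_real (Re (of_circle z))) = (\<lambda>z. (1 / 2) * (of_circle z powi 1 + of_circle z powi (- 1)))"
    unfolding c by (simp add: fun_eq_iff complex_add_cnj)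
  thus "(\<lambda>z. complex_of_real (Re (of_circle z))) \<in> trig_poly"
    using trig_poly.scale[OF trig_poly.add[OF trig_poly.powi[of 1] trig_poly.powi[of "-1"]], of "1 / 2"] by simp
  have "(\<lambda>z. complex_of_real (Im (of_circle z))) =
      (\<lambda>z. (- \<i> / 2) * (of_circle z powi 1 + (- 1) * of_circle z powi (- 1)))"
    unfolding c by (simp add: fun_eq_iff complex_eq_iff)
  thus "(\<lambda>z. complex_of_real (Im (of_circle z))) \<in> trig_poly"
    using trig_poly.scale[OF trig_poly.add[OF trig_poly.powi[of 1]
        trig_poly.scale[OF trig_poly.powi[of "-1"], of "-1"]], of "- \<i> / 2"] by simp
qed

text \<open>Stone-Weierstrass, for the algebra of those real functions that are trigonometric polynomials with
complex coefficients.\<close>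

lemma trig_poly_approx_real:
  fixes h :: "circle \<Rightarrow> real"
  assumes "continuous_on UNIV h" "e > 0"
  obtains p where "p \<in> trig_poly" "\<And>z. cmod (complex_of_real (h z) - p z) < e"
proof -
  let ?R = "{h :: circle \<Rightarrow> real. (\<lambda>z. complex_of_real (h z)) \<in> trig_poly}"
  interpret function_ring_on ?R UNIV
  proof
    show "compact (UNIV :: circle set)" by (rule compact_UNIV_circle)
  next
    fix f assume "f \<in> ?R"
    hence "continuous_on UNIV (\<lambda>z. Re (complex_of_real (f z)))"
      by (intro continuous_on_Re trig_poly_continuous) simp
    thus "continuous_on UNIV f" by simp
  next
    fix f g assume fg: "f \<in> ?R" "g \<in> ?R"
    show "(\<lambda>x. f x + g x) \<in> ?R" using trig_poly.add fg by simp
    show "(\<lambda>x. f x * g x) \<in> ?R" using trig_poly_mult fg by simp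
  next
    fix c show "(\<lambda>_. c) \<in> ?R" using trig_poly_const by simp
  next
    fix x y :: circle assume "x \<noteq> y"
    hence "Re (of_circle x) \<noteq> Re (of_circle y) \<or> Im (of_circle x) \<noteq> Im (of_circle y)"
      by (auto simp: of_circle_inject[symmetric] complex_eq_iff)
    thus "\<exists>f\<in>?R. f x \<noteq> f y"
    proof
      assume "Re (of_circle x) \<noteq> Re (of_circle y)"
      thus ?thesis using trig_poly_Re_Im(1) by (intro bexI[of _ "\<lambda>z. Re (of_circle z)"]) auto
    next
      assume "Im (of_circle x) \<noteq> Im (of_circle y)"
      thus ?thesis using trig_poly_Re_Im(2) by (intro bexI[of _ "\<lambda>z. Im (of_circle z)"]) auto
    qed
  qed
  obtain g where g: "g \<in> ?R" "\<forall>x\<in>UNIV. \<bar>h x - g x\<bar> < e"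
    using Stone_Weierstrass_basic[OF assms] by blast
  have "cmod (complex_of_real (h z) - complex_of_real (g z)) < e" for z
    using g(2) by (simp flip: of_real_diff)
  thus ?thesis using that[of "\<lambda>z. complex_of_real (g z)"] g(1) by simp
qed

lemma continuous_circle_bounded:
  fixes f :: "circle \<Rightarrow> 'a::real_normed_vector"
  assumes "continuous_on UNIV f" obtains C where "\<And>z. norm (f z) \<le> C"
proof -
  have "bounded (f ` UNIV)"
    by (intro compact_imp_bounded compact_continuous_image assms compact_UNIV_circle)
  thus ?thesis using that unfolding bounded_iff by auto
qed

lemma integrable_mult_bounded:
  fixes f g :: "circle \<Rightarrow> complex"
  assumes f: "integrable circle_measure f" and [measurable]: "g \<in> borel_measurable borel" and g: "\<And>z. cmod (g z) \<le> C"
  shows "integrable circle_measure (\<lambda>z. f z * g z)"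
proof (rule Bochner_Integration.integrable_bound)
  show "integrable circle_measure (\<lambda>z. C * cmod (f z))" using f by simp
  show "(\<lambda>z. f z * g z) \<in> borel_measurable circle_measure" using f by measurable
  show "AE z in circle_measure. cmod (f z * g z) \<le> norm (C * cmod (f z))"
  proof (rule AE_I2)
    fix z
    have "cmod (f z) * cmod (g z) \<le> cmod (f z) * C" by (intro mult_left_mono g) auto
    also have "\<dots> \<le> norm (C * cmod (f z))" by (simp add: mult.commute)
    finally show "cmod (f z * g z) \<le> norm (C * cmod (f z))" by (simp add: norm_mult)
  qed
qed

text \<open>The orthogonality passes from characters to trigonometric polynomials, by uniform approximation to
continuous functions, by dominated convergence to indicators of closed sets, and by a Dynkin argument to
indicators of all Borel sets.\<close>

theorem fourier_uniqueness:
  assumes f: "integrable circle_measure f"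
    and zero: "\<And>n. (LINT z|circle_measure. f z * of_circle z powi n) = 0"
  shows "AE z in circle_measure. f z = 0"
proof -
  have [measurable]: "f \<in> borel_measurable circle_measure" using f by auto
  have trig: "integrable circle_measure (\<lambda>z. f z * p z) \<and> (LINT z|circle_measure. f z * p z) = 0"
    if "p \<in> trig_poly" for p
    using that
  proof (induction rule: trig_poly.induct)
    case (powi n)
    have "integrable circle_measure (\<lambda>z. f z * of_circle z powi n)"
      by (rule integrable_mult_bounded[OF f, of _ 1]) (auto simp: norm_power_int)
    thus ?case using zero by simp
  next
    case (add p q) thus ?case by (simp add: distrib_left)
  next
    case (scale p c)
    have "(\<lambda>z. f z * (c * p z)) = (\<lambda>z. c * (f z * p z))" by (simp add: fun_eq_iff)
    thus ?case using scale by simp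
  qed
  have cont: "(LINT z|circle_measure. f z * complex_of_real (h z)) = 0" if h: "continuous_on UNIV h" for h
  proof -
    let ?I = "LINT z|circle_measure. cmod (f z)"
    have [measurable]: "h \<in> borel_measurable borel" by (intro borel_measurable_continuous_onI h)
    obtain C where C: "\<And>z. norm (h z) \<le> C" using continuous_circle_bounded[OF h] by blast
    have int: "integrable circle_measure (\<lambda>z. f z * complex_of_real (h z))"
      by (rule integrable_mult_bounded[OF f, of _ C]) (use C in auto)
    have "cmod (LINT z|circle_measure. f z * complex_of_real (h z)) \<le> 0 + e" if "e > 0" for e
    proof -
      define d where "d = e / (?I + 1)"
      have I: "?I \<ge> 0" by simp
      hence I1: "?I + 1 \<noteq> 0" by linarith
      have d: "d > 0" unfolding d_def using that I by (intro divide_pos_pos add_nonneg_pos) auto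
      obtain p where p: "p \<in> trig_poly" "\<And>z. cmod (complex_of_real (h z) - p z) < d"
        using trig_poly_approx_real[OF h d] by blast
      have "(LINT z|circle_measure. f z * complex_of_real (h z)) =
          (LINT z|circle_measure. f z * complex_of_real (h z) - f z * p z)"
        using trig[OF p(1)] int by (subst Bochner_Integration.integral_diff) auto
      also have "cmod \<dots> \<le> (LINT z|circle_measure. d * cmod (f z))"
      proof (rule order_trans[OF Bochner_Integration.integral_norm_bound Bochner_Integration.integral_mono])
        show "integrable circle_measure (\<lambda>z. cmod (f z * complex_of_real (h z) - f z * p z))"
          using trig[OF p(1)] int by (intro integrable_norm Bochner_Integration.integrable_diff) auto
        show "integrable circle_measure (\<lambda>z. d * cmod (f z))" using f by simp
        fix z
        have "cmod (f z * complex_of_real (h z) - f z * p z) = cmod (complex_of_real (h z) - p z) * cmod (f z)"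
          by (simp add: norm_mult flip: right_diff_distrib)
        also have "\<dots> \<le> d * cmod (f z)" using p(2)[of z] by (intro mult_right_mono) auto
        finally show "cmod (f z * complex_of_real (h z) - f z * p z) \<le> d * cmod (f z)" .
      qed
      also have "\<dots> = d * ?I" by simp
      also have "\<dots> \<le> d * (?I + 1)" using d by (intro mult_left_mono) auto
      also have "\<dots> = e" using I1 by (simp add: d_def)
      finally show ?thesis by simp
    qed
    hence "cmod (LINT z|circle_measure. f z * complex_of_real (h z)) \<le> 0" by (rule field_le_epsilon)
    thus ?thesis by simp
  qed
  have closed_zero: "(LINT z:A|circle_measure. f z) = 0" if A: "closed A" for A
  proof (cases "A = {}")
    case False
    have [measurable]: "A \<in> sets borel" using A by (rule borel_closed)
    define h where "h k z = max 0 (1 - real k * infdist z A)" for k z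
    have "continuous_on UNIV (h k)" for k unfolding h_def by (intro continuous_intros)
    hence [measurable]: "h k \<in> borel_measurable borel" for k by (rule borel_measurable_continuous_onI)
    have lim: "(\<lambda>k. h k z) \<longlonglongrightarrow> indicator A z" for z
    proof (cases "z \<in> A")
      case True thus ?thesis by (simp add: h_def)
    next
      case z: False
      hence "infdist z A > 0"
        using A False by (metis in_closed_iff_infdist_zero infdist_nonneg less_eq_real_def)
      then obtain K :: nat where K: "1 < real K * infdist z A" using reals_Archimedean3 by blast
      have "h k z = 0" if "k \<ge> K" for k
      proof -
        have "real K * infdist z A \<le> real k * infdist z A" using that by (intro mult_right_mono) (auto simp: infdist_nonneg)
        thus ?thesis using K by (simp add: h_def)
      qed
      hence "(\<lambda>k. h k z) \<longlonglongrightarrow> 0" by (intro tendsto_eventually eventually_sequentiallyI)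
      thus ?thesis using z by simp
    qed
    have "(\<lambda>k. LINT z|circle_measure. f z * complex_of_real (h k z)) \<longlonglongrightarrow>
        (LINT z|circle_measure. f z * complex_of_real (indicator A z))"
    proof (rule integral_dominated_convergence)
      show "integrable circle_measure (\<lambda>z. cmod (f z))" using f by simp
      show "AE z in circle_measure. (\<lambda>k. f z * complex_of_real (h k z)) \<longlonglongrightarrow> f z * complex_of_real (indicator A z)"
        by (intro AE_I2 tendsto_intros lim)
      show "(\<lambda>z. f z * complex_of_real (indicator A z)) \<in> borel_measurable circle_measure"
        by measurable
      fix k
      have "h k z \<le> 1" "0 \<le> h k z" for z by (auto simp: h_def infdist_nonneg)
      hence "cmod (f z) * \<bar>h k z\<bar> \<le> cmod (f z) * 1" for z by (intro mult_left_mono) auto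
      thus "AE z in circle_measure. cmod (f z * complex_of_real (h k z)) \<le> cmod (f z)"
        by (intro AE_I2) (simp add: norm_mult)
    qed measurable
    moreover have "(LINT z|circle_measure. f z * complex_of_real (h k z)) = 0" for k
      by (intro cont) fact
    ultimately have "(LINT z|circle_measure. f z * complex_of_real (indicator A z)) = 0"
      by (simp add: LIMSEQ_const_iff)
    moreover have "(LINT z:A|circle_measure. f z) = (LINT z|circle_measure. f z * complex_of_real (indicator A z))"
      unfolding set_lebesgue_integral_def by (intro Bochner_Integration.integral_cong) (auto simp: scaleR_conv_of_real mult.commute)
    ultimately show ?thesis by simp
  qed (simp add: set_lebesgue_integral_def)
  have "(LINT z:A|circle_measure. f z) = 0" if "A \<in> sets circle_measure" for A
  proof -
    have A: "A \<in> sigma_sets UNIV (Collect closed)"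
      using that by (simp add: borel_eq_closed)
    have "Int_stable (Collect (closed :: circle set \<Rightarrow> bool))" by (auto simp: Int_stable_def)
    moreover have "Collect (closed :: circle set \<Rightarrow> bool) \<subseteq> Pow UNIV" by auto
    ultimately show ?thesis
      using A
    proof (induction rule: sigma_sets_induct_disjoint)
      case (basic A) thus ?case by (simp add: closed_zero)
    next
      case empty show ?case by (simp add: set_lebesgue_integral_def)
    next
      case (compl A)
      hence A[measurable]: "A \<in> sets circle_measure" by (simp add: borel_eq_closed)
      have "(LINT z|circle_measure. f z) = 0" using zero[of 0] by simp
      moreover have "(LINT z:UNIV|circle_measure. f z) = (LINT z:(A \<union> (UNIV - A))|circle_measure. f z)" by simp
      moreover have "\<dots> = (LINT z:A|circle_measure. f z) + (LINT z:(UNIV - A)|circle_measure. f z)"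
        using f A by (intro set_integral_Un) (auto simp: set_integrable_def intro!: integrable_mult_indicator sets.compl_sets)
      moreover have "(LINT z:UNIV|circle_measure. f z) = (LINT z|circle_measure. f z)"
        by (simp add: set_lebesgue_integral_def)
      ultimately show ?case using compl.IH by simp
    next
      case (union A)
      hence A: "A i \<in> sets circle_measure" for i by (auto simp: borel_eq_closed)
      have "(LINT z:(\<Union>i. A i)|circle_measure. f z) = (\<Sum>i. (LINT z:(A i)|circle_measure. f z))"
        using union.hyps A f
        by (intro lebesgue_integral_countable_add) (auto simp: disjoint_family_on_def set_integrable_def intro!: integrable_mult_indicator)
      thus ?case by (simp add: union.IH)
    qed
  qed
  thus ?thesis by (intro circle_measure.density_zero f)
qed

lemma L2_eqI:
  assumes "\<And>n. fourier_coeff f n = fourier_coeff g n" shows "f = g"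
proof -
  define u where "u = rep_L2 (f - g)"
  have u: "f - g = abs_L2 u" "sq_int u" by (simp_all add: u_def abs_rep_L2 sq_int_rep_L2)
  have "(LINT z|circle_measure. u z * of_circle z powi n) = fourier_coeff (f - g) (- n)" for n
    unfolding u(1) by (subst fourier_coeff.abs_eq) (auto simp: ae_eq_def u(2))
  hence "AE z in circle_measure. u z = 0"
    by (intro fourier_uniqueness sq_int_imp_integrable u) (simp add: fourier_coeff_diff assms)
  hence "ae_eq u (\<lambda>_. 0)" using u(2) sq_int_0 by (simp add: ae_eq_def)
  hence "abs_L2 u = abs_L2 (\<lambda>_. 0)" by (rule Quotient3_rel_abs[OF Quotient3_L2])
  hence "abs_L2 u = 0" by (simp add: zero_L2_def)
  thus ?thesis using u(1) by simp
qed

lemma norm_char_sum: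
  assumes "inj_on \<tau> A" "finite A"
  shows "(norm (\<Sum>k\<in>A. a k *\<^sub>C char_L2 (\<tau> k)))\<^sup>2 = (\<Sum>k\<in>A. (cmod (a k))\<^sup>2)"
proof -
  let ?S = "\<Sum>k\<in>A. a k *\<^sub>C char_L2 (\<tau> k)"
  have c: "fourier_coeff ?S (\<tau> n) = a n" if "n \<in> A" for n
  proof -
    have "fourier_coeff ?S (\<tau> n) = (\<Sum>k\<in>A. if k = n then a k else 0)"
      unfolding fourier_coeff_sum
      by (intro sum.cong refl) (use assms that in \<open>auto simp: fourier_coeff_scaleC fourier_coeff_char inj_on_def\<close>)
    thus ?thesis using that assms by simp
  qed
  have "(norm ?S)\<^sup>2 = (\<Sum>k\<in>A. inner ?S (a k *\<^sub>C char_L2 (\<tau> k)))"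
    by (simp add: power2_norm_eq_inner inner_sum_right)
  also have "\<dots> = (\<Sum>k\<in>A. Re (cnj (a k) * a k))"
    by (intro sum.cong refl) (simp add: inner_scaleC_char c del: times_complex.sel)
  also have "\<dots> = (\<Sum>k\<in>A. (cmod (a k))\<^sup>2)"
    by (intro sum.cong refl) (simp only: mult.commute[of "cnj _"] Re_mult_cnj_self)
  finally show ?thesis .
qed

lemma bessel_inj:
  assumes "inj_on \<tau> A" "finite A"
  shows "(\<Sum>k\<in>A. (cmod (fourier_coeff f (\<tau> k)))\<^sup>2) \<le> (norm f)\<^sup>2"
proof -
  let ?a = "\<lambda>k. fourier_coeff f (\<tau> k)"
  let ?S = "\<Sum>k\<in>A. ?a k *\<^sub>C char_L2 (\<tau> k)"
  let ?q = "\<Sum>k\<in>A. (cmod (?a k))\<^sup>2"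
  have "inner f ?S = (\<Sum>k\<in>A. Re (cnj (?a k) * ?a k))"
    by (simp add: inner_sum_right inner_scaleC_char del: times_complex.sel)
  also have "\<dots> = ?q"
    by (intro sum.cong refl) (simp only: mult.commute[of "cnj _"] Re_mult_cnj_self)
  finally have i: "inner f ?S = ?q" .
  have "0 \<le> (norm (f - ?S))\<^sup>2" by simp
  also have "\<dots> = (norm f)\<^sup>2 - 2 * inner f ?S + (norm ?S)\<^sup>2"
    by (simp add: power2_norm_eq_inner inner_diff inner_commute)
  also have "\<dots> = (norm f)\<^sup>2 - ?q"
    unfolding i norm_char_sum[OF assms] by simp
  finally show ?thesis by simp
qed

lemma summable_fourier_coeff:
  assumes "inj (\<tau> :: nat \<Rightarrow> int)" shows "summable (\<lambda>k. (cmod (fourier_coeff f (\<tau> k)))\<^sup>2)"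
  by (rule bounded_imp_summable[of _ "(norm f)\<^sup>2"])
     (auto intro!: bessel_inj inj_on_subset[OF assms])

text \<open>The characters are enumerated by an arbitrary injection \<open>\<tau>\<close>, since two enumerations are needed
below: of the nonnegative integers, and of all integers.\<close>

lemma riesz_fischer:
  assumes inj: "inj (\<tau> :: nat \<Rightarrow> int)" and sq: "summable (\<lambda>k. (cmod (a k))\<^sup>2)"
  obtains s where "(\<lambda>k. a k *\<^sub>C char_L2 (\<tau> k)) sums s" "(norm s)\<^sup>2 = (\<Sum>k. (cmod (a k))\<^sup>2)"
    "\<And>k. fourier_coeff s (\<tau> k) = a k" "\<And>n. n \<notin> range \<tau> \<Longrightarrow> fourier_coeff s n = 0"
proof -
  let ?t = "\<lambda>k. a k *\<^sub>C char_L2 (\<tau> k)"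
  have inj': "inj_on \<tau> A" for A using inj by (rule inj_on_subset) simp
  have "summable ?t"
    unfolding summable_Cauchy
  proof (intro allI impI)
    fix e :: real assume "e > 0"
    then obtain N where N: "\<And>m n. m \<ge> N \<Longrightarrow> norm (\<Sum>k\<in>{m..<n}. (cmod (a k))\<^sup>2) < e\<^sup>2"
      using sq unfolding summable_Cauchy by (meson zero_less_power)
    have "norm (sum ?t {m..<n}) < e" if "m \<ge> N" for m n
    proof (rule power2_less_imp_less)
      show "(norm (sum ?t {m..<n}))\<^sup>2 < e\<^sup>2"
        using N[OF that, of n] by (subst norm_char_sum) (auto intro: inj')
    qed (use \<open>e > 0\<close> in simp)
    thus "\<exists>N. \<forall>m\<ge>N. \<forall>n. norm (sum ?t {m..<n}) < e" by blast
  qed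
  then obtain s where s: "?t sums s" by (auto simp: summable_def)
  have c: "(\<lambda>k. a k * (if \<tau> k = n then 1 else 0)) sums fourier_coeff s n" for n
    using bounded_linear.sums[OF bounded_linear_fourier_coeff s, of n]
    by (simp add: fourier_coeff_scaleC fourier_coeff_char)
  show ?thesis
  proof
    show "?t sums s" by fact
    have "(\<lambda>n. (norm (\<Sum>k<n. ?t k))\<^sup>2) \<longlonglongrightarrow> (norm s)\<^sup>2"
      using s unfolding sums_def by (intro tendsto_intros)
    moreover have "(norm (\<Sum>k<n. ?t k))\<^sup>2 = (\<Sum>k<n. (cmod (a k))\<^sup>2)" for n
      by (rule norm_char_sum) (auto intro: inj')
    ultimately have "(\<lambda>k. (cmod (a k))\<^sup>2) sums (norm s)\<^sup>2" by (simp add: sums_def)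
    thus "(norm s)\<^sup>2 = (\<Sum>k. (cmod (a k))\<^sup>2)" by (rule sums_unique)
  next
    fix k
    have "(\<lambda>j. a j * (if \<tau> j = \<tau> k then 1 else 0)) = (\<lambda>j. if j = k then a j else 0)"
      using inj by (auto simp: fun_eq_iff inj_def)
    thus "fourier_coeff s (\<tau> k) = a k"
      using c[of "\<tau> k"] sums_single[of k a] by (simp add: sums_unique2)
  next
    fix n assume "n \<notin> range \<tau>"
    hence "(\<lambda>j. a j * (if \<tau> j = n then 1 else 0)) = (\<lambda>_. 0)" by (auto simp: fun_eq_iff)
    thus "fourier_coeff s n = 0" using c[of n] sums_zero by (simp add: sums_iff)
  qed
qed

lemma riesz_proj_eq_self: "(\<And>n. n < 0 \<Longrightarrow> fourier_coeff f n = 0) \<Longrightarrow> riesz_proj f = f"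
  by (rule L2_eqI) (auto simp: fourier_coeff_riesz_proj)

section \<open>Multiplication and Toeplitz operators\<close>

definition bounded_measurable :: "(circle \<Rightarrow> complex) \<Rightarrow> bool" where
  "bounded_measurable F \<longleftrightarrow> F \<in> borel_measurable borel \<and> (\<exists>C. \<forall>z. cmod (F z) \<le> C)"

lemma bounded_measurableI: "F \<in> borel_measurable borel \<Longrightarrow> (\<And>z. cmod (F z) \<le> C) \<Longrightarrow> bounded_measurable F"
  by (auto simp: bounded_measurable_def)

lemma bounded_measurableE:
  assumes "bounded_measurable F"
  obtains C where "F \<in> borel_measurable borel" "C \<ge> 0" "\<And>z. cmod (F z) \<le> C"
proof -
  from assms obtain C where C: "F \<in> borel_measurable borel" "\<And>z. cmod (F z) \<le> C"
    by (auto simp: bounded_measurable_def)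
  moreover have "C \<ge> 0" using order_trans[OF norm_ge_zero C(2)] .
  ultimately show ?thesis using that by blast
qed

lemma bounded_measurable_measurable: "bounded_measurable F \<Longrightarrow> F \<in> borel_measurable borel"
  by (simp add: bounded_measurable_def)

lemma bounded_measurable_continuous: "continuous_on UNIV F \<Longrightarrow> bounded_measurable F"
  by (rule continuous_circle_bounded[of F]) (blast intro: bounded_measurableI borel_measurable_continuous_onI)+

lemma bounded_measurable_const: "bounded_measurable (\<lambda>_. c)"
  by (rule bounded_measurableI[of _ "cmod c"]) auto

lemma bounded_measurable_powi: "bounded_measurable (\<lambda>z. of_circle z powi n)"
  by (rule bounded_measurableI[of _ 1]) (auto simp: norm_power_int)

lemma bounded_measurable_mult:
  assumes "bounded_measurable F" "bounded_measurable G" shows "bounded_measurable (\<lambda>z. F z * G z)"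
proof -
  obtain C where C: "F \<in> borel_measurable borel" "C \<ge> 0" "\<And>z. cmod (F z) \<le> C" using bounded_measurableE[OF assms(1)] by blast
  obtain D where D: "G \<in> borel_measurable borel" "D \<ge> 0" "\<And>z. cmod (G z) \<le> D" using bounded_measurableE[OF assms(2)] by blast
  show ?thesis
    using C D by (intro bounded_measurableI[of _ "C * D"]) (auto simp: norm_mult intro!: mult_mono)
qed

lemma bounded_measurable_add:
  assumes "bounded_measurable F" "bounded_measurable G" shows "bounded_measurable (\<lambda>z. F z + G z)"
proof -
  obtain C where C: "F \<in> borel_measurable borel" "C \<ge> 0" "\<And>z. cmod (F z) \<le> C" using bounded_measurableE[OF assms(1)] by blast
  obtain D where D: "G \<in> borel_measurable borel" "D \<ge> 0" "\<And>z. cmod (G z) \<le> D" using bounded_measurableE[OF assms(2)] by blast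
  show ?thesis
    using C D by (intro bounded_measurableI[of _ "C + D"]) (auto intro: order_trans[OF norm_triangle_ineq add_mono])
qed

lemma bounded_measurable_uminus: "bounded_measurable F \<Longrightarrow> bounded_measurable (\<lambda>z. - F z)"
  using bounded_measurable_mult[OF bounded_measurable_const[of "-1"], of F] by simp

lemma bounded_measurable_diff:
  "bounded_measurable F \<Longrightarrow> bounded_measurable G \<Longrightarrow> bounded_measurable (\<lambda>z. F z - G z)"
  using bounded_measurable_add[OF _ bounded_measurable_uminus, of F G] by simp

lemma bounded_measurable_cnj: "bounded_measurable F \<Longrightarrow> bounded_measurable (\<lambda>z. cnj (F z))"
  by (auto simp: bounded_measurable_def)

lemma bounded_measurable_exp:
  assumes "bounded_measurable F" shows "bounded_measurable (\<lambda>z. exp (F z))"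
proof -
  obtain C where C: "F \<in> borel_measurable borel" "C \<ge> 0" "\<And>z. cmod (F z) \<le> C" using bounded_measurableE[OF assms] by blast
  note [measurable] = C(1)
  have "cmod (exp (F z)) \<le> exp C" for z using norm_exp[of "F z"] C(3)[of z] by (meson exp_le_cancel_iff order_trans)
  thus ?thesis by (intro bounded_measurableI) auto
qed

lemma bounded_measurable_sq_int: "bounded_measurable F \<Longrightarrow> sq_int F"
  by (auto simp: bounded_measurable_def intro: sq_int_bounded)

lemma L2_cases: obtains u where "sq_int u" "f = abs_L2 u"
  using that[OF sq_int_rep_L2, of f] by (simp add: abs_rep_L2)

lemma abs_L2_add: "sq_int f \<Longrightarrow> sq_int g \<Longrightarrow> abs_L2 f + abs_L2 g = abs_L2 (\<lambda>z. f z + g z)"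
  by (rule plus_L2.abs_eq) (auto simp: ae_eq_def)

lemma abs_L2_scaleC: "sq_int f \<Longrightarrow> c *\<^sub>C abs_L2 f = abs_L2 (\<lambda>z. c * f z)"
  by (rule scaleC_L2.abs_eq) (auto simp: ae_eq_def)

lemma abs_L2_cong: "sq_int f \<Longrightarrow> sq_int g \<Longrightarrow> AE z in circle_measure. f z = g z \<Longrightarrow> abs_L2 f = abs_L2 g"
  by (rule Quotient3_rel_abs[OF Quotient3_L2]) (simp add: ae_eq_def)

lemma abs_L2_eq_iff: "sq_int f \<Longrightarrow> sq_int g \<Longrightarrow> abs_L2 f = abs_L2 g \<longleftrightarrow> (AE z in circle_measure. f z = g z)"
  using Quotient3_rel[OF Quotient3_L2, of f g] by (auto simp: ae_eq_def)

lemma sq_int_bm_mult: "bounded_measurable F \<Longrightarrow> sq_int u \<Longrightarrow> sq_int (\<lambda>z. F z * u z)"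
  by (auto simp: bounded_measurable_def intro: sq_int_mult)

lemma mult_op_abs_L2: "bounded_measurable F \<Longrightarrow> sq_int u \<Longrightarrow> mult_op F (abs_L2 u) = abs_L2 (\<lambda>z. F z * u z)"
  by (auto simp: bounded_measurable_def intro: mult_op_abs)

lemma mult_op_add_right: "bounded_measurable F \<Longrightarrow> mult_op F (f + g) = mult_op F f + mult_op F g"
  by (rule L2_cases[of f], rule L2_cases[of g])
     (simp add: abs_L2_add mult_op_abs_L2 sq_int_bm_mult sq_int_add distrib_left)

lemma mult_op_scaleC: "bounded_measurable F \<Longrightarrow> mult_op F (c *\<^sub>C f) = c *\<^sub>C mult_op F f"
  by (rule L2_cases[of f])
     (simp add: abs_L2_scaleC mult_op_abs_L2 sq_int_bm_mult sq_int_cmult mult.left_commute)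

lemma mult_op_mult:
  "bounded_measurable F \<Longrightarrow> bounded_measurable G \<Longrightarrow> mult_op F (mult_op G f) = mult_op (\<lambda>z. F z * G z) f"
  by (rule L2_cases[of f])
     (simp add: mult_op_abs_L2 sq_int_bm_mult bounded_measurable_mult mult.assoc)

lemma mult_op_add_left:
  "bounded_measurable F \<Longrightarrow> bounded_measurable G \<Longrightarrow> mult_op (\<lambda>z. F z + G z) f = mult_op F f + mult_op G f"
  by (rule L2_cases[of f])
     (simp add: abs_L2_add mult_op_abs_L2 sq_int_bm_mult bounded_measurable_add distrib_right)

lemma mult_op_const: "mult_op (\<lambda>_. c) f = c *\<^sub>C f"
  by (rule L2_cases[of f]) (simp add: mult_op_abs_L2 bounded_measurable_const abs_L2_scaleC)

lemma norm_abs_L2_le: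
  assumes "sq_int f" "sq_int g" "C \<ge> 0" "\<And>z. cmod (f z) \<le> C * cmod (g z)"
  shows "norm (abs_L2 f) \<le> C * norm (abs_L2 g)"
proof (rule power2_le_imp_le)
  have "(norm (abs_L2 f))\<^sup>2 = (LINT z|circle_measure. (cmod (f z))\<^sup>2)" by (rule norm_abs_L2[OF assms(1)])
  also have "\<dots> \<le> (LINT z|circle_measure. C\<^sup>2 * (cmod (g z))\<^sup>2)"
  proof (rule Bochner_Integration.integral_mono)
    fix z show "(cmod (f z))\<^sup>2 \<le> C\<^sup>2 * (cmod (g z))\<^sup>2"
      using power_mono[OF assms(4)[of z], of 2] by (simp add: power_mult_distrib)
  qed (use assms in \<open>auto simp: sq_int_def\<close>)
  also have "\<dots> = (C * norm (abs_L2 g))\<^sup>2" by (simp add: norm_abs_L2[OF assms(2)] power_mult_distrib)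
  finally show "(norm (abs_L2 f))\<^sup>2 \<le> (C * norm (abs_L2 g))\<^sup>2" .
qed (use assms in simp)

lemma norm_mult_op_le:
  assumes "F \<in> borel_measurable borel" "\<And>z. cmod (F z) \<le> C" shows "norm (mult_op F f) \<le> C * norm f"
proof -
  have F: "bounded_measurable F" by (rule bounded_measurableI[OF assms])
  have C: "C \<ge> 0" using order_trans[OF norm_ge_zero assms(2)] .
  show ?thesis
    by (rule L2_cases[of f])
       (auto simp: mult_op_abs_L2 F norm_mult intro!: norm_abs_L2_le sq_int_bm_mult[OF F] C mult_right_mono assms(2))
qed

lemma bounded_linear_mult_op:
  assumes F: "bounded_measurable F" shows "bounded_linear (mult_op F)"
proof -
  obtain C where C: "F \<in> borel_measurable borel" "C \<ge> 0" "\<And>z. cmod (F z) \<le> C" using bounded_measurableE[OF F] by blast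
  show ?thesis
    by (rule bounded_linear_intro[of _ C])
       (use norm_mult_op_le[OF C(1,3)] in \<open>auto simp: mult_op_add_right[OF F] mult_op_scaleC[OF F] mult.commute simp flip: scaleC_of_real\<close>)
qed

lemma fourier_coeff_mult_powi:
  "fourier_coeff (mult_op (\<lambda>z. of_circle z powi m) f) n = fourier_coeff f (n - m)"
proof (rule L2_cases[of f])
  fix u assume u: "sq_int u" "f = abs_L2 u"
  have "cnj (of_circle z powi (n - m)) = of_circle z powi m * cnj (of_circle z powi n)" for z
    by (simp add: of_circle_powi_minus[symmetric] flip: power_int_add del: complex_cnj_power_int)
  thus ?thesis
    using u sq_int_bm_mult[OF bounded_measurable_powi u(1), of m]
    by (simp add: mult_op_abs_L2 bounded_measurable_powi fourier_coeff_abs mult.assoc mult.left_commute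
        del: complex_cnj_power_int)
qed

text \<open>The boundary functions of $H^\infty$. A symbol \<open>b\<close> is called co-analytic if the complex conjugate of \<open>b\<close>
is an analytic symbol.\<close>

definition analytic_symbol :: "(circle \<Rightarrow> complex) \<Rightarrow> bool" where
  "analytic_symbol u \<longleftrightarrow> bounded_measurable u \<and> (\<forall>n<0. fourier_coeff (abs_L2 u) n = 0)"

lemma analytic_symbol_bm: "analytic_symbol u \<Longrightarrow> bounded_measurable u"
  by (simp add: analytic_symbol_def)

lemma mult_op_char:
  assumes "bounded_measurable u" shows "mult_op u (char_L2 k) = mult_op (\<lambda>z. of_circle z powi k) (abs_L2 u)"
  unfolding char_L2_def using assms
  by (simp add: mult_op_abs_L2 bounded_measurable_powi bounded_measurable_sq_int sq_int_powi mult.commute)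

text \<open>Multiplication by an analytic symbol does not lower the order of a Fourier series. For \<open>m = 0\<close> the
product is expanded along the series of \<open>f\<close>; the general case is reduced to this one by shifting the
coefficients.\<close>

lemma mult_op_analytic:
  assumes u: "analytic_symbol u" and f: "\<And>n. n < m \<Longrightarrow> fourier_coeff f n = 0" and n: "n < m"
  shows "fourier_coeff (mult_op u f) n = 0"
proof -
  note bm = analytic_symbol_bm[OF u]
  have zero: "fourier_coeff (mult_op u g) n = 0" if g: "\<And>n. n < 0 \<Longrightarrow> fourier_coeff g n = 0" and "n < 0" for g n
  proof -
    have "(\<lambda>k. fourier_coeff g (int k) *\<^sub>C char_L2 (int k)) sums g"
      using riesz_proj_sums[of g] riesz_proj_eq_self[OF g] by simp
    hence "(\<lambda>k. mult_op u (fourier_coeff g (int k) *\<^sub>C char_L2 (int k))) sums mult_op u g"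
      by (rule bounded_linear.sums[OF bounded_linear_mult_op[OF bm]])
    hence "(\<lambda>k. fourier_coeff (mult_op u (fourier_coeff g (int k) *\<^sub>C char_L2 (int k))) n) sums fourier_coeff (mult_op u g) n"
      by (rule bounded_linear.sums[OF bounded_linear_fourier_coeff])
    moreover have "fourier_coeff (mult_op u (fourier_coeff g (int k) *\<^sub>C char_L2 (int k))) n = 0" for k
      using u \<open>n < 0\<close>
      by (simp only: mult_op_scaleC[OF bm] fourier_coeff_scaleC mult_op_char[OF bm] fourier_coeff_mult_powi)
         (simp add: analytic_symbol_def)
    ultimately show ?thesis using sums_unique2[OF sums_zero] by fastforce
  qed
  let ?s = "\<lambda>m z. of_circle z powi m"
  have "mult_op u f = mult_op (?s m) (mult_op u (mult_op (?s (- m)) f))"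
  proof -
    have "(\<lambda>z. of_circle z powi m * (u z * of_circle z powi (- m))) = u"
      by (simp add: fun_eq_iff power_int_minus)
    thus ?thesis by (simp only: mult_op_mult bm bounded_measurable_powi bounded_measurable_mult)
  qed
  hence "fourier_coeff (mult_op u f) n = fourier_coeff (mult_op u (mult_op (?s (- m)) f)) (n - m)"
    by (simp add: fourier_coeff_mult_powi)
  also have "\<dots> = 0" using n by (intro zero) (auto simp: fourier_coeff_mult_powi f)
  finally show ?thesis .
qed

lemma analytic_symbol_mult:
  assumes "analytic_symbol u" "analytic_symbol v" shows "analytic_symbol (\<lambda>z. u z * v z)"
proof -
  have "abs_L2 (\<lambda>z. u z * v z) = mult_op u (abs_L2 v)"
    using assms by (simp add: mult_op_abs_L2 analytic_symbol_bm bounded_measurable_sq_int)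
  thus ?thesis
    using assms mult_op_analytic[OF assms(1), of 0 "abs_L2 v"]
    by (auto simp: analytic_symbol_def bounded_measurable_mult)
qed

lemma analytic_symbol_const: "analytic_symbol (\<lambda>_. c)"
proof -
  have "abs_L2 (\<lambda>_. c) = c *\<^sub>C char_L2 0"
    unfolding char_L2_def by (simp add: abs_L2_scaleC bounded_measurable_sq_int[OF bounded_measurable_const])
  thus ?thesis by (auto simp: analytic_symbol_def bounded_measurable_const fourier_coeff_scaleC fourier_coeff_char)
qed

lemma analytic_symbol_add:
  assumes "analytic_symbol u" "analytic_symbol v" shows "analytic_symbol (\<lambda>z. u z + v z)"
  using assms by (auto simp: analytic_symbol_def bounded_measurable_add bounded_measurable_sq_int fourier_coeff_add simp flip: abs_L2_add)

lemma analytic_symbol_uminus: "analytic_symbol u \<Longrightarrow> analytic_symbol (\<lambda>z. - u z)"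
  using analytic_symbol_mult[OF analytic_symbol_const[of "-1"], of u] by simp

text \<open>Partial sums of the exponential series are analytic and uniformly bounded, so each Fourier
coefficient passes to the limit.\<close>

lemma analytic_symbol_exp:
  assumes u: "analytic_symbol u" shows "analytic_symbol (\<lambda>z. exp (u z))"
proof -
  obtain C where C: "u \<in> borel_measurable borel" "C \<ge> 0" "\<And>z. cmod (u z) \<le> C"
    using bounded_measurableE[OF analytic_symbol_bm[OF u]] by blast
  note [measurable] = C(1)
  have pow: "analytic_symbol (\<lambda>z. u z ^ k)" for k
    by (induction k) (auto intro: analytic_symbol_const analytic_symbol_mult u)
  define S where "S K z = (\<Sum>k<K. inverse (fact k) * u z ^ k)" for K z
  have S: "analytic_symbol (S K)" for K
  proof (induction K)
    case 0 show ?case using analytic_symbol_const[of 0] by (simp add: S_def)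
  next
    case (Suc K)
    from analytic_symbol_add[OF Suc analytic_symbol_mult[OF analytic_symbol_const[of "inverse (fact K)"] pow[of K]]]
    show ?case by (simp add: S_def fun_eq_iff)
  qed
  have [measurable]: "S K \<in> borel_measurable borel" for K unfolding S_def by measurable
  have lim: "(\<lambda>K. S K z) \<longlonglongrightarrow> exp (u z)" for z
    using exp_converges[of "u z"] by (simp add: sums_def S_def scaleR_conv_of_real)
  have bound: "cmod (S K z) \<le> exp C" for K z
  proof -
    have "cmod (S K z) \<le> (\<Sum>k<K. inverse (fact k) * C ^ k)"
      unfolding S_def
      by (rule sum_norm_le) (auto simp: norm_mult norm_power norm_inverse intro!: mult_left_mono power_mono C)
    also have "\<dots> \<le> exp C"
    proof -
      have "(\<lambda>k. inverse (fact k) * C ^ k) sums exp C" using exp_converges[of C] by simp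
      thus ?thesis using C(2) unfolding sums_iff by (metis (no_types, lifting) finite_lessThan sum_le_suminf
          mult_nonneg_nonneg zero_le_power inverse_nonnegative_iff_nonnegative fact_ge_zero)
    qed
    finally show ?thesis .
  qed
  have bm: "bounded_measurable (\<lambda>z. exp (u z))" by (intro bounded_measurable_exp analytic_symbol_bm u)
  have "fourier_coeff (abs_L2 (\<lambda>z. exp (u z))) n = 0" if "n < 0" for n
  proof -
    have "(\<lambda>K. LINT z|circle_measure. S K z * cnj (of_circle z powi n)) \<longlonglongrightarrow>
        (LINT z|circle_measure. exp (u z) * cnj (of_circle z powi n))"
    proof (rule integral_dominated_convergence)
      show "integrable circle_measure (\<lambda>_. exp C)" by simp
      show "AE z in circle_measure. (\<lambda>K. S K z * cnj (of_circle z powi n)) \<longlonglongrightarrow> exp (u z) * cnj (of_circle z powi n)"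
        by (intro AE_I2 tendsto_mult lim tendsto_const)
      show "AE z in circle_measure. cmod (S K z * cnj (of_circle z powi n)) \<le> exp C" for K
        using bound by (intro AE_I2) (simp add: norm_mult norm_power_int)
    qed measurable
    moreover have "(LINT z|circle_measure. S K z * cnj (of_circle z powi n)) = 0" for K
      using S[of K] that fourier_coeff_abs[of "S K" n] by (simp add: analytic_symbol_def bounded_measurable_sq_int del: complex_cnj_power_int)
    ultimately have "(LINT z|circle_measure. exp (u z) * cnj (of_circle z powi n)) = 0"
      by (simp add: LIMSEQ_const_iff)
    thus ?thesis by (simp add: fourier_coeff_abs bounded_measurable_sq_int[OF bm] del: complex_cnj_power_int)
  qed
  thus ?thesis using bm by (simp add: analytic_symbol_def)
qed

lemma fourier_coeff_cnj:
  assumes "sq_int u" shows "fourier_coeff (abs_L2 (\<lambda>z. cnj (u z))) n = cnj (fourier_coeff (abs_L2 u) (- n))"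
proof -
  have "sq_int (\<lambda>z. cnj (u z))" using assms by (auto simp: sq_int_def)
  hence "fourier_coeff (abs_L2 (\<lambda>z. cnj (u z))) n = (LINT z|circle_measure. cnj (u z * of_circle z powi n))"
    by (simp add: fourier_coeff_abs)
  also have "\<dots> = cnj (LINT z|circle_measure. u z * of_circle z powi n)"
    by (rule Bochner_Integration.integral_cnj)
  also have "(LINT z|circle_measure. u z * of_circle z powi n) = fourier_coeff (abs_L2 u) (- n)"
    using assms by (subst fourier_coeff.abs_eq) (auto simp: ae_eq_def)
  finally show ?thesis .
qed

lemma riesz_proj_add: "riesz_proj (f + g) = riesz_proj f + riesz_proj g"
  by (rule L2_eqI) (simp add: fourier_coeff_riesz_proj fourier_coeff_add)

lemma riesz_proj_scaleC: "riesz_proj (c *\<^sub>C f) = c *\<^sub>C riesz_proj f"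
  by (rule L2_eqI) (simp add: fourier_coeff_riesz_proj fourier_coeff_scaleC)

lemma inner_riesz_proj_orthogonal: "inner (f - riesz_proj f) (riesz_proj f) = 0"
proof -
  have "(\<lambda>k. inner (f - riesz_proj f) (fourier_coeff f (int k) *\<^sub>C char_L2 (int k))) sums inner (f - riesz_proj f) (riesz_proj f)"
    by (rule bounded_linear.sums[OF bounded_linear_inner_right riesz_proj_sums])
  moreover have "inner (f - riesz_proj f) (fourier_coeff f (int k) *\<^sub>C char_L2 (int k)) = 0" for k
    by (simp add: inner_scaleC_char fourier_coeff_diff fourier_coeff_riesz_proj del: times_complex.sel)
  ultimately show ?thesis using sums_unique2[OF sums_zero] by fastforce
qed

lemma riesz_proj_pythagoras: "(norm f)\<^sup>2 = (norm (riesz_proj f))\<^sup>2 + (norm (f - riesz_proj f))\<^sup>2"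
proof -
  have "inner f f = inner (riesz_proj f + (f - riesz_proj f)) (riesz_proj f + (f - riesz_proj f))" by simp
  also have "\<dots> = inner (riesz_proj f) (riesz_proj f) + inner (f - riesz_proj f) (f - riesz_proj f)"
    unfolding inner_add_left inner_add_right using inner_riesz_proj_orthogonal[of f]
    by (simp add: inner_commute)
  finally show ?thesis by (simp add: power2_norm_eq_inner)
qed

lemma norm_riesz_proj_le: "norm (riesz_proj f) \<le> norm f"
  by (rule power2_le_imp_le) (simp_all add: riesz_proj_pythagoras[of f])

text \<open>The part of \<open>f\<close> that \<open>P\<^sub>+\<close> removes has only negative frequencies, and it keeps this property when
multiplied by a co-analytic symbol. This is \<open>mult_op_analytic\<close> after complex conjugation, with \<open>m = 1\<close>.\<close>

lemma mult_op_coanalytic: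
  assumes b: "analytic_symbol (\<lambda>z. cnj (b z))"
  shows "riesz_proj (mult_op b (riesz_proj f)) = riesz_proj (mult_op b f)"
proof -
  have bm: "bounded_measurable b" using bounded_measurable_cnj[OF analytic_symbol_bm[OF b]] by simp
  obtain w where w: "sq_int w" "f - riesz_proj f = abs_L2 w" by (rule L2_cases)
  have cw: "sq_int (\<lambda>z. cnj (w z))" using w(1) by (auto simp: sq_int_def)
  have "fourier_coeff (mult_op b (f - riesz_proj f)) n = 0" if n: "n \<ge> 0" for n
  proof -
    have "fourier_coeff (mult_op (\<lambda>z. cnj (b z)) (abs_L2 (\<lambda>z. cnj (w z)))) (- n) = 0"
    proof (rule mult_op_analytic[OF b, of 1])
      fix k :: int assume "k < 1"
      hence "fourier_coeff (f - riesz_proj f) (- k) = 0" by (simp add: fourier_coeff_diff fourier_coeff_riesz_proj)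
      thus "fourier_coeff (abs_L2 (\<lambda>z. cnj (w z))) k = 0" by (simp add: fourier_coeff_cnj w)
    qed (use n in simp)
    also have "mult_op (\<lambda>z. cnj (b z)) (abs_L2 (\<lambda>z. cnj (w z))) = abs_L2 (\<lambda>z. cnj (b z * w z))"
      by (simp add: mult_op_abs_L2 bounded_measurable_cnj bm cw)
    also have "fourier_coeff (abs_L2 (\<lambda>z. cnj (b z * w z))) (- n) = cnj (fourier_coeff (mult_op b (f - riesz_proj f)) n)"
      by (simp add: fourier_coeff_cnj[OF sq_int_bm_mult[OF bm w(1)]] w mult_op_abs_L2 bm del: complex_cnj_mult)
    finally show ?thesis by simp
  qed
  hence "riesz_proj (mult_op b (f - riesz_proj f)) = 0"
    by (intro L2_eqI) (simp add: fourier_coeff_riesz_proj fourier_coeff_0)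
  moreover have "mult_op b f = mult_op b (riesz_proj f) + mult_op b (f - riesz_proj f)"
    by (simp flip: mult_op_add_right[OF bm])
  ultimately show ?thesis by (simp add: riesz_proj_add)
qed

instance H2 :: perfect_space
proof
  fix x :: H2
  define v :: H2 where "v = Abs_H2 (char_L2 0)"
  have "of_H2 v = char_L2 0" unfolding v_def by (rule Abs_H2_inverse) (simp add: fourier_coeff_char)
  hence v: "v \<noteq> 0" using fourier_coeff_char[of 0 0] by (auto simp: zero_H2.rep_eq fourier_coeff_0)
  show "\<not> open {x}"
  proof
    assume "open {x}"
    then obtain e where e: "e > 0" "\<And>y. dist y x < e \<Longrightarrow> y = x" unfolding open_dist by auto
    have "dist (x + (e / (2 * norm v)) *\<^sub>R v) x < e" using v e(1) by (simp add: dist_norm)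
    from e(2)[OF this] v e(1) show False by simp
  qed
qed

lemma H2_eqI: "of_H2 f = of_H2 g \<Longrightarrow> f = g"
  by (simp add: of_H2_inject)

lemma riesz_proj_of_H2 [simp]: "riesz_proj (of_H2 f) = of_H2 f"
  using of_H2[of f] by (intro riesz_proj_eq_self) auto

lemma of_H2_coeff: "n < 0 \<Longrightarrow> fourier_coeff (of_H2 f) n = 0"
  using of_H2[of f] by auto

lemma bounded_clinear_toeplitz:
  assumes F: "bounded_measurable F" shows "bounded_clinear (toeplitz F)"
proof -
  obtain C where C: "F \<in> borel_measurable borel" "C \<ge> 0" "\<And>z. cmod (F z) \<le> C" using bounded_measurableE[OF F] by blast
  have add: "toeplitz F (f + g) = toeplitz F f + toeplitz F g" for f g
    by (rule H2_eqI) (simp add: of_H2_toeplitz plus_H2.rep_eq mult_op_add_right[OF F] riesz_proj_add)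
  have sc: "toeplitz F (c *\<^sub>C f) = c *\<^sub>C toeplitz F f" for c f
    by (rule H2_eqI) (simp add: of_H2_toeplitz scaleC_H2.rep_eq mult_op_scaleC[OF F] riesz_proj_scaleC)
  have "norm (toeplitz F f) \<le> norm f * C" for f
  proof -
    have "norm (of_H2 (toeplitz F f)) \<le> C * norm (of_H2 f)"
      unfolding of_H2_toeplitz by (rule order_trans[OF norm_riesz_proj_le norm_mult_op_le[OF C(1,3)]])
    thus ?thesis by (simp add: norm_of_H2 mult.commute)
  qed
  hence "bounded_linear (toeplitz F)"
    by (intro bounded_linear_intro[of _ C]) (simp_all only: add sc scaleC_of_real[symmetric])
  thus ?thesis using sc by (simp add: bounded_clinear_def)
qed

definition toeplitz_cop :: "(circle \<Rightarrow> complex) \<Rightarrow> H2 cop" where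
  "toeplitz_cop F = (SOME A. cop_apply A = toeplitz F)"

lemma cop_apply_toeplitz: "bounded_measurable F \<Longrightarrow> cop_apply (toeplitz_cop F) = toeplitz F"
  unfolding toeplitz_cop_def
  by (rule cop_of_bounded_clinear[OF bounded_clinear_toeplitz], assumption) (metis (mono_tags, lifting) someI_ex)

lemma of_H2_toeplitz_cop:
  "bounded_measurable F \<Longrightarrow> of_H2 (cop_apply (toeplitz_cop F) f) = riesz_proj (mult_op F (of_H2 f))"
  by (simp add: cop_apply_toeplitz of_H2_toeplitz)

lemma norm_toeplitz_cop_le:
  assumes "F \<in> borel_measurable borel" "\<And>z. cmod (F z) \<le> C" shows "norm (toeplitz_cop F) \<le> C"
proof (rule norm_cop_le)
  show "C \<ge> 0" using order_trans[OF norm_ge_zero assms(2)] .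
  fix f
  have "norm (of_H2 (cop_apply (toeplitz_cop F) f)) \<le> C * norm (of_H2 f)"
    unfolding of_H2_toeplitz_cop[OF bounded_measurableI[OF assms]]
    by (rule order_trans[OF norm_riesz_proj_le norm_mult_op_le[OF assms]])
  thus "norm (cop_apply (toeplitz_cop F) f) \<le> C * norm f" by (simp add: norm_of_H2)
qed

lemma toeplitz_cop_const: "toeplitz_cop (\<lambda>_. c) = scalar_cop c"
  by (rule cop_eqI, rule H2_eqI)
     (simp add: of_H2_toeplitz_cop bounded_measurable_const mult_op_const riesz_proj_scaleC scaleC_H2.rep_eq)

lemma toeplitz_cop_add:
  "bounded_measurable F \<Longrightarrow> bounded_measurable G \<Longrightarrow> toeplitz_cop (\<lambda>z. F z + G z) = toeplitz_cop F + toeplitz_cop G"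
  by (rule cop_eqI, rule H2_eqI)
     (simp add: of_H2_toeplitz_cop bounded_measurable_add mult_op_add_left riesz_proj_add cop_apply_add plus_H2.rep_eq)

lemma toeplitz_cop_mult_analytic:
  assumes F: "bounded_measurable F" and u: "analytic_symbol u"
  shows "toeplitz_cop (\<lambda>z. F z * u z) = toeplitz_cop F * toeplitz_cop u"
proof (rule cop_eqI, rule H2_eqI)
  fix f
  note bm = analytic_symbol_bm[OF u]
  have "riesz_proj (mult_op u (of_H2 f)) = mult_op u (of_H2 f)"
    by (intro riesz_proj_eq_self mult_op_analytic[OF u, of 0] of_H2_coeff)
  thus "of_H2 (cop_apply (toeplitz_cop (\<lambda>z. F z * u z)) f) = of_H2 (cop_apply (toeplitz_cop F * toeplitz_cop u) f)"
    by (simp add: of_H2_toeplitz_cop F bm bounded_measurable_mult mult_op_mult)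
qed

lemma toeplitz_cop_coanalytic_mult:
  assumes F: "bounded_measurable F" and b: "analytic_symbol (\<lambda>z. cnj (b z))"
  shows "toeplitz_cop (\<lambda>z. b z * F z) = toeplitz_cop b * toeplitz_cop F"
proof (rule cop_eqI, rule H2_eqI)
  fix f
  have bm: "bounded_measurable b" using bounded_measurable_cnj[OF analytic_symbol_bm[OF b]] by simp
  show "of_H2 (cop_apply (toeplitz_cop (\<lambda>z. b z * F z)) f) = of_H2 (cop_apply (toeplitz_cop b * toeplitz_cop F) f)"
    by (simp add: of_H2_toeplitz_cop F bm bounded_measurable_mult mult_op_coanalytic[OF b] mult_op_mult)
qed

text \<open>The \<open>L\<^sup>2\<close> class \<open>P\<^sub>+ g\<close> has an essentially bounded representative; it is truncated to a function
\<open>u\<close> that is bounded everywhere, and \<open>v\<close> is the pointwise difference, so that the splitting of \<open>g\<close> holds at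
every point.\<close>

lemma riesz_proj_split:
  assumes g: "continuous_on UNIV g" and ess: "ess_bounded (riesz_proj (abs_L2 g))"
  obtains u v where "analytic_symbol u" "analytic_symbol (\<lambda>z. cnj (v z))" "\<And>z. g z = u z + v z"
proof -
  define p where "p = rep_L2 (riesz_proj (abs_L2 g))"
  have p: "sq_int p" "abs_L2 p = riesz_proj (abs_L2 g)" by (simp_all add: p_def sq_int_rep_L2 abs_rep_L2)
  obtain C where C: "AE z in circle_measure. cmod (p z) \<le> C" using ess by (auto simp: ess_bounded_def p_def)
  have [measurable]: "p \<in> borel_measurable borel" using p(1) by (simp add: sq_int_def)
  define u where "u z = (if cmod (p z) \<le> C then p z else 0)" for z
  have bm: "bounded_measurable u"
    by (rule bounded_measurableI[of _ "max C 0"]) (auto simp: u_def[abs_def])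
  have up: "abs_L2 u = abs_L2 p"
    by (intro abs_L2_cong bounded_measurable_sq_int bm p, rule AE_mp[OF C]) (auto simp: u_def)
  have gb: "bounded_measurable g" by (rule bounded_measurable_continuous[OF g])
  define v where "v z = g z - u z" for z
  have vb: "bounded_measurable v" unfolding v_def[abs_def] by (intro bounded_measurable_diff gb bm)
  have "abs_L2 v = abs_L2 g - riesz_proj (abs_L2 g)"
    unfolding v_def[abs_def] p(2)[symmetric] up[symmetric]
    by (rule abs_L2_minus[symmetric]) (intro bounded_measurable_sq_int gb bm)+
  hence "fourier_coeff (abs_L2 v) n = 0" if "n \<ge> 0" for n
    using that by (simp add: fourier_coeff_diff fourier_coeff_riesz_proj)
  hence coanalytic: "analytic_symbol (\<lambda>z. cnj (v z))"
    by (simp add: analytic_symbol_def bounded_measurable_cnj vb fourier_coeff_cnj bounded_measurable_sq_int)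
  have analytic: "analytic_symbol u"
    by (simp add: analytic_symbol_def bm up p fourier_coeff_riesz_proj)
  show ?thesis by (rule that[OF analytic coanalytic]) (simp add: v_def)
qed

section \<open>Boundary uniqueness and dense ranges\<close>

lemma emeasure_circle_open_pos:
  assumes U: "open U" "z \<in> U" shows "emeasure circle_measure U > 0"
proof -
  define V where "V = (\<lambda>t. Abs_circle (cis t)) -` U"
  have V: "open V" unfolding V_def by (rule open_vimage[OF U(1) continuous_Abs_cis])
  define t where "t = Arg2pi (of_circle z)"
  have t: "0 \<le> t" "t < 2 * pi" using Arg2pi[of "of_circle z"] by (auto simp: t_def)
  have "t \<in> V" using U(2) circle_eq_Abs_cis_Arg2pi[of z] by (simp add: V_def t_def)
  then obtain e where e: "e > 0" "ball t e \<subseteq> V" using V open_contains_ball by blast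
  define b where "b = min (t + e) (2 * pi)"
  have b: "t < b" "{t<..<b} \<subseteq> {0..2 * pi} \<inter> V"
    using t e by (auto simp: b_def dist_real_def subset_iff)
  have meas: "U \<in> sets borel" "V \<in> sets borel" using U V by auto
  have "0 < emeasure lborel {t<..<b}" using b by simp
  also have "\<dots> \<le> emeasure lborel ({0..2 * pi} \<inter> V)" using b meas by (intro emeasure_mono) auto
  finally have pos: "0 < emeasure lborel ({0..2 * pi} \<inter> V)" .
  have "emeasure circle_measure U = emeasure (uniform_measure lborel {0..2 * pi}) V"
    unfolding circle_measure_def V_def using meas by (subst emeasure_distr) auto
  also have "\<dots> = emeasure lborel ({0..2 * pi} \<inter> V) / emeasure lborel {0..2 * pi}"
    using meas by (subst emeasure_uniform_measure) auto
  finally show ?thesis using pos by (simp add: ennreal_zero_less_divide)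
qed

text \<open>By the parallelogram law a minimising sequence is a Cauchy sequence.\<close>

lemma minimal_norm_element:
  fixes K :: "'a::{real_inner, banach} set"
  assumes "convex K" "closed K" "K \<noteq> {}"
  obtains g where "g \<in> K" "\<And>h. h \<in> K \<Longrightarrow> norm g \<le> norm h"
proof -
  define d where "d = (INF x\<in>K. norm x)"
  have bdd: "bdd_below (norm ` K)" by (rule bdd_belowI2[of _ 0]) simp
  have le: "d \<le> norm h" if "h \<in> K" for h unfolding d_def by (rule cINF_lower[OF bdd that])
  have d0: "0 \<le> d" unfolding d_def using assms(3) by (intro cINF_greatest) auto
  have "\<exists>x\<in>K. norm x < d + 1 / real (Suc n)" for n
  proof -
    have "d < d + 1 / real (Suc n)" by simp
    thus ?thesis unfolding d_def using assms(3) bdd by (subst (asm) cINF_less_iff) auto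
  qed
  then obtain x where x: "\<And>n. x n \<in> K" "\<And>n. norm (x n) < d + 1 / real (Suc n)" by metis
  have lim: "(\<lambda>n. d + 1 / real (Suc n)) \<longlonglongrightarrow> d"
    using tendsto_add[OF tendsto_const LIMSEQ_inverse_real_of_nat, of d] by (simp add: inverse_eq_divide)
  have par: "(norm (x m - x n))\<^sup>2 \<le> 2 * (d + 1 / real (Suc m))\<^sup>2 + 2 * (d + 1 / real (Suc n))\<^sup>2 - 4 * d\<^sup>2" for m n
  proof -
    have "(1 / 2) *\<^sub>R x m + (1 / 2) *\<^sub>R x n \<in> K" using assms(1) x(1) by (intro convexD) auto
    hence "d \<le> norm ((1 / 2) *\<^sub>R (x m + x n))" using le by (simp add: scaleR_add_right)
    hence "2 * d \<le> norm (x m + x n)" by simp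
    hence "(2 * d)\<^sup>2 \<le> (norm (x m + x n))\<^sup>2" using d0 by (intro power_mono) auto
    moreover have "(norm (x m - x n))\<^sup>2 = 2 * (norm (x m))\<^sup>2 + 2 * (norm (x n))\<^sup>2 - (norm (x m + x n))\<^sup>2"
      by (simp add: power2_norm_eq_inner inner_diff inner_add inner_commute)
    moreover have "(norm (x k))\<^sup>2 \<le> (d + 1 / real (Suc k))\<^sup>2" for k
      using x(2)[of k] by (intro power_mono) auto
    note this[of m] this[of n]
    ultimately show ?thesis by (simp add: power_mult_distrib)
  qed
  have "Cauchy x"
  proof (rule CauchyI)
    fix e :: real assume e: "e > 0"
    have "(\<lambda>n. (d + 1 / real (Suc n))\<^sup>2) \<longlonglongrightarrow> d\<^sup>2" by (intro tendsto_power lim)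
    hence "\<forall>\<^sub>F n in sequentially. (d + 1 / real (Suc n))\<^sup>2 < d\<^sup>2 + e\<^sup>2 / 4"
      by (rule order_tendstoD) (use e in simp)
    then obtain M where M: "\<And>n. n \<ge> M \<Longrightarrow> (d + 1 / real (Suc n))\<^sup>2 < d\<^sup>2 + e\<^sup>2 / 4"
      unfolding eventually_sequentially by blast
    have "norm (x m - x n) < e" if "m \<ge> M" "n \<ge> M" for m n
    proof (rule power2_less_imp_less)
      show "(norm (x m - x n))\<^sup>2 < e\<^sup>2" using par[of m n] M[OF that(1)] M[OF that(2)] by linarith
    qed (use e in simp)
    thus "\<exists>M. \<forall>m\<ge>M. \<forall>n\<ge>M. norm (x m - x n) < e" by blast
  qed
  then obtain g where g: "x \<longlonglongrightarrow> g" using Cauchy_convergent_iff convergent_def by blast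
  have "g \<in> K" using closed_sequentially[OF assms(2)] x(1) g by blast
  moreover have "norm g \<le> d"
    by (rule LIMSEQ_le[OF tendsto_norm[OF g] lim]) (use x(2) less_imp_le in blast)
  ultimately show ?thesis using that le by (meson order_trans)
qed

text \<open>A nonzero inner product would allow a small step along \<open>h\<close> that decreases the norm. The step \<open>t\<close> used
here is the minimiser with \<open>H + 1\<close> in place of \<open>H\<close>, which avoids a case distinction for \<open>h = 0\<close>.\<close>

lemma inner_eq_0_of_minimal:
  fixes g h :: "'a::real_inner"
  assumes "\<And>t. norm g \<le> norm (g + t *\<^sub>R h)" shows "inner g h = 0"
proof -
  define s where "s = inner g h"
  define H where "H = inner h h"
  have H: "H \<ge> 0" by (simp add: H_def)
  define t where "t = - s / (H + 1)"
  have "(norm g)\<^sup>2 \<le> (norm (g + t *\<^sub>R h))\<^sup>2" using assms by (intro power_mono) auto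
  also have "\<dots> = (norm g)\<^sup>2 + 2 * t * s + t\<^sup>2 * H"
    unfolding power2_norm_eq_inner by (simp add: inner_add inner_commute s_def H_def power2_eq_square algebra_simps)
  finally have "0 \<le> 2 * t * s + t\<^sup>2 * H" by simp
  moreover have s: "s = - t * (H + 1)"
    using H by (simp add: t_def)
  moreover have "2 * t * (- t * (H + 1)) + t\<^sup>2 * H = - (t\<^sup>2 * (H + 2))"
    by (simp add: power2_eq_square algebra_simps)
  ultimately have "t\<^sup>2 * (H + 2) \<le> 0" by (metis neg_0_le_iff_le)
  hence "t = 0" using H by (simp add: mult_le_0_iff)
  hence "s = 0" using s by simp
  thus ?thesis by (simp add: s_def)
qed

lemma closed_hyperplane_L2: "closed {g. fourier_coeff g n = c}"
proof -
  have "continuous_on UNIV (\<lambda>g. fourier_coeff g n)"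
    by (rule linear_continuous_on[OF bounded_linear_fourier_coeff])
  from continuous_closed_preimage_constant[OF this closed_UNIV, of c] show ?thesis by simp
qed

text \<open>A nonzero Hardy function cannot vanish on a set of positive measure. If it did, division by a power
of \<open>z\<close> and scaling would give a Hardy function with mean value \<open>1\<close> that vanishes on \<open>E\<close>. Among these functions
let \<open>g\<close> have minimal norm. Adding multiples of \<open>z\<^sup>n g\<close> with \<open>n > 0\<close> does not leave the set, so \<open>g\<close> is
orthogonal to every \<open>z\<^sup>n g\<close>. This says that all Fourier coefficients of \<open>|g|\<^sup>2\<close> except the one of
index \<open>0\<close> vanish. So \<open>|g|\<close> is constant almost everywhere, and the constant is \<open>0\<close> because of \<open>E\<close>.\<close>

theorem hardy_uniqueness:
  assumes f: "sq_int f" "\<And>n. n < 0 \<Longrightarrow> fourier_coeff (abs_L2 f) n = 0"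
    and E: "E \<in> sets borel" "emeasure circle_measure E > 0" "AE z in circle_measure. z \<in> E \<longrightarrow> f z = 0"
  shows "abs_L2 f = 0"
proof (rule ccontr)
  assume nz: "abs_L2 f \<noteq> 0"
  note [measurable] = E(1)
  let ?\<chi> = "\<lambda>z. complex_of_real (indicator E z)"
  have bm: "bounded_measurable ?\<chi>" by (rule bounded_measurableI[of _ 1]) (auto simp: indicator_def)
  note chi = bounded_linear_mult_op[OF bm]
  have "\<exists>n. fourier_coeff (abs_L2 f) n \<noteq> 0"
    using L2_eqI[of "abs_L2 f" 0] nz by (auto simp: fourier_coeff_0)
  hence "\<exists>k. fourier_coeff (abs_L2 f) (int k) \<noteq> 0" using f(2) by (metis nonneg_int_cases not_le)
  define k where "k = (LEAST k. fourier_coeff (abs_L2 f) (int k) \<noteq> 0)"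
  have k: "fourier_coeff (abs_L2 f) (int k) \<noteq> 0" unfolding k_def by (rule LeastI_ex) fact
  have below: "fourier_coeff (abs_L2 f) n = 0" if "n < int k" for n
  proof (cases "n < 0")
    case False
    hence "fourier_coeff (abs_L2 f) (int (nat n)) = 0"
      using that not_less_Least[of "nat n" "\<lambda>k. fourier_coeff (abs_L2 f) (int k) \<noteq> 0"] by (simp add: k_def[symmetric])
    thus ?thesis using False by simp
  qed (use f in simp)
  define K where "K = {g. (\<forall>n<0. fourier_coeff g n = 0) \<and> fourier_coeff g 0 = 1 \<and> mult_op ?\<chi> g = 0}"
  have "closed {g. mult_op ?\<chi> g = 0}"
    using continuous_closed_preimage_constant[OF linear_continuous_on[OF chi] closed_UNIV, of 0] by simp
  hence "closed ((\<Inter>n\<in>{..<0}. {g. fourier_coeff g n = 0}) \<inter> {g. fourier_coeff g 0 = 1} \<inter> {g. mult_op ?\<chi> g = 0})"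
    by (intro closed_Int closed_INT closed_hyperplane_L2 ballI)
  also have "(\<Inter>n\<in>{..<0}. {g. fourier_coeff g n = 0}) \<inter> {g. fourier_coeff g 0 = 1} \<inter> {g. mult_op ?\<chi> g = 0} = K"
    by (auto simp: K_def)
  finally have "closed K" .
  moreover have "convex K"
  proof (rule convexI)
    fix g h and u v :: real assume "g \<in> K" "h \<in> K" "0 \<le> u" "0 \<le> v" "u + v = 1"
    thus "u *\<^sub>R g + v *\<^sub>R h \<in> K"
      using bounded_linear.linear[OF chi]
      by (auto simp: K_def fourier_coeff_add fourier_coeff_scaleR linear_add linear_scale simp flip: of_real_add)
  qed
  moreover have "K \<noteq> {}"
  proof -
    define g where "g = (1 / fourier_coeff (abs_L2 f) (int k)) *\<^sub>C mult_op (\<lambda>z. of_circle z powi (- int k)) (abs_L2 f)"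
    have "mult_op ?\<chi> (abs_L2 f) = abs_L2 (\<lambda>_. 0)"
      unfolding mult_op_abs_L2[OF bm f(1)]
      by (intro abs_L2_cong sq_int_bm_mult[OF bm] f sq_int_0, rule AE_mp[OF E(3)]) (auto simp: indicator_def)
    hence z: "mult_op ?\<chi> (abs_L2 f) = 0" by (simp add: zero_L2_def)
    have "mult_op ?\<chi> g = (1 / fourier_coeff (abs_L2 f) (int k)) *\<^sub>C
        mult_op (\<lambda>z. of_circle z powi (- int k)) (mult_op ?\<chi> (abs_L2 f))"
      unfolding g_def mult_op_scaleC[OF bm] mult_op_mult[OF bm bounded_measurable_powi] mult_op_mult[OF bounded_measurable_powi bm]
      by (simp only: mult.commute)
    also have "\<dots> = 0"
      unfolding z linear_0[OF bounded_linear.linear[OF bounded_linear_mult_op[OF bounded_measurable_powi]]] by simp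
    finally have "mult_op ?\<chi> g = 0" .
    hence "g \<in> K" using k below by (auto simp: K_def g_def fourier_coeff_scaleC fourier_coeff_mult_powi)
    thus ?thesis by blast
  qed
  ultimately obtain g where g: "g \<in> K" "\<And>h. h \<in> K \<Longrightarrow> norm g \<le> norm h" using minimal_norm_element by metis
  obtain u where u: "sq_int u" "g = abs_L2 u" by (rule L2_cases)
  have [measurable]: "u \<in> borel_measurable borel" using u(1) by (simp add: sq_int_def)
  have int: "integrable circle_measure (\<lambda>z. complex_of_real ((cmod (u z))\<^sup>2))"
    by (rule integrable_of_real) (use u(1) in \<open>simp add: sq_int_def\<close>)
  have pos: "(LINT z|circle_measure. complex_of_real ((cmod (u z))\<^sup>2) * cnj (of_circle z powi n)) = 0" if n: "n > 0" for n
  proof -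
    let ?I = "LINT z|circle_measure. complex_of_real ((cmod (u z))\<^sup>2) * cnj (of_circle z powi n)"
    let ?h = "mult_op (\<lambda>z. of_circle z powi n) g"
    have orth: "Re (cnj c * ?I) = 0" for c
    proof -
      have "norm g \<le> norm (g + t *\<^sub>R (c *\<^sub>C ?h))" for t :: real
      proof (rule g(2))
        have "mult_op ?\<chi> ?h = mult_op (\<lambda>z. of_circle z powi n) (mult_op ?\<chi> g)"
          unfolding mult_op_mult[OF bm bounded_measurable_powi] mult_op_mult[OF bounded_measurable_powi bm]
          by (simp only: mult.commute)
        also have "\<dots> = 0"
          using g(1) linear_0[OF bounded_linear.linear[OF bounded_linear_mult_op[OF bounded_measurable_powi[of n]]]] by (simp add: K_def)
        finally have "mult_op ?\<chi> ?h = 0" .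
        thus "g + t *\<^sub>R (c *\<^sub>C ?h) \<in> K"
          using g(1) n bounded_linear.linear[OF chi]
          by (auto simp: K_def fourier_coeff_add fourier_coeff_scaleR fourier_coeff_scaleC fourier_coeff_mult_powi
              linear_add linear_scale mult_op_scaleC[OF bm])
      qed
      hence "inner g (c *\<^sub>C ?h) = 0" by (rule inner_eq_0_of_minimal)
      also have "c *\<^sub>C ?h = abs_L2 (\<lambda>z. c * (of_circle z powi n * u z))"
        unfolding u(2) by (simp add: mult_op_abs_L2 bounded_measurable_powi u(1) abs_L2_scaleC sq_int_bm_mult[OF bounded_measurable_powi])
      also have "inner g \<dots> = Re (LINT z|circle_measure. u z * cnj (c * (of_circle z powi n * u z)))"
        unfolding u(2) using u(1)
        by (intro inner_L2.abs_eq) (auto simp: ae_eq_def intro!: sq_int_cmult sq_int_bm_mult[OF bounded_measurable_powi])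
      also have "(LINT z|circle_measure. u z * cnj (c * (of_circle z powi n * u z))) =
          (LINT z|circle_measure. cnj c * (complex_of_real ((cmod (u z))\<^sup>2) * cnj (of_circle z powi n)))"
      proof (intro Bochner_Integration.integral_cong refl)
        fix z
        have "complex_of_real ((cmod (u z))\<^sup>2) = u z * cnj (u z)" by (metis complex_norm_square of_real_power)
        thus "u z * cnj (c * (of_circle z powi n * u z)) =
            cnj c * (complex_of_real ((cmod (u z))\<^sup>2) * cnj (of_circle z powi n))"
          by (simp only: complex_cnj_mult mult_ac)
      qed
      finally show ?thesis by simp
    qed
    have "Re ?I = 0" using orth[of 1] by simp
    moreover have "Im ?I = 0" using orth[of \<i>] by simp
    ultimately show ?thesis by (simp add: complex_eq_iff)
  qed
  define m where "m = (LINT z|circle_measure. (cmod (u z))\<^sup>2)"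
  have m: "(LINT z|circle_measure. complex_of_real ((cmod (u z))\<^sup>2)) = complex_of_real m"
    unfolding m_def by (rule integral_complex_of_real)
  have prod_int: "integrable circle_measure (\<lambda>z. complex_of_real ((cmod (u z))\<^sup>2) * of_circle z powi n)" for n
    by (rule integrable_mult_bounded[OF int, of _ 1]) (auto simp: norm_power_int)
  have powi_int: "integrable circle_measure (\<lambda>z. of_circle z powi n)" for n
    by (rule sq_int_imp_integrable[OF sq_int_powi])
  have coeff: "(LINT z|circle_measure. complex_of_real ((cmod (u z))\<^sup>2) * of_circle z powi n) = (if n = 0 then complex_of_real m else 0)" for n
  proof -
    consider "n = 0" | "n < 0" | "n > 0" by linarith
    thus ?thesis
    proof cases
      case 1 thus ?thesis using m by simp
    next
      case 2
      have "cnj (of_circle z powi (- n)) = of_circle z powi n" for z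
        using of_circle_powi_minus[of z "- n"] by simp
      thus ?thesis using pos[of "- n"] 2 by (simp del: complex_cnj_power_int)
    next
      case 3
      have "(LINT z|circle_measure. complex_of_real ((cmod (u z))\<^sup>2) * of_circle z powi n) =
          (LINT z|circle_measure. cnj (complex_of_real ((cmod (u z))\<^sup>2) * cnj (of_circle z powi n)))"
        by simp
      also have "\<dots> = cnj (LINT z|circle_measure. complex_of_real ((cmod (u z))\<^sup>2) * cnj (of_circle z powi n))"
        by (rule Bochner_Integration.integral_cnj)
      also have "\<dots> = 0" unfolding pos[OF 3] by simp
      finally show ?thesis using 3 by simp
    qed
  qed
  have "AE z in circle_measure. complex_of_real ((cmod (u z))\<^sup>2) - complex_of_real m = 0"
  proof (rule fourier_uniqueness)
    show "integrable circle_measure (\<lambda>z. complex_of_real ((cmod (u z))\<^sup>2) - complex_of_real m)"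
      by (intro Bochner_Integration.integrable_diff int) simp
    fix n
    have "(LINT z|circle_measure. (complex_of_real ((cmod (u z))\<^sup>2) - complex_of_real m) * of_circle z powi n) =
        (LINT z|circle_measure. complex_of_real ((cmod (u z))\<^sup>2) * of_circle z powi n) - (LINT z|circle_measure. complex_of_real m * of_circle z powi n)"
      unfolding left_diff_distrib using prod_int powi_int
      by (intro Bochner_Integration.integral_diff integrable_mult_right) auto
    also have "\<dots> = 0"
      by (simp only: coeff integral_mult_right_zero integral_circle_powi) simp
    finally show "(LINT z|circle_measure. (complex_of_real ((cmod (u z))\<^sup>2) - complex_of_real m) * of_circle z powi n) = 0" .
  qed
  hence const: "AE z in circle_measure. (cmod (u z))\<^sup>2 = m"
    by (rule AE_mp) (intro AE_I2 impI, simp flip: of_real_diff of_real_power)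
  have "abs_L2 (\<lambda>z. ?\<chi> z * u z) = abs_L2 (\<lambda>_. 0)"
    using g(1) by (simp add: K_def u(2) mult_op_abs_L2[OF bm u(1)] zero_L2_def)
  hence zeroE: "AE z in circle_measure. ?\<chi> z * u z = 0"
    by (subst (asm) abs_L2_eq_iff) (auto intro: sq_int_bm_mult[OF bm u(1)] sq_int_0)
  have "m = 0"
  proof (rule ccontr)
    assume "m \<noteq> 0"
    have "AE z in circle_measure. z \<notin> E"
      using const zeroE
    proof eventually_elim
      case (elim z)
      thus ?case using \<open>m \<noteq> 0\<close> by (auto simp: indicator_def split: if_splits)
    qed
    hence "emeasure circle_measure E = 0" using E(1) by (subst (asm) AE_iff_measurable[of E]) auto
    with E(2) show False by simp
  qed
  hence "AE z in circle_measure. u z = 0" using const by (auto elim: eventually_mono)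
  hence "g = abs_L2 (\<lambda>_. 0)" unfolding u(2) by (intro abs_L2_cong u sq_int_0)
  hence "fourier_coeff g 0 = 0" using fourier_coeff_0 by (simp add: zero_L2_def)
  thus False using g(1) by (simp add: K_def)
qed

text \<open>A vector \<open>g\<close> that is orthogonal to the range of \<open>1 - V\<close>, for a contraction \<open>V\<close>, satisfies \<open>V g = g\<close>.
For \<open>V = T\<^sub>G\<close> this forces equality in \<open>norm (P\<^sub>+ (G g)) \<le> norm (G g) \<le> norm g\<close>, hence \<open>G g = g\<close>, and \<open>g\<close>
vanishes where \<open>G\<close> differs from \<open>1\<close>. Orthogonality for the real inner product is enough for this
computation.\<close>

lemma dense_range_one_minus_toeplitz:
  assumes G: "G \<in> borel_measurable borel" "\<And>z. cmod (G z) \<le> 1" and E: "emeasure circle_measure {z. G z \<noteq> 1} > 0"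
  shows "closure (range (cop_apply (1 - toeplitz_cop G))) = UNIV"
proof (rule ccontr)
  let ?V = "toeplitz_cop G"
  let ?R = "closure (range (cop_apply (1 - ?V)))"
  note [measurable] = G(1)
  have bm: "bounded_measurable G" by (rule bounded_measurableI[OF G])
  assume "?R \<noteq> UNIV"
  then obtain x where x: "x \<notin> ?R" by blast
  have lin: "linear (cop_apply (1 - ?V))"
    using bounded_clinear_cop_apply[of "1 - ?V"] by (auto simp: bounded_clinear_def bounded_linear.linear)
  have sub: "subspace (range (cop_apply (1 - ?V)))" by (intro linear_subspace_image[OF lin] subspace_UNIV)
  define B where "B = (\<lambda>r. x - r) ` range (cop_apply (1 - ?V))"
  have "convex (closure B)"
  proof -
    have "B = (\<lambda>y. x + y) ` uminus ` range (cop_apply (1 - ?V))" by (simp add: B_def image_image)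
    thus ?thesis
      using convex_closure[OF convex_translation[OF convex_negations[OF subspace_imp_convex[OF sub]]]] by simp
  qed
  moreover have "closure B \<noteq> {}" unfolding B_def by simp
  ultimately obtain g where g: "g \<in> closure B" "\<And>h. h \<in> closure B \<Longrightarrow> norm g \<le> norm h"
    using minimal_norm_element[of "closure B"] by auto
  have "g \<noteq> 0"
  proof
    assume "g = 0"
    have "x \<in> ?R" unfolding closure_approachable
    proof (intro allI impI)
      fix e :: real assume "e > 0"
      then obtain b where "b \<in> B" "dist b 0 < e" using g(1) \<open>g = 0\<close> unfolding closure_approachable by blast
      then obtain r where "r \<in> range (cop_apply (1 - ?V))" "dist (x - r) 0 < e" unfolding B_def by blast
      thus "\<exists>y\<in>range (cop_apply (1 - ?V)). dist y x < e"
        by (intro bexI[of _ r]) (simp_all add: dist_norm norm_minus_commute)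
    qed
    with x show False by simp
  qed
  have orth: "inner g (cop_apply (1 - ?V) h) = 0" for h
  proof (rule inner_eq_0_of_minimal, rule g(2))
    fix t
    define w where "w = t *\<^sub>R cop_apply (1 - ?V) h"
    have w: "w \<in> range (cop_apply (1 - ?V))" unfolding w_def by (intro subspace_scale[OF sub]) simp
    have "(\<lambda>y. w + y) ` B \<subseteq> B"
    proof safe
      fix b assume "b \<in> B"
      then obtain r where r: "r \<in> range (cop_apply (1 - ?V))" "b = x - r" unfolding B_def by blast
      have "w + b = x - (r - w)" by (simp add: r(2))
      thus "w + b \<in> B" unfolding B_def using subspace_diff[OF sub r(1) w] by blast
    qed
    hence "(\<lambda>y. w + y) ` closure B \<subseteq> closure B" using closure_mono closure_translation[of w B] by metis
    thus "g + t *\<^sub>R cop_apply (1 - ?V) h \<in> closure B" using g(1) by (auto simp: w_def add.commute image_subset_iff)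
  qed
  have fix_eq: "cop_apply ?V g = g"
  proof -
    have "norm (cop_apply ?V g) \<le> norm g"
      using norm_cop_apply[of ?V g] mult_right_mono[OF norm_toeplitz_cop_le[OF G], of "norm g"] by simp
    hence "(norm (cop_apply ?V g))\<^sup>2 \<le> (norm g)\<^sup>2" by (intro power_mono) auto
    moreover have "inner g (cop_apply ?V g) = inner g g"
      using orth[of g] by (simp add: cop_apply_diff inner_diff_right)
    ultimately have "(norm (cop_apply ?V g - g))\<^sup>2 \<le> 0"
      by (simp add: power2_norm_eq_inner inner_diff inner_commute)
    thus ?thesis by simp
  qed
  hence P: "riesz_proj (mult_op G (of_H2 g)) = of_H2 g" by (metis of_H2_toeplitz_cop[OF bm])
  have "norm (mult_op G (of_H2 g)) \<le> norm (of_H2 g)" using norm_mult_op_le[OF G, of "of_H2 g"] by simp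
  hence "(norm (mult_op G (of_H2 g)))\<^sup>2 \<le> (norm (of_H2 g))\<^sup>2" by (intro power_mono) auto
  hence "mult_op G (of_H2 g) = of_H2 g"
    using riesz_proj_pythagoras[of "mult_op G (of_H2 g)"] by (simp add: P)
  moreover obtain u where u: "sq_int u" "of_H2 g = abs_L2 u" by (rule L2_cases)
  ultimately have "AE z in circle_measure. G z * u z = u z"
    by (simp add: mult_op_abs_L2 bm abs_L2_eq_iff sq_int_bm_mult)
  hence "AE z in circle_measure. z \<in> {z. G z \<noteq> 1} \<longrightarrow> u z = 0" by (rule AE_mp) auto
  hence "abs_L2 u = 0"
    using of_H2_coeff[of _ g] by (intro hardy_uniqueness[OF u(1) _ _ E]) (auto simp: u(2))
  hence "g = 0" using u(2) by (intro H2_eqI) (simp add: zero_H2.rep_eq)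
  with \<open>g \<noteq> 0\<close> show False by simp
qed

lemma trig_poly_coeff_bound: "p \<in> trig_poly \<Longrightarrow> \<exists>m. \<forall>n<m. fourier_coeff (abs_L2 p) n = 0"
proof (induction rule: trig_poly.induct)
  case (powi k)
  have "\<forall>n<k. fourier_coeff (abs_L2 (\<lambda>z. of_circle z powi k)) n = 0"
    unfolding char_L2_def[symmetric] by (simp add: fourier_coeff_char)
  thus ?case by blast
next
  case (add f g)
  then obtain m m' where m: "\<forall>n<m. fourier_coeff (abs_L2 f) n = 0" "\<forall>n<m'. fourier_coeff (abs_L2 g) n = 0" by blast
  have sq: "sq_int f" "sq_int g" using add by (auto intro!: bounded_measurable_sq_int bounded_measurable_continuous trig_poly_continuous)
  show ?case
    by (rule exI[of _ "min m m'"]) (use m in \<open>auto simp: fourier_coeff_add simp flip: abs_L2_add[OF sq]\<close>)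
next
  case (scale f c)
  have "sq_int f" using scale by (auto intro!: bounded_measurable_sq_int bounded_measurable_continuous trig_poly_continuous)
  thus ?case using scale by (auto simp: fourier_coeff_scaleC simp flip: abs_L2_scaleC)
qed

text \<open>Multiplication by a power of \<open>z\<close> is isometric and moves the trigonometric polynomial into $H^2$,
where the resolvent bounds it from above by the Toeplitz operator, and hence by multiplication with
\<open>F - l\<close>.\<close>

lemma resolvent_lower_bound_trig_poly:
  assumes F: "bounded_measurable F" and R: "R * (toeplitz_cop F - scalar_cop l) = 1" and p: "p \<in> trig_poly"
  shows "norm (abs_L2 p) \<le> norm R * norm (abs_L2 (\<lambda>z. (F z - l) * p z))"
proof -
  obtain m where m: "\<And>n. n < m \<Longrightarrow> fourier_coeff (abs_L2 p) n = 0" using trig_poly_coeff_bound[OF p] by blast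
  have sq: "sq_int p" using p by (auto intro!: bounded_measurable_sq_int bounded_measurable_continuous trig_poly_continuous)
  have Fl: "bounded_measurable (\<lambda>z. F z - l)" by (intro bounded_measurable_diff F bounded_measurable_const)
  let ?s = "\<lambda>m z. of_circle z powi m"
  define q where "q = mult_op (?s (- m)) (abs_L2 p)"
  have "of_H2 (Abs_H2 q) = q"
    by (rule Abs_H2_inverse) (simp add: q_def fourier_coeff_mult_powi m)
  define h where "h = Abs_H2 q"
  have h: "of_H2 h = q" by (simp add: h_def \<open>of_H2 (Abs_H2 q) = q\<close>)
  have shift: "norm (mult_op (?s k) f) \<le> norm f" for k f
    using norm_mult_op_le[of "?s k" 1 f] by (simp add: norm_power_int)
  have "abs_L2 p = mult_op (?s m) q"
  proof -
    have "(\<lambda>z. of_circle z powi m * of_circle z powi (- m)) = (\<lambda>_. 1)"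
      by (simp add: fun_eq_iff power_int_minus)
    thus ?thesis unfolding q_def mult_op_mult[OF bounded_measurable_powi bounded_measurable_powi] by (simp add: mult_op_const)
  qed
  hence "norm (abs_L2 p) \<le> norm q" using shift[of m q] by simp
  also have "\<dots> = norm (cop_apply (R * (toeplitz_cop F - scalar_cop l)) h)" by (simp only: R cop_apply_one h[symmetric] norm_of_H2)
  also have "\<dots> \<le> norm R * norm (cop_apply (toeplitz_cop F - scalar_cop l) h)" by (simp only: cop_apply_mult norm_cop_apply)
  also have "cop_apply (toeplitz_cop F - scalar_cop l) h = cop_apply (toeplitz_cop (\<lambda>z. F z - l)) h"
  proof -
    have "toeplitz_cop (\<lambda>z. F z + (- l)) = toeplitz_cop F + toeplitz_cop (\<lambda>_. - l)"
      by (intro toeplitz_cop_add F bounded_measurable_const)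
    thus ?thesis by (simp add: toeplitz_cop_const scalar_cop_minus)
  qed
  also have "norm \<dots> = norm (riesz_proj (mult_op (\<lambda>z. F z - l) q))"
    using of_H2_toeplitz_cop[OF Fl, of h] norm_of_H2 by (metis h)
  also have "\<dots> \<le> norm (mult_op (\<lambda>z. F z - l) q)" by (rule norm_riesz_proj_le)
  also have "mult_op (\<lambda>z. F z - l) q = mult_op (?s (- m)) (mult_op (\<lambda>z. F z - l) (abs_L2 p))"
    unfolding q_def mult_op_mult[OF Fl bounded_measurable_powi] mult_op_mult[OF bounded_measurable_powi Fl]
    by (simp only: mult.commute)
  also have "norm \<dots> \<le> norm (mult_op (\<lambda>z. F z - l) (abs_L2 p))" by (rule shift)
  finally show ?thesis by (simp add: mult_op_abs_L2[OF Fl sq] mult_left_mono)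
qed

text \<open>If \<open>F \<zeta>\<close> were in the resolvent set, the bound above would extend from trigonometric polynomials to
all continuous functions by uniform approximation. It fails for a bump function concentrated
where \<open>F\<close> is close to \<open>F \<zeta>\<close>.\<close>

theorem symbol_value_in_spectrum:
  assumes F: "continuous_on UNIV F" shows "F \<zeta> \<in> op_spectrum (toeplitz F)"
proof (rule ccontr)
  assume notin: "F \<zeta> \<notin> op_spectrum (toeplitz F)"
  define l where "l = F \<zeta>"
  have bm: "bounded_measurable F" by (rule bounded_measurable_continuous[OF F])
  from notin obtain R where R: "R * (toeplitz_cop F - scalar_cop l) = 1"
    unfolding cop_apply_toeplitz[OF bm, symmetric] notin_op_spectrum_iff l_def by blast
  have Fl: "bounded_measurable (\<lambda>z. F z - l)" by (intro bounded_measurable_diff bm bounded_measurable_const)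
  obtain C where C: "C \<ge> 0" "\<And>z. cmod (F z - l) \<le> C" using bounded_measurableE[OF Fl] by blast
  define d where "d = 1 / (2 * (norm R + 1))"
  have d: "d > 0" unfolding d_def by (simp add: add_nonneg_pos)
  have "isCont F \<zeta>" using F by (simp add: continuous_on_eq_continuous_at)
  then obtain e where e: "e > 0" "\<And>z. dist z \<zeta> < e \<Longrightarrow> dist (F z) (F \<zeta>) < d"
    using d unfolding continuous_at_eps_delta by blast
  define h where "h z = max 0 (e - dist z \<zeta>)" for z
  have hc: "continuous_on UNIV h" unfolding h_def by (intro continuous_intros)
  hence hb: "bounded_measurable (\<lambda>z. complex_of_real (h z))"
    by (intro bounded_measurable_continuous continuous_on_of_real)
  note hs = bounded_measurable_sq_int[OF hb]
  have sql: "sq_int (\<lambda>z. (F z - l) * complex_of_real (h z))" by (rule sq_int_bm_mult[OF Fl hs])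
  let ?h = "abs_L2 (\<lambda>z. complex_of_real (h z))"
  have sup1: "norm (abs_L2 f) \<le> a" if "sq_int f" "a \<ge> 0" "\<And>z. cmod (f z) \<le> a" for f a
  proof -
    have "norm (abs_L2 (\<lambda>_. 1)) = 1"
    proof (rule power2_eq_imp_eq)
      show "(norm (abs_L2 (\<lambda>_. 1)))\<^sup>2 = 1\<^sup>2"
        using norm_abs_L2[OF bounded_measurable_sq_int[OF bounded_measurable_const[of 1]]] circle_measure.prob_space by simp
    qed auto
    thus ?thesis
      using norm_abs_L2_le[OF that(1) bounded_measurable_sq_int[OF bounded_measurable_const[of 1]] that(2)] that(3) by simp
  qed
  have "norm ?h \<le> norm R * norm (abs_L2 (\<lambda>z. (F z - l) * complex_of_real (h z))) + \<epsilon>" if "\<epsilon> > 0" for \<epsilon>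
  proof -
    define \<delta> where "\<delta> = \<epsilon> / (1 + norm R * C)"
    have den: "1 + norm R * C > 0" using C(1) by (simp add: add_pos_nonneg)
    have \<delta>: "\<delta> > 0" using that den by (simp add: \<delta>_def)
    obtain p where p: "p \<in> trig_poly" "\<And>z. cmod (complex_of_real (h z) - p z) < \<delta>"
      using trig_poly_approx_real[OF hc \<delta>] by blast
    have pb: "bounded_measurable p" using p(1) by (intro bounded_measurable_continuous trig_poly_continuous)
    note ps = bounded_measurable_sq_int[OF pb]
    have "norm (?h - abs_L2 p) \<le> \<delta>"
      unfolding abs_L2_minus[OF hs ps] using \<delta> less_imp_le[OF p(2)] by (intro sup1 sq_int_diff hs ps) auto
    hence 1: "norm ?h \<le> norm (abs_L2 p) + \<delta>" using norm_triangle_sub[of ?h "abs_L2 p"] by linarith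
    have sqp: "sq_int (\<lambda>z. (F z - l) * p z)" by (rule sq_int_bm_mult[OF Fl ps])
    have "norm (abs_L2 (\<lambda>z. (F z - l) * p z) - abs_L2 (\<lambda>z. (F z - l) * complex_of_real (h z))) \<le> C * \<delta>"
      unfolding abs_L2_minus[OF sqp sql]
    proof (intro sup1 sq_int_diff sqp sql)
      fix z
      have "cmod ((F z - l) * p z - (F z - l) * complex_of_real (h z)) = cmod (F z - l) * cmod (complex_of_real (h z) - p z)"
        by (simp add: norm_mult norm_minus_commute flip: right_diff_distrib)
      also have "\<dots> \<le> C * \<delta>" using less_imp_le[OF p(2)] C by (intro mult_mono) auto
      finally show "cmod ((F z - l) * p z - (F z - l) * complex_of_real (h z)) \<le> C * \<delta>" .
    qed (use C \<delta> in simp)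
    hence 2: "norm (abs_L2 (\<lambda>z. (F z - l) * p z)) \<le> norm (abs_L2 (\<lambda>z. (F z - l) * complex_of_real (h z))) + C * \<delta>"
      using norm_triangle_sub[of "abs_L2 (\<lambda>z. (F z - l) * p z)" "abs_L2 (\<lambda>z. (F z - l) * complex_of_real (h z))"] by linarith
    have "norm ?h \<le> norm R * norm (abs_L2 (\<lambda>z. (F z - l) * p z)) + \<delta>"
      using 1 resolvent_lower_bound_trig_poly[OF bm R p(1)] by linarith
    also have "\<dots> \<le> norm R * (norm (abs_L2 (\<lambda>z. (F z - l) * complex_of_real (h z))) + C * \<delta>) + \<delta>"
      using 2 by (intro add_right_mono mult_left_mono) auto
    also have "\<dots> = norm R * norm (abs_L2 (\<lambda>z. (F z - l) * complex_of_real (h z))) + \<delta> * (1 + norm R * C)"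
      by (simp add: algebra_simps)
    also have "\<delta> * (1 + norm R * C) = \<epsilon>" using den by (simp add: \<delta>_def)
    finally show ?thesis .
  qed
  hence "norm ?h \<le> norm R * norm (abs_L2 (\<lambda>z. (F z - l) * complex_of_real (h z)))" by (rule field_le_epsilon)
  also have "\<dots> \<le> norm R * (d * norm ?h)"
  proof (intro mult_left_mono norm_abs_L2_le sql hs)
    fix z
    show "cmod ((F z - l) * complex_of_real (h z)) \<le> d * cmod (complex_of_real (h z))"
    proof (cases "dist z \<zeta> < e")
      case True
      hence "cmod (F z - l) \<le> d" using e(2)[of z] by (simp add: dist_norm l_def)
      thus ?thesis by (simp add: norm_mult mult_right_mono)
    next
      case False thus ?thesis by (simp add: h_def)
    qed
  qed (use d in auto)
  also have "\<dots> = (norm R * d) * norm ?h" by simp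
  also have "\<dots> \<le> (1 / 2) * norm ?h"
  proof (rule mult_right_mono)
    have "norm R + 1 > 0" by (simp add: add_nonneg_pos)
    thus "norm R * d \<le> 1 / 2" unfolding d_def by (simp add: field_simps)
  qed simp
  finally have "?h = abs_L2 (\<lambda>_. 0)" by (simp add: zero_L2_def[symmetric])
  hence ae: "AE z in circle_measure. complex_of_real (h z) = 0"
    by (subst (asm) abs_L2_eq_iff) (auto intro: hs sq_int_0)
  have "emeasure circle_measure (ball \<zeta> e) > 0" using e(1) by (intro emeasure_circle_open_pos[of _ \<zeta>]) auto
  moreover have "AE z in circle_measure. z \<notin> ball \<zeta> e"
    by (rule AE_mp[OF ae]) (auto simp: h_def dist_commute)
  hence "emeasure circle_measure (ball \<zeta> e) = 0" by (subst (asm) AE_iff_measurable[of "ball \<zeta> e"]) auto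
  ultimately show False by simp
qed

section \<open>A nilpotent semigroup on $H^2$\<close>

abbreviation circle_arg :: "circle \<Rightarrow> real" where "circle_arg z \<equiv> Arg2pi (of_circle z)"

definition rotate_circle :: "real \<Rightarrow> circle \<Rightarrow> circle" where
  "rotate_circle t z = Abs_circle (of_circle z * cis t)"

lemma of_circle_rotate [simp]: "of_circle (rotate_circle t z) = of_circle z * cis t"
  unfolding rotate_circle_def by (rule Abs_circle_inverse) (simp add: norm_mult)

lemma continuous_rotate: "continuous_on UNIV (rotate_circle t)"
  unfolding continuous_on_iff
proof (intro ballI allI impI)
  fix x :: circle and e :: real assume "e > 0"
  have "dist (rotate_circle t x') (rotate_circle t x) = dist x' x" for x'
    by (simp add: dist_circle_def dist_norm norm_mult flip: left_diff_distrib)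
  thus "\<exists>d>0. \<forall>x'\<in>UNIV. dist x' x < d \<longrightarrow> dist (rotate_circle t x') (rotate_circle t x) < e"
    using \<open>e > 0\<close> by auto
qed

lemma measurable_rotate [measurable]: "rotate_circle t \<in> borel_measurable borel"
  by (intro borel_measurable_continuous_onI continuous_rotate)

lemma measurable_circle_arg [measurable]: "Measurable.pred borel (\<lambda>z. t < circle_arg z)"
proof -
  have "open (of_circle -` {z. t < Arg2pi z})"
    by (rule open_vimage[OF open_Arg2pi2pi_gt continuous_of_circle])
  hence "{z. t < circle_arg z} \<in> sets borel" by (simp add: vimage_def)
  thus ?thesis by (simp add: pred_def)
qed

lemma circle_arg_Abs_cis: "0 \<le> t \<Longrightarrow> t < 2 * pi \<Longrightarrow> circle_arg (Abs_circle (cis t)) = t"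
  unfolding of_circle_Abs_cis by (rule Arg2pi_unique[of 1]) (simp_all add: cis_conv_exp)

lemma circle_arg_rotate:
  assumes "0 \<le> t" "t < circle_arg z" shows "circle_arg (rotate_circle (- t) z) = circle_arg z - t"
proof (rule Arg2pi_unique[of 1])
  have "of_circle z = cis (circle_arg z)"
    using complex_norm_eq_1_exp[of "of_circle z"] by (simp add: cis_conv_exp)
  thus "of_real 1 * exp (\<i> * of_real (circle_arg z - t)) = of_circle (rotate_circle (- t) z)"
    by (metis cis_conv_exp cis_mult diff_conv_add_uminus mult_1 of_circle_rotate of_real_1)
qed (use assms Arg2pi[of "of_circle z"] in auto)

text \<open>In the coordinate \<open>circle_arg z\<close>, which runs through the interval from \<open>0\<close> to \<open>2 * pi\<close>, this is
translation to the right by \<open>t\<close>; what leaves the interval is lost. Hence it is zero from time \<open>2 * pi\<close>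
on.\<close>

definition cut_shift :: "real \<Rightarrow> (circle \<Rightarrow> 'a::zero) \<Rightarrow> circle \<Rightarrow> 'a" where
  "cut_shift t f z = (if t < circle_arg z then f (rotate_circle (- t) z) else 0)"

lemma cut_shift_add:
  assumes "s \<ge> 0" "t \<ge> 0" shows "cut_shift t (cut_shift s f) = cut_shift (t + s) f"
proof
  fix z
  have "rotate_circle (- s) (rotate_circle (- t) z) = rotate_circle (- (t + s)) z"
    by (simp add: of_circle_inject[symmetric] cis_mult mult.assoc add.commute)
  thus "cut_shift t (cut_shift s f) z = cut_shift (t + s) f z"
    using assms circle_arg_rotate[of t z] by (auto simp: cut_shift_def)
qed

lemma cut_shift_2pi: "t \<ge> 2 * pi \<Longrightarrow> cut_shift t f = (\<lambda>_. 0)"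
proof
  fix z assume "t \<ge> 2 * pi"
  thus "cut_shift t f z = 0" using Arg2pi[of "of_circle z"] by (simp add: cut_shift_def)
qed

lemma measurable_cut_shift:
  fixes f :: "circle \<Rightarrow> complex"
  assumes [measurable]: "f \<in> borel_measurable borel"
  shows "cut_shift t f \<in> borel_measurable borel"
  unfolding cut_shift_def[abs_def] by measurable

lemma nn_integral_circle:
  assumes [measurable]: "h \<in> borel_measurable borel"
  shows "(\<integral>\<^sup>+z. h z \<partial>circle_measure) =
    (\<integral>\<^sup>+t. h (Abs_circle (cis t)) * indicator {0..2 * pi} t \<partial>lborel) / emeasure lborel {0..2 * pi}"
proof -
  have "(\<integral>\<^sup>+z. h z \<partial>circle_measure) = (\<integral>\<^sup>+t. h (Abs_circle (cis t)) \<partial>uniform_measure lborel {0..2 * pi})"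
    unfolding circle_measure_def by (rule nn_integral_distr) measurable
  also have "\<dots> = (\<integral>\<^sup>+t. h (Abs_circle (cis t)) * indicator {0..2 * pi} t \<partial>lborel) / emeasure lborel {0..2 * pi}"
    by (rule nn_integral_uniform_measure) measurable
  finally show ?thesis .
qed

text \<open>In the coordinate on the interval, the left-hand side is the integral of a translate, restricted to a
subset.\<close>

lemma nn_integral_cut_shift_le:
  fixes h :: "circle \<Rightarrow> ennreal"
  assumes [measurable]: "h \<in> borel_measurable borel" and t: "t \<ge> 0"
  shows "(\<integral>\<^sup>+z. cut_shift t h z \<partial>circle_measure) \<le> (\<integral>\<^sup>+z. h z \<partial>circle_measure)"
proof -
  let ?k = "\<lambda>s. h (Abs_circle (cis s)) * indicator {0..2 * pi} s"
  have [measurable]: "cut_shift t h \<in> borel_measurable borel" unfolding cut_shift_def[abs_def] by measurable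
  have "cut_shift t h (Abs_circle (cis s)) * indicator {0..2 * pi} s \<le> ?k (- t + 1 * s)" for s
  proof (cases "s \<in> {0..2 * pi} \<and> t < circle_arg (Abs_circle (cis s))")
    case True
    \<comment> \<open>The right end point of the interval is the point of argument \<open>0\<close>.\<close>
    have "s \<noteq> 2 * pi"
    proof
      assume "s = 2 * pi"
      hence "circle_arg (Abs_circle (cis s)) = Arg2pi 1"
        unfolding of_circle_Abs_cis by (simp add: cis_2pi)
      hence "circle_arg (Abs_circle (cis s)) = 0" using Arg2pi_of_real[of 1] by simp
      thus False using True t by simp
    qed
    hence s: "0 \<le> s" "s < 2 * pi" using True by auto
    hence "t < s" using True circle_arg_Abs_cis[OF s] by simp
    moreover have "rotate_circle (- t) (Abs_circle (cis s)) = Abs_circle (cis (- t + s))"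
      by (simp add: rotate_circle_def cis_mult add.commute)
    ultimately show ?thesis using True s t by (simp add: cut_shift_def)
  next
    case False
    thus ?thesis by (auto simp: cut_shift_def indicator_def)
  qed
  hence "(\<integral>\<^sup>+s. cut_shift t h (Abs_circle (cis s)) * indicator {0..2 * pi} s \<partial>lborel) \<le> (\<integral>\<^sup>+s. ?k (- t + 1 * s) \<partial>lborel)"
    by (intro nn_integral_mono) auto
  also have "\<dots> = (\<integral>\<^sup>+s. ?k s \<partial>lborel)"
    using nn_integral_real_affine[of ?k 1 "- t"] by simp
  finally show ?thesis
    unfolding nn_integral_circle[OF assms(1)] nn_integral_circle[OF \<open>cut_shift t h \<in> borel_measurable borel\<close>]
    by (rule divide_right_mono_ennreal)
qed

lemma sq_int_cut_shift:
  assumes u: "sq_int u" and t: "t \<ge> 0"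
  shows "sq_int (cut_shift t u)" "norm (abs_L2 (cut_shift t u)) \<le> norm (abs_L2 u)"
proof -
  have [measurable]: "u \<in> borel_measurable borel" using u by (simp add: sq_int_def)
  have [measurable]: "cut_shift t u \<in> borel_measurable borel" by (rule measurable_cut_shift) fact
  have eq: "ennreal ((cmod (cut_shift t u z))\<^sup>2) = cut_shift t (\<lambda>z. ennreal ((cmod (u z))\<^sup>2)) z" for z
    by (simp add: cut_shift_def)
  have "(\<integral>\<^sup>+z. ennreal ((cmod (cut_shift t u z))\<^sup>2) \<partial>circle_measure) \<le> (\<integral>\<^sup>+z. ennreal ((cmod (u z))\<^sup>2) \<partial>circle_measure)"
    unfolding eq by (intro nn_integral_cut_shift_le t) measurable
  also have "\<dots> = ennreal ((norm (abs_L2 u))\<^sup>2)" by (rule nn_integral_sq[OF u])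
  finally have le: "(\<integral>\<^sup>+z. ennreal ((cmod (cut_shift t u z))\<^sup>2) \<partial>circle_measure) \<le> ennreal ((norm (abs_L2 u))\<^sup>2)" .
  have "integrable circle_measure (\<lambda>z. (cmod (cut_shift t u z))\<^sup>2)"
    by (rule integrableI_bounded) (use le in \<open>auto simp: measurable_circle_eq intro: le_less_trans\<close>)
  thus sq: "sq_int (cut_shift t u)" by (simp add: sq_int_def)
  have "(norm (abs_L2 (cut_shift t u)))\<^sup>2 \<le> (norm (abs_L2 u))\<^sup>2"
    using le unfolding nn_integral_sq[OF sq] by (subst (asm) ennreal_le_iff) auto
  thus "norm (abs_L2 (cut_shift t u)) \<le> norm (abs_L2 u)" by (rule power2_le_imp_le) simp
qed

definition shift_L2 :: "real \<Rightarrow> L2 \<Rightarrow> L2" where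
  "shift_L2 t f = abs_L2 (cut_shift t (rep_L2 f))"

lemma cut_shift_diff: "cut_shift t (\<lambda>z. u z - v z) = (\<lambda>z. cut_shift t u z - cut_shift t v z)"
  for u :: "circle \<Rightarrow> complex"
  by (auto simp: cut_shift_def fun_eq_iff)

lemma shift_L2_abs:
  assumes u: "sq_int u" and t: "t \<ge> 0" shows "shift_L2 t (abs_L2 u) = abs_L2 (cut_shift t u)"
proof -
  let ?v = "rep_L2 (abs_L2 u)"
  have v: "sq_int ?v" "abs_L2 ?v = abs_L2 u" by (simp_all add: sq_int_rep_L2 abs_rep_L2)
  have "shift_L2 t (abs_L2 u) - abs_L2 (cut_shift t u) = abs_L2 (cut_shift t (\<lambda>z. ?v z - u z))"
    unfolding shift_L2_def cut_shift_diff by (intro abs_L2_minus sq_int_cut_shift u v t)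
  moreover have "norm (abs_L2 (cut_shift t (\<lambda>z. ?v z - u z))) \<le> norm (abs_L2 (\<lambda>z. ?v z - u z))"
    by (intro sq_int_cut_shift sq_int_diff v u t)
  moreover have "abs_L2 (\<lambda>z. ?v z - u z) = 0" using abs_L2_minus[OF v(1) u] v(2) by simp
  ultimately show ?thesis by simp
qed

lemma shift_L2_add_right: "t \<ge> 0 \<Longrightarrow> shift_L2 t (f + g) = shift_L2 t f + shift_L2 t g"
proof (rule L2_cases[of f], rule L2_cases[of g])
  fix u v assume t: "t \<ge> 0" and uv: "sq_int u" "f = abs_L2 u" "sq_int v" "g = abs_L2 v"
  have "cut_shift t (\<lambda>z. u z + v z) = (\<lambda>z. cut_shift t u z + cut_shift t v z)"
    by (auto simp: cut_shift_def fun_eq_iff)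
  thus ?thesis using uv t by (simp add: abs_L2_add shift_L2_abs sq_int_add sq_int_cut_shift)
qed

lemma shift_L2_scaleC: "t \<ge> 0 \<Longrightarrow> shift_L2 t (c *\<^sub>C f) = c *\<^sub>C shift_L2 t f"
proof (rule L2_cases[of f])
  fix u assume t: "t \<ge> 0" and u: "sq_int u" "f = abs_L2 u"
  have "cut_shift t (\<lambda>z. c * u z) = (\<lambda>z. c * cut_shift t u z)"
    by (auto simp: cut_shift_def fun_eq_iff)
  thus ?thesis using u t by (simp add: abs_L2_scaleC shift_L2_abs sq_int_cmult sq_int_cut_shift)
qed

lemma norm_shift_L2_le: "t \<ge> 0 \<Longrightarrow> norm (shift_L2 t f) \<le> norm f"
  by (rule L2_cases[of f]) (simp add: shift_L2_abs sq_int_cut_shift)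

lemma bounded_linear_shift_L2: "t \<ge> 0 \<Longrightarrow> bounded_linear (shift_L2 t)"
  by (rule bounded_linear_intro[of _ 1])
     (simp_all add: shift_L2_add_right shift_L2_scaleC norm_shift_L2_le scaleC_of_real[symmetric])

lemma shift_L2_add: "s \<ge> 0 \<Longrightarrow> t \<ge> 0 \<Longrightarrow> shift_L2 t (shift_L2 s f) = shift_L2 (t + s) f"
  by (rule L2_cases[of f]) (simp add: shift_L2_abs sq_int_cut_shift cut_shift_add)

lemma shift_L2_2pi: "t \<ge> 2 * pi \<Longrightarrow> shift_L2 t f = 0"
  by (simp add: shift_L2_def cut_shift_2pi zero_L2_def)

lemma norm_indicator_arg_le:
  assumes t: "0 < t" "t < 2 * pi"
  shows "norm (abs_L2 (\<lambda>z. if t < circle_arg z then 0 else 1)) \<le> sqrt (t / (2 * pi))"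
proof -
  let ?f = "\<lambda>z. if t < circle_arg z then 0 else 1 :: complex"
  have bm: "bounded_measurable ?f" by (rule bounded_measurableI[of _ 1]) auto
  have [measurable]: "?f \<in> borel_measurable borel" using bm by (simp add: bounded_measurable_def)
  have "ennreal ((norm (abs_L2 ?f))\<^sup>2) = (\<integral>\<^sup>+z. ennreal ((cmod (?f z))\<^sup>2) \<partial>circle_measure)"
    by (rule nn_integral_sq[symmetric, OF bounded_measurable_sq_int[OF bm]])
  also have "\<dots> = (\<integral>\<^sup>+s. ennreal ((cmod (?f (Abs_circle (cis s))))\<^sup>2) * indicator {0..2 * pi} s \<partial>lborel) / emeasure lborel {0..2 * pi}"
    by (rule nn_integral_circle) measurable
  also have "\<dots> \<le> (\<integral>\<^sup>+s. indicator ({0..t} \<union> {2 * pi}) s \<partial>lborel) / emeasure lborel {0..2 * pi}"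
  proof (intro divide_right_mono_ennreal nn_integral_mono)
    fix s :: real
    show "ennreal ((cmod (?f (Abs_circle (cis s))))\<^sup>2) * indicator {0..2 * pi} s \<le> indicator ({0..t} \<union> {2 * pi}) s"
      using circle_arg_Abs_cis[of s] by (cases "0 \<le> s \<and> s < 2 * pi") (auto simp: indicator_def)
  qed
  also have "(\<integral>\<^sup>+s. indicator ({0..t} \<union> {2 * pi}) s \<partial>lborel) = emeasure lborel ({0..t} \<union> {2 * pi})"
    by (rule nn_integral_indicator) auto
  also have "\<dots> \<le> emeasure lborel {0..t} + emeasure lborel {2 * pi}"
    by (rule emeasure_subadditive) auto
  also have "\<dots> = ennreal t" using t by simp
  also have "ennreal t / emeasure lborel {0..2 * pi} = ennreal (t / (2 * pi))"
    using t by (simp add: divide_ennreal)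
  finally have "ennreal ((norm (abs_L2 ?f))\<^sup>2) \<le> ennreal (t / (2 * pi))" by (simp add: divide_right_mono_ennreal)
  hence "(norm (abs_L2 ?f))\<^sup>2 \<le> t / (2 * pi)" using t by (subst (asm) ennreal_le_iff) auto
  thus ?thesis by (rule real_le_rsqrt)
qed

lemma shift_L2_char_tendsto: "((\<lambda>t. shift_L2 t (char_L2 n)) \<longlongrightarrow> char_L2 n) (at_right 0)"
proof (rule LIM_zero_cancel, rule Lim_null_comparison)
  have "((\<lambda>t. cmod (cis (- (real_of_int n * t)) - 1) + sqrt (t / (2 * pi))) \<longlongrightarrow>
      cmod (cis (- (real_of_int n * 0)) - 1) + sqrt (0 / (2 * pi))) (at_right 0)"
    by (intro tendsto_intros) auto
  thus "((\<lambda>t. cmod (cis (- (real_of_int n * t)) - 1) + sqrt (t / (2 * pi))) \<longlongrightarrow> 0) (at_right 0)" by simp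
  have "0 < 2 * pi" by simp
  from eventually_at_right_real[OF this]
  show "\<forall>\<^sub>F t in at_right 0. norm (shift_L2 t (char_L2 n) - char_L2 n) \<le>
      cmod (cis (- (real_of_int n * t)) - 1) + sqrt (t / (2 * pi))"
  proof eventually_elim
    case (elim t)
    let ?\<chi> = "\<lambda>z. of_circle z powi n"
    let ?c = "cis (- (real_of_int n * t)) - 1"
    let ?f = "\<lambda>z. if t < circle_arg z then 0 else 1 :: complex"
    let ?g = "\<lambda>z. ?c * ((1 - ?f z) * ?\<chi> z)"
    let ?h = "\<lambda>z. ?f z * ?\<chi> z"
    have fb: "bounded_measurable ?f" by (rule bounded_measurableI[of _ 1]) auto
    have hb: "bounded_measurable ?h" by (intro bounded_measurable_mult fb bounded_measurable_powi)
    have gb: "bounded_measurable ?g"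
      by (intro bounded_measurable_mult bounded_measurable_diff fb bounded_measurable_powi bounded_measurable_const)
    have "cut_shift t ?\<chi> z - ?\<chi> z = ?g z - ?h z" for z
      by (simp add: cut_shift_def power_int_mult_distrib cis_power_int algebra_simps)
    hence eq: "shift_L2 t (char_L2 n) - char_L2 n = abs_L2 ?g - abs_L2 ?h"
      using elim unfolding char_L2_def
      by (simp add: shift_L2_abs sq_int_powi abs_L2_minus sq_int_cut_shift bounded_measurable_sq_int[OF gb] bounded_measurable_sq_int[OF hb])
    have 1: "norm (abs_L2 ?g - abs_L2 ?h) \<le> norm (abs_L2 ?g) + norm (abs_L2 ?h)" by (rule norm_triangle_ineq4)
    have 2: "norm (abs_L2 ?g) \<le> cmod ?c * norm (char_L2 0)"
      unfolding char_L2_def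
    proof (rule norm_abs_L2_le[OF bounded_measurable_sq_int[OF gb] sq_int_powi norm_ge_zero])
      fix z
      have "cmod (?g z) = cmod ?c * cmod (1 - ?f z)"
        by (simp only: norm_mult norm_power_int norm_of_circle power_int_1_left mult_1_right)
      also have "\<dots> \<le> cmod ?c * 1" by (rule mult_left_mono) simp_all
      finally show "cmod (?g z) \<le> cmod ?c * cmod (of_circle z powi 0)" by simp
    qed
    have 3: "norm (char_L2 0) = 1"
    proof -
      have "(norm (char_L2 0))\<^sup>2 = 1" by (simp add: power2_norm_eq_inner inner_char fourier_coeff_char)
      thus ?thesis using power2_eq_1_iff[of "norm (char_L2 0)"] norm_ge_zero[of "char_L2 0"] by linarith
    qed
    have 4: "norm (abs_L2 ?h) \<le> 1 * norm (abs_L2 ?f)"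
      by (rule norm_abs_L2_le[OF bounded_measurable_sq_int[OF hb] bounded_measurable_sq_int[OF fb]])
         (simp_all add: norm_mult norm_power_int)
    have 5: "norm (abs_L2 ?f) \<le> sqrt (t / (2 * pi))" using elim by (intro norm_indicator_arg_le) auto
    show ?case unfolding eq using 1 2 4 5 unfolding 3 by linarith
  qed
qed

text \<open>The translations are contractions, so it suffices to have convergence on a set with dense span: the
characters, enumerated by \<open>int_decode\<close>.\<close>

lemma shift_L2_tendsto: "((\<lambda>t. shift_L2 t f) \<longlongrightarrow> f) (at_right 0)"
proof -
  let ?t = "\<lambda>k. fourier_coeff f (int_decode k) *\<^sub>C char_L2 (int_decode k)"
  obtain s where s: "?t sums s" "\<And>k. fourier_coeff s (int_decode k) = fourier_coeff f (int_decode k)"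
    using riesz_fischer[OF inj_int_decode summable_fourier_coeff[OF inj_int_decode]] by metis
  have "s = f" by (rule L2_eqI) (metis s(2) int_encode_inverse)
  hence sums: "(\<lambda>n. \<Sum>k<n. ?t k) \<longlonglongrightarrow> f" using s(1) by (simp add: sums_def)
  have pos: "\<forall>\<^sub>F t in at_right (0::real). t > 0" by (rule eventually_at_right_less)
  have part: "((\<lambda>t. shift_L2 t (\<Sum>k<n. ?t k)) \<longlongrightarrow> (\<Sum>k<n. ?t k)) (at_right 0)" for n
  proof -
    have "((\<lambda>t. \<Sum>k<n. fourier_coeff f (int_decode k) *\<^sub>C shift_L2 t (char_L2 (int_decode k))) \<longlongrightarrow> (\<Sum>k<n. ?t k)) (at_right 0)"
      by (intro tendsto_sum bounded_linear.tendsto[OF bounded_linear_scaleC_right] shift_L2_char_tendsto)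
    moreover have "\<forall>\<^sub>F t in at_right 0. (\<Sum>k<n. fourier_coeff f (int_decode k) *\<^sub>C shift_L2 t (char_L2 (int_decode k))) =
        shift_L2 t (\<Sum>k<n. ?t k)"
      using pos
    proof eventually_elim
      case (elim t)
      thus ?case by (simp add: Real_Vector_Spaces.linear_sum[OF bounded_linear.linear[OF bounded_linear_shift_L2]] shift_L2_scaleC)
    qed
    ultimately show ?thesis by (rule Lim_transform_eventually)
  qed
  show ?thesis unfolding tendsto_iff
  proof (intro allI impI)
    fix e :: real assume "e > 0"
    hence e3: "e / 3 > 0" by simp
    from LIMSEQ_D[OF sums e3] obtain n where n: "norm ((\<Sum>k<n. ?t k) - f) < e / 3" by blast
    from part[of n] e3 have "\<forall>\<^sub>F t in at_right 0. dist (shift_L2 t (\<Sum>k<n. ?t k)) (\<Sum>k<n. ?t k) < e / 3"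
      by (rule tendstoD)
    with pos show "\<forall>\<^sub>F t in at_right 0. dist (shift_L2 t f) f < e"
    proof eventually_elim
      case (elim t)
      let ?p = "\<Sum>k<n. ?t k"
      have "shift_L2 t f - shift_L2 t ?p = shift_L2 t (f - ?p)"
        using elim linear_diff[OF bounded_linear.linear[OF bounded_linear_shift_L2[of t]]] by simp
      hence "dist (shift_L2 t f) (shift_L2 t ?p) < e / 3"
        using norm_shift_L2_le[of t "f - ?p"] n elim by (simp add: dist_norm norm_minus_commute)
      moreover have "dist ?p f < e / 3" using n by (simp add: dist_norm)
      ultimately show ?case
        using elim dist_triangle[of "shift_L2 t f" f "shift_L2 t ?p"] dist_triangle[of "shift_L2 t ?p" f ?p] by linarith
    qed
  qed
qed

text \<open>A unitary map onto $L^2(\mathbb T)$: the \<open>k\<close>-th Fourier coefficient of a Hardy function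
becomes the coefficient of index \<open>int_decode k\<close>.\<close>

definition H2_to_L2 :: "H2 \<Rightarrow> L2" where
  "H2_to_L2 f = (SOME g. \<forall>k. fourier_coeff g (int_decode k) = fourier_coeff (of_H2 f) (int k))"

definition L2_to_H2 :: "L2 \<Rightarrow> H2" where
  "L2_to_H2 g = (SOME f. \<forall>k. fourier_coeff (of_H2 f) (int k) = fourier_coeff g (int_decode k))"

lemma coeff_transfer:
  assumes "inj (\<sigma> :: nat \<Rightarrow> int)" "inj (\<tau> :: nat \<Rightarrow> int)"
  obtains s where "\<And>k. fourier_coeff s (\<tau> k) = fourier_coeff f (\<sigma> k)"
    "\<And>n. n \<notin> range \<tau> \<Longrightarrow> fourier_coeff s n = 0" "norm s \<le> norm f"
proof -
  have sq: "summable (\<lambda>k. (cmod (fourier_coeff f (\<sigma> k)))\<^sup>2)" by (rule summable_fourier_coeff[OF assms(1)])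
  obtain s where s: "(norm s)\<^sup>2 = (\<Sum>k. (cmod (fourier_coeff f (\<sigma> k)))\<^sup>2)"
    "\<And>k. fourier_coeff s (\<tau> k) = fourier_coeff f (\<sigma> k)" "\<And>n. n \<notin> range \<tau> \<Longrightarrow> fourier_coeff s n = 0"
    using riesz_fischer[OF assms(2) sq] by metis
  have "(norm s)\<^sup>2 \<le> (norm f)\<^sup>2"
    unfolding s(1) by (rule suminf_le_const[OF sq]) (auto intro!: bessel_inj inj_on_subset[OF assms(1)])
  hence "norm s \<le> norm f" by (rule power2_le_imp_le) simp
  thus ?thesis using that s by blast
qed

lemma inj_int_nat: "inj (int :: nat \<Rightarrow> int)"
  by (simp add: inj_def)

lemma coeff_H2_to_L2: "fourier_coeff (H2_to_L2 f) (int_decode k) = fourier_coeff (of_H2 f) (int k)"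
proof -
  obtain s where "\<forall>k. fourier_coeff s (int_decode k) = fourier_coeff (of_H2 f) (int k)"
    using coeff_transfer[OF inj_int_nat inj_int_decode] by metis
  hence "\<forall>k. fourier_coeff (H2_to_L2 f) (int_decode k) = fourier_coeff (of_H2 f) (int k)"
    unfolding H2_to_L2_def by (rule someI)
  thus ?thesis by blast
qed

lemma L2_eqI_int_decode: "(\<And>k. fourier_coeff f (int_decode k) = fourier_coeff g (int_decode k)) \<Longrightarrow> f = g"
  by (rule L2_eqI) (metis int_encode_inverse)

lemma H2_eqI_coeff: "(\<And>k. fourier_coeff (of_H2 f) (int k) = fourier_coeff (of_H2 g) (int k)) \<Longrightarrow> f = g"
  by (rule H2_eqI, rule L2_eqI) (metis of_H2_coeff nonneg_int_cases not_le)

lemma norm_H2_to_L2: "norm (H2_to_L2 f) \<le> norm f"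
proof -
  obtain s where s: "\<And>k. fourier_coeff s (int_decode k) = fourier_coeff (of_H2 f) (int k)" "norm s \<le> norm (of_H2 f)"
    using coeff_transfer[OF inj_int_nat inj_int_decode] by metis
  have "H2_to_L2 f = s" by (rule L2_eqI_int_decode) (simp add: s coeff_H2_to_L2)
  thus ?thesis using s(2) by (simp add: norm_of_H2)
qed

lemma L2_to_H2_ex:
  obtains f where "\<And>k. fourier_coeff (of_H2 f) (int k) = fourier_coeff g (int_decode k)" "norm f \<le> norm g"
proof -
  obtain s where s: "\<And>k. fourier_coeff s (int k) = fourier_coeff g (int_decode k)"
    "\<And>n. n \<notin> range int \<Longrightarrow> fourier_coeff s n = 0" "norm s \<le> norm g"
    using coeff_transfer[OF inj_int_decode inj_int_nat] by metis
  have "of_H2 (Abs_H2 s) = s" by (rule Abs_H2_inverse) (auto intro!: s(2))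
  thus ?thesis using that[of "Abs_H2 s"] s norm_of_H2[of "Abs_H2 s"] by simp
qed

lemma coeff_L2_to_H2: "fourier_coeff (of_H2 (L2_to_H2 g)) (int k) = fourier_coeff g (int_decode k)"
proof -
  obtain f where "\<forall>k. fourier_coeff (of_H2 f) (int k) = fourier_coeff g (int_decode k)"
    using L2_to_H2_ex by metis
  hence "\<forall>k. fourier_coeff (of_H2 (L2_to_H2 g)) (int k) = fourier_coeff g (int_decode k)"
    unfolding L2_to_H2_def by (rule someI)
  thus ?thesis by blast
qed

lemma norm_L2_to_H2: "norm (L2_to_H2 g) \<le> norm g"
proof -
  obtain f where f: "\<And>k. fourier_coeff (of_H2 f) (int k) = fourier_coeff g (int_decode k)" "norm f \<le> norm g"
    using L2_to_H2_ex by metis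
  have "L2_to_H2 g = f" by (rule H2_eqI_coeff) (simp add: f coeff_L2_to_H2)
  thus ?thesis using f(2) by simp
qed

lemma L2_to_H2_inverse: "L2_to_H2 (H2_to_L2 f) = f"
  by (rule H2_eqI_coeff) (simp add: coeff_L2_to_H2 coeff_H2_to_L2)

lemma H2_to_L2_inverse: "H2_to_L2 (L2_to_H2 g) = g"
  by (rule L2_eqI_int_decode) (simp add: coeff_L2_to_H2 coeff_H2_to_L2)

lemma H2_to_L2_add: "H2_to_L2 (f + g) = H2_to_L2 f + H2_to_L2 g"
  by (rule L2_eqI_int_decode) (simp add: coeff_H2_to_L2 fourier_coeff_add plus_H2.rep_eq)

lemma H2_to_L2_scaleC: "H2_to_L2 (c *\<^sub>C f) = c *\<^sub>C H2_to_L2 f"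
  by (rule L2_eqI_int_decode) (simp add: coeff_H2_to_L2 fourier_coeff_scaleC scaleC_H2.rep_eq)

lemma L2_to_H2_add: "L2_to_H2 (f + g) = L2_to_H2 f + L2_to_H2 g"
  by (rule H2_eqI_coeff) (simp add: coeff_L2_to_H2 fourier_coeff_add plus_H2.rep_eq)

lemma L2_to_H2_scaleC: "L2_to_H2 (c *\<^sub>C f) = c *\<^sub>C L2_to_H2 f"
  by (rule H2_eqI_coeff) (simp add: coeff_L2_to_H2 fourier_coeff_scaleC scaleC_H2.rep_eq)

lemma bounded_linear_L2_to_H2: "bounded_linear L2_to_H2"
  by (rule bounded_linear_intro[of _ 1])
     (simp_all add: L2_to_H2_add L2_to_H2_scaleC norm_L2_to_H2 scaleC_of_real[symmetric])

text \<open>The translations on $L^2(\mathbb T)$, moved to $H^2$ and rescaled so that they vanish at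
time \<open>1\<close>.\<close>

theorem C0_embeddable_zero: "C0_embeddable (\<lambda>_. 0 :: H2)"
proof -
  define T where "T t f = L2_to_H2 (shift_L2 (2 * pi * t) (H2_to_L2 f))" for t f
  have "C0_semigroup T"
    unfolding C0_semigroup_def
  proof (intro conjI allI impI)
    fix t :: real assume "t > 0"
    hence t: "2 * pi * t \<ge> 0" by simp
    have add: "T t (f + g) = T t f + T t g" for f g
      by (simp add: T_def H2_to_L2_add shift_L2_add_right[OF t] L2_to_H2_add)
    have sc: "T t (c *\<^sub>C f) = c *\<^sub>C T t f" for c f
      by (simp add: T_def H2_to_L2_scaleC shift_L2_scaleC[OF t] L2_to_H2_scaleC)
    have "norm (T t f) \<le> norm f * 1" for f
      unfolding T_def using norm_L2_to_H2 norm_shift_L2_le[OF t] norm_H2_to_L2 by (metis mult.right_neutral order_trans)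
    hence "bounded_linear (T t)"
      by (intro bounded_linear_intro[of _ 1]) (simp_all only: add sc scaleC_of_real[symmetric])
    thus "bounded_clinear (T t)" using sc by (simp add: bounded_clinear_def)
  next
    fix t s :: real assume "t > 0" "s > 0"
    thus "T t \<circ> T s = T (t + s)"
      by (simp add: fun_eq_iff T_def H2_to_L2_inverse shift_L2_add distrib_left)
  next
    fix f
    have "((\<lambda>t. 2 * pi * t) \<longlongrightarrow> 2 * pi * 0) (at_right 0)" by (intro tendsto_intros)
    hence "filterlim (\<lambda>t. 2 * pi * t) (at_right 0) (at_right (0::real))"
      unfolding filterlim_at using eventually_at_right_less[of "0::real"] by (auto elim: eventually_mono)
    from filterlim_compose[OF shift_L2_tendsto this, of "H2_to_L2 f"]
    have "((\<lambda>t. T t f) \<longlongrightarrow> L2_to_H2 (H2_to_L2 f)) (at_right 0)"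
      unfolding T_def by (rule bounded_linear.tendsto[OF bounded_linear_L2_to_H2])
    hence "((\<lambda>t. T t f - f) \<longlongrightarrow> 0) (at_right 0)" by (simp add: L2_to_H2_inverse LIM_zero)
    thus "((\<lambda>t. norm (T t f - f)) \<longlongrightarrow> 0) (at_right 0)" by (rule tendsto_norm_zero)
  qed
  moreover have "T 1 = (\<lambda>_. 0)"
  proof
    fix f
    have "L2_to_H2 0 = 0" using linear_0[OF bounded_linear.linear[OF bounded_linear_L2_to_H2]] .
    thus "T 1 f = 0" by (simp add: T_def shift_L2_2pi)
  qed
  ultimately show ?thesis unfolding C0_embeddable_def by blast
qed

section \<open>Gelfand theory for function algebras without unit\<close>

abbreviation cst :: "complex \<Rightarrow> circle \<Rightarrow> complex" where "cst c \<equiv> (\<lambda>_. c)"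

text \<open>Functions are added and multiplied by the pointwise operations of the type class instances for
function types, so that identities between them can be proved by ring normalisation. The algebra may lack the
constant functions; the constant \<open>1\<close> then only occurs in expressions like \<open>1 - x\<close>, which stand for
elements of the unitisation.\<close>

locale continuous_function_algebra =
  fixes X :: "(circle \<Rightarrow> complex) set" and N :: "(circle \<Rightarrow> complex) \<Rightarrow> real"
  assumes banach: "banach_function_algebra X N"
    and embedded: "cont_embedded_in_C X N"
begin

lemma zero_mem: "0 \<in> X"
  using banach by (simp add: banach_function_algebra_def zero_fun_def)

lemma add_mem: "f \<in> X \<Longrightarrow> g \<in> X \<Longrightarrow> f + g \<in> X"
  using banach by (simp add: banach_function_algebra_def plus_fun_def)

lemma scale_mem: "f \<in> X \<Longrightarrow> cst c * f \<in> X"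
  using banach by (simp add: banach_function_algebra_def times_fun_def)

lemma mult_mem: "f \<in> X \<Longrightarrow> g \<in> X \<Longrightarrow> f * g \<in> X"
  using banach by (simp add: banach_function_algebra_def times_fun_def)

lemma uminus_eq_scale: "- f = cst (- 1) * (f :: circle \<Rightarrow> complex)"
  by (simp add: fun_eq_iff)

lemma uminus_mem: "f \<in> X \<Longrightarrow> - f \<in> X"
  unfolding uminus_eq_scale by (rule scale_mem)

lemma diff_mem: "f \<in> X \<Longrightarrow> g \<in> X \<Longrightarrow> f - g \<in> X"
  using add_mem[OF _ uminus_mem, of f g] by simp

lemma sum_mem: "(\<And>i. i \<in> A \<Longrightarrow> f i \<in> X) \<Longrightarrow> sum f A \<in> X"
  by (induction A rule: infinite_finite_induct) (auto intro: zero_mem add_mem)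

lemma N_nonneg: "f \<in> X \<Longrightarrow> 0 \<le> N f"
  using banach by (simp add: banach_function_algebra_def)

lemma N_scale: "f \<in> X \<Longrightarrow> N (cst c * f) = cmod c * N f"
  using banach by (simp add: banach_function_algebra_def times_fun_def)

lemma N_add_le: "f \<in> X \<Longrightarrow> g \<in> X \<Longrightarrow> N (f + g) \<le> N f + N g"
  using banach by (simp add: banach_function_algebra_def plus_fun_def)

lemma N_mult_le: "f \<in> X \<Longrightarrow> g \<in> X \<Longrightarrow> N (f * g) \<le> N f * N g"
  using banach by (simp add: banach_function_algebra_def times_fun_def)

lemma N_zero: "N 0 = 0"
  using N_scale[OF zero_mem, of 0] by simp

lemma N_minus: "f \<in> X \<Longrightarrow> N (- f) = N f"
  unfolding uminus_eq_scale by (simp add: N_scale)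

lemma N_sum_le: "(\<And>i. i \<in> A \<Longrightarrow> f i \<in> X) \<Longrightarrow> N (sum f A) \<le> (\<Sum>i\<in>A. N (f i))"
proof (induction A rule: infinite_finite_induct)
  case (insert i A)
  have "N (f i + sum f A) \<le> N (f i) + N (sum f A)"
    using insert by (intro N_add_le sum_mem) auto
  also have "\<dots> \<le> N (f i) + (\<Sum>i\<in>A. N (f i))" using insert by auto
  finally show ?case unfolding sum.insert[OF insert(1,2)] .
qed (simp_all add: N_zero)

lemma N_power_le: "f \<in> X \<Longrightarrow> f ^ Suc n \<in> X \<and> N (f ^ Suc n) \<le> N f ^ Suc n"
proof (induction n)
  case (Suc n)
  note f = Suc.prems and p = conjunct1[OF Suc.IH[OF Suc.prems]] and le = conjunct2[OF Suc.IH[OF Suc.prems]]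
  have "N (f * f ^ Suc n) \<le> N f * N (f ^ Suc n)" by (rule N_mult_le[OF f p])
  also have "\<dots> \<le> N f * N f ^ Suc n" by (rule mult_left_mono[OF le N_nonneg[OF f]])
  finally show ?case using mult_mem[OF f p]
    by (simp only: power_Suc[of f "Suc n"] power_Suc[of "N f" "Suc n"])
qed simp

lemma complete:
  assumes "\<And>n. s n \<in> X" "\<And>e. e > 0 \<Longrightarrow> \<exists>M. \<forall>m\<ge>M. \<forall>n\<ge>M. N (s m - s n) < e"
  obtains f where "f \<in> X" "(\<lambda>n. N (s n - f)) \<longlonglongrightarrow> 0"
proof -
  have *: "f - g = (\<lambda>z. f z - g z)" for f g :: "circle \<Rightarrow> complex" by (simp add: fun_eq_iff)
  show ?thesis
    using banach assms that unfolding banach_function_algebra_def * by blast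
qed

lemma continuous: "f \<in> X \<Longrightarrow> continuous_on UNIV f"
  using embedded by (simp add: cont_embedded_in_C_def)

lemma pointwise_bound: obtains C where "C \<ge> 0" "\<And>f z. f \<in> X \<Longrightarrow> cmod (f z) \<le> C * N f"
proof -
  obtain C where C: "\<And>f z. f \<in> X \<Longrightarrow> cmod (f z) \<le> C * N f"
    using embedded by (auto simp: cont_embedded_in_C_def)
  have "cmod (f z) \<le> max C 0 * N f" if "f \<in> X" for f z
    using C[OF that, of z] mult_right_mono[OF max.cobounded1[of C 0] N_nonneg[OF that]] by linarith
  thus ?thesis using that[of "max C 0"] by simp
qed

text \<open>A power series without constant term, with coefficients bounded by \<open>1\<close>, converges in the norm of
the algebra, and therefore pointwise.\<close>

lemma power_series_mem:
  assumes x: "x \<in> X" "N x < 1" and a: "\<And>n. cmod (a n) \<le> 1"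
  obtains s where "s \<in> X" "\<And>z. (\<lambda>n. a n * x z ^ Suc n) sums s z"
proof -
  define p where "p n = (\<Sum>k<n. cst (a k) * x ^ Suc k)" for n
  have trm: "cst (a k) * x ^ Suc k \<in> X" "N (cst (a k) * x ^ Suc k) \<le> N x ^ Suc k" for k
  proof -
    note px = N_power_le[OF x(1), of k]
    show "cst (a k) * x ^ Suc k \<in> X" using px by (intro scale_mem) auto
    have "N (cst (a k) * x ^ Suc k) = cmod (a k) * N (x ^ Suc k)" using px by (intro N_scale) auto
    also have "\<dots> \<le> 1 * N x ^ Suc k" using px a N_nonneg[OF x(1)] N_nonneg by (intro mult_mono) auto
    finally show "N (cst (a k) * x ^ Suc k) \<le> N x ^ Suc k" by simp
  qed
  have pX: "p n \<in> X" for n unfolding p_def by (intro sum_mem trm)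
  have summ: "summable (\<lambda>k. N x ^ Suc k)"
    using x N_nonneg[OF x(1)] by (subst summable_Suc_iff) (intro summable_geometric, simp)
  have diff: "N (p m - p n) \<le> norm (\<Sum>k\<in>{n..<m}. N x ^ Suc k)" if "n \<le> m" for m n
  proof -
    have "p m - p n = (\<Sum>k\<in>{n..<m}. cst (a k) * x ^ Suc k)"
      unfolding p_def using that by (simp add: lessThan_atLeast0 sum_diff_nat_ivl)
    hence "N (p m - p n) = N (\<Sum>k\<in>{n..<m}. cst (a k) * x ^ Suc k)" by (rule arg_cong)
    also have "\<dots> \<le> (\<Sum>k\<in>{n..<m}. N (cst (a k) * x ^ Suc k))" by (intro N_sum_le trm)
    also have "\<dots> \<le> (\<Sum>k\<in>{n..<m}. N x ^ Suc k)" by (intro sum_mono trm)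
    finally show ?thesis by simp
  qed
  obtain s where s: "s \<in> X" "(\<lambda>n. N (p n - s)) \<longlonglongrightarrow> 0"
  proof (rule complete[of p])
    fix e :: real assume "e > 0"
    then obtain M where M: "\<And>m n. m \<ge> M \<Longrightarrow> norm (\<Sum>k\<in>{m..<n}. N x ^ Suc k) < e"
      using summ unfolding summable_Cauchy by meson
    have "N (p m - p n) < e" if "m \<ge> M" "n \<ge> M" for m n
    proof (cases "n \<le> m")
      case True thus ?thesis using diff[of n m] M[of n m] that by linarith
    next
      case False
      have "N (p m - p n) = N (p n - p m)" using N_minus[OF diff_mem[OF pX pX], of n m] by simp
      thus ?thesis using False diff[of m n] M[of m n] that by linarith
    qed
    thus "\<exists>M. \<forall>m\<ge>M. \<forall>n\<ge>M. N (p m - p n) < e" by blast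
  qed (use pX in auto)
  obtain C where C: "C \<ge> 0" "\<And>f z. f \<in> X \<Longrightarrow> cmod (f z) \<le> C * N f" by (rule pointwise_bound) blast
  have "(\<lambda>n. a n * x z ^ Suc n) sums s z" for z
    unfolding sums_def
  proof (rule LIM_zero_cancel, rule Lim_null_comparison)
    show "\<forall>\<^sub>F n in sequentially. cmod ((\<Sum>k<n. a k * x z ^ Suc k) - s z) \<le> C * N (p n - s)"
    proof (rule always_eventually, rule allI)
      fix n
      have pow: "(x ^ k) z = x z ^ k" for k by (induction k) auto
      have sm: "(sum f A) z = (\<Sum>k\<in>A. f k z)" for f :: "nat \<Rightarrow> circle \<Rightarrow> complex" and A
        by (induction A rule: infinite_finite_induct) auto
      have "p n z = (\<Sum>k<n. a k * x z ^ Suc k)"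
        unfolding p_def sm by (simp only: times_fun_apply pow)
      thus "cmod ((\<Sum>k<n. a k * x z ^ Suc k) - s z) \<le> C * N (p n - s)"
        using C(2)[OF diff_mem[OF pX s(1)], of n z] by simp
    qed
    show "(\<lambda>n. C * N (p n - s)) \<longlonglongrightarrow> 0" by (rule tendsto_mult_right_zero[OF s(2)])
  qed
  with s(1) show ?thesis by (rule that)
qed

text \<open>The geometric series of \<open>x z\<close> converges by the previous lemma.\<close>

lemma pointwise_less_one:
  assumes "x \<in> X" "N x < 1" shows "cmod (x z) < 1"
proof -
  obtain s where s: "\<And>z. (\<lambda>n. 1 * x z ^ Suc n) sums s z"
    by (rule power_series_mem[OF assms, of "\<lambda>_. 1"]) auto
  from sums_summable[OF s[of z]] have "summable (\<lambda>n. x z ^ Suc n)" by (simp only: mult_1)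
  hence "summable (\<lambda>n. x z ^ n)" by (simp only: summable_Suc_iff[where f = "\<lambda>n. x z ^ n"])
  thus ?thesis by (simp only: summable_geometric_iff)
qed

lemma quasi_inverse_small:
  assumes "x \<in> X" "N x < 1" obtains y where "y \<in> X" "(1 - x) * (1 - y) = 1"
proof -
  obtain s where s: "s \<in> X" "\<And>z. (\<lambda>n. 1 * x z ^ Suc n) sums s z"
    by (rule power_series_mem[OF assms, of "\<lambda>_. 1"]) auto
  have "(1 - x z) * (1 - - s z) = 1" for z
  proof -
    have lt: "cmod (x z) < 1" by (rule pointwise_less_one[OF assms])
    hence "x z \<noteq> 1" by auto
    have "(\<lambda>n. x z * x z ^ n) sums (x z * (1 / (1 - x z)))" by (intro sums_mult geometric_sums lt)
    hence "s z = x z * (1 / (1 - x z))" using s(2)[of z] by (simp add: sums_iff)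
    thus ?thesis using \<open>x z \<noteq> 1\<close> by (simp add: field_simps)
  qed
  thus ?thesis using s(1) by (intro that[of "- s"] uminus_mem) (auto simp: fun_eq_iff)
qed

lemma log_one_minus_small:
  assumes "x \<in> X" "N x < 1" obtains g where "g \<in> X" "\<And>z. 1 - x z = exp (g z)"
proof -
  have "cmod (1 / of_nat (Suc n)) \<le> 1" for n by (simp add: norm_divide del: of_nat_Suc)
  then obtain s where s: "s \<in> X" "\<And>z. (\<lambda>n. 1 / of_nat (Suc n) * x z ^ Suc n) sums s z"
    by (rule power_series_mem[OF assms, of "\<lambda>n. 1 / of_nat (Suc n)"]) auto
  have "1 - x z = exp (- s z)" for z
  proof -
    have lt: "cmod (x z) < 1" by (rule pointwise_less_one[OF assms])
    hence ne: "x z \<noteq> 1" by auto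
    have "(\<lambda>n. - ((- (- x z)) ^ n) / of_nat n) sums ln (1 + (- x z))" using lt by (intro Ln_series') simp
    hence "(\<lambda>n. - (x z ^ n) / of_nat n) sums ln (1 - x z)" by simp
    hence "(\<lambda>n. - (x z ^ Suc n) / of_nat (Suc n)) sums ln (1 - x z)"
      by (subst sums_Suc_iff) simp
    moreover have "(\<lambda>n. - (1 / of_nat (Suc n) * x z ^ Suc n)) sums (- s z)"
      by (intro sums_minus s(2))
    ultimately have "- s z = ln (1 - x z)" by (intro sums_unique2) simp_all
    thus ?thesis using ne by simp
  qed
  thus ?thesis using s(1) by (intro that[of "- s"] uminus_mem) auto
qed

end

context continuous_function_algebra
begin

text \<open>An ideal modulo which \<open>e\<close> is a unit element. In an algebra without unit these ideals replace the
proper ideals: membership of \<open>e\<close> would make the ideal the whole algebra.\<close>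

definition modular_ideal :: "(circle \<Rightarrow> complex) \<Rightarrow> (circle \<Rightarrow> complex) set \<Rightarrow> bool" where
  "modular_ideal e I \<longleftrightarrow> I \<subseteq> X \<and> 0 \<in> I \<and> (\<forall>a\<in>I. \<forall>b\<in>I. a + b \<in> I) \<and> (\<forall>c. \<forall>a\<in>I. cst c * a \<in> I) \<and>
     (\<forall>a\<in>I. \<forall>x\<in>X. a * x \<in> I) \<and> (\<forall>x\<in>X. e * x - x \<in> I) \<and> e \<notin> I"

end

locale maximal_modular_ideal = continuous_function_algebra +
  fixes e :: "circle \<Rightarrow> complex" and M :: "(circle \<Rightarrow> complex) set"
  assumes e_mem: "e \<in> X"
    and ideal: "modular_ideal e M"
    and maximal: "\<And>I. modular_ideal e I \<Longrightarrow> M \<subseteq> I \<Longrightarrow> I = M"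
begin

lemma M_sub: "f \<in> M \<Longrightarrow> f \<in> X"
  and M_zero: "0 \<in> M"
  and M_add: "f \<in> M \<Longrightarrow> g \<in> M \<Longrightarrow> f + g \<in> M"
  and M_scale: "f \<in> M \<Longrightarrow> cst c * f \<in> M"
  and M_mult: "f \<in> M \<Longrightarrow> x \<in> X \<Longrightarrow> f * x \<in> M"
  and M_unit: "x \<in> X \<Longrightarrow> e * x - x \<in> M"
  and e_notin: "e \<notin> M"
  using ideal unfolding modular_ideal_def by blast+

lemma diff_M_mem: "f \<in> X \<Longrightarrow> m \<in> M \<Longrightarrow> f - m \<in> X"
  by (intro diff_mem M_sub[of m])

lemma M_mult_left: "f \<in> M \<Longrightarrow> x \<in> X \<Longrightarrow> x * f \<in> M"
  using M_mult by (simp only: mult.commute)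

lemma M_minus: "f \<in> M \<Longrightarrow> - f \<in> M"
  unfolding uminus_eq_scale by (rule M_scale)

lemma M_diff: "f \<in> M \<Longrightarrow> g \<in> M \<Longrightarrow> f - g \<in> M"
  using M_add[OF _ M_minus, of f g] by simp

lemma M_sum: "(\<And>i. i \<in> A \<Longrightarrow> f i \<in> M) \<Longrightarrow> sum f A \<in> M"
  by (induction A rule: infinite_finite_induct) (auto intro: M_zero M_add)

text \<open>By maximality the ideal generated by \<open>M\<close> and \<open>y\<close> contains \<open>e\<close>: modulo \<open>M\<close> the algebra is a field.\<close>

lemma inverse_mod:
  assumes y: "y \<in> X" "y \<notin> M" obtains w where "w \<in> X" "y * w - e \<in> M"
proof -
  define I where "I = {m + y * w + cst b * y | m w b. m \<in> M \<and> w \<in> X}"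
  have I: "m + y * w + cst b * y \<in> I" if "m \<in> M" "w \<in> X" for m w b
    unfolding I_def using that by blast
  have MI: "m \<in> I" if "m \<in> M" for m
    using I[OF that zero_mem, of 0] by (simp add: zero_fun_def[symmetric])
  have "y \<in> I" using I[OF M_zero zero_mem, of 1] by (simp add: one_fun_def[symmetric])
  have not_ideal: "\<not> modular_ideal e I"
  proof
    assume "modular_ideal e I"
    hence "I = M" by (rule maximal) (use MI in blast)
    with \<open>y \<in> I\<close> y(2) show False by simp
  qed
  have 1: "I \<subseteq> X"
    unfolding I_def using y(1) M_sub by (auto intro!: add_mem mult_mem scale_mem)
  have 2: "0 \<in> I" by (rule MI[OF M_zero])
  have 3: "a + a' \<in> I" if "a \<in> I" "a' \<in> I" for a a'
  proof -
    from that obtain m w b m' w' b' where a: "a = m + y * w + cst b * y" "a' = m' + y * w' + cst b' * y"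
      and mw: "m \<in> M" "m' \<in> M" "w \<in> X" "w' \<in> X" unfolding I_def by blast
    have "a + a' = (m + m') + y * (w + w') + cst (b + b') * y"
      unfolding a by (simp add: fun_eq_iff algebra_simps)
    thus ?thesis using I[OF M_add[OF mw(1,2)] add_mem[OF mw(3,4)]] by simp
  qed
  have 4: "cst c * a \<in> I" if "a \<in> I" for a c
  proof -
    from that obtain m w b where a: "a = m + y * w + cst b * y"
      and mw: "m \<in> M" "w \<in> X" unfolding I_def by blast
    have "cst c * a = cst c * m + y * (cst c * w) + cst (c * b) * y"
      unfolding a by (simp add: fun_eq_iff algebra_simps)
    thus ?thesis using I[OF M_scale[OF mw(1)] scale_mem[OF mw(2)]] by simp
  qed
  have 5: "a * x \<in> I" if "a \<in> I" "x \<in> X" for a x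
  proof -
    from that obtain m w b where a: "a = m + y * w + cst b * y"
      and mw: "m \<in> M" "w \<in> X" unfolding I_def by blast
    have "a * x = m * x + y * (w * x + cst b * x) + cst 0 * y"
      unfolding a by (simp add: fun_eq_iff algebra_simps)
    thus ?thesis
      using I[OF M_mult[OF mw(1) that(2)] add_mem[OF mult_mem[OF mw(2) that(2)] scale_mem[OF that(2)]]] by simp
  qed
  have 6: "e * x - x \<in> I" if "x \<in> X" for x by (rule MI[OF M_unit[OF that]])
  have "e \<in> I"
  proof (rule ccontr)
    assume "e \<notin> I"
    hence "modular_ideal e I"
      unfolding modular_ideal_def by (intro conjI ballI allI 1 2 3 4 5 6)
    with not_ideal show False ..
  qed
  then obtain m w b where e: "e = m + y * w + cst b * y" and mw: "m \<in> M" "w \<in> X"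
    unfolding I_def by blast
  let ?w = "w + cst b * e"
  have "?w \<in> X" by (intro add_mem scale_mem mw e_mem)
  moreover have "y * ?w - e \<in> M"
  proof -
    have "y * ?w - e = cst b * (e * y - y) - m"
      by (subst (2) e) (simp add: fun_eq_iff algebra_simps)
    moreover have "cst b * (e * y - y) - m \<in> M" by (intro M_diff M_scale M_unit y mw)
    ultimately show ?thesis by simp
  qed
  ultimately show ?thesis by (rule that)
qed

text \<open>The norm of the quotient modulo \<open>M\<close>, kept as a seminorm on the algebra itself; congruence modulo
\<open>M\<close> takes the place of equality in the quotient.\<close>

definition quot_norm :: "(circle \<Rightarrow> complex) \<Rightarrow> real" where
  "quot_norm f = (INF m\<in>M. N (f - m))"

lemma quot_norm_le: "f \<in> X \<Longrightarrow> m \<in> M \<Longrightarrow> quot_norm f \<le> N (f - m)"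
  unfolding quot_norm_def
  by (intro cINF_lower bdd_belowI2[of _ 0] N_nonneg diff_M_mem)

lemma quot_norm_nonneg: "f \<in> X \<Longrightarrow> 0 \<le> quot_norm f"
  unfolding quot_norm_def using M_zero by (intro cINF_greatest N_nonneg diff_M_mem) auto

lemma quot_norm_approx:
  assumes "f \<in> X" "d > 0" obtains m where "m \<in> M" "N (f - m) < quot_norm f + d"
proof -
  have "(INF m\<in>M. N (f - m)) < quot_norm f + d" using assms(2) by (simp add: quot_norm_def)
  hence "\<exists>m\<in>M. N (f - m) < quot_norm f + d"
    using M_zero assms by (subst (asm) cINF_less_iff) (auto intro!: bdd_belowI2[of _ 0] N_nonneg diff_M_mem)
  thus ?thesis using that by blast
qed

lemma quot_norm_M: "f \<in> M \<Longrightarrow> quot_norm f = 0"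
  using quot_norm_le[of f f] quot_norm_nonneg[of f] M_sub[of f] by (simp add: N_zero)

lemma quot_norm_add_le:
  assumes f: "f \<in> X" and g: "g \<in> X" shows "quot_norm (f + g) \<le> quot_norm f + quot_norm g"
proof (rule field_le_epsilon)
  fix d :: real assume "d > 0"
  obtain m where m: "m \<in> M" "N (f - m) < quot_norm f + d / 2" using quot_norm_approx[OF f, of "d / 2"] \<open>d > 0\<close> by auto
  obtain m' where m': "m' \<in> M" "N (g - m') < quot_norm g + d / 2" using quot_norm_approx[OF g, of "d / 2"] \<open>d > 0\<close> by auto
  have eq: "(f + g) - (m + m') = (f - m) + (g - m')" by (simp add: fun_eq_iff)
  have "quot_norm (f + g) \<le> N ((f + g) - (m + m'))" by (intro quot_norm_le add_mem M_add f g m m')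
  also have "\<dots> \<le> N (f - m) + N (g - m')" unfolding eq by (intro N_add_le diff_M_mem f g m m')
  finally show "quot_norm (f + g) \<le> quot_norm f + quot_norm g + d" using m m' by simp
qed

lemma quot_norm_mult_le:
  assumes f: "f \<in> X" and g: "g \<in> X" shows "quot_norm (f * g) \<le> quot_norm f * quot_norm g"
proof -
  have le: "quot_norm (f * g) \<le> (quot_norm f + d) * (quot_norm g + d)" if d: "d > 0" for d
  proof -
    obtain m where m: "m \<in> M" "N (f - m) < quot_norm f + d" using quot_norm_approx[OF f d] .
    obtain m' where m': "m' \<in> M" "N (g - m') < quot_norm g + d" using quot_norm_approx[OF g d] .
    have eq: "f * g - (m * g + (f - m) * m') = (f - m) * (g - m')" by (simp add: fun_eq_iff algebra_simps)
    have "quot_norm (f * g) \<le> N (f * g - (m * g + (f - m) * m'))"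
      by (intro quot_norm_le mult_mem M_add M_mult[of m] M_mult_left[of m'] diff_M_mem f g m m')
    also have "\<dots> \<le> N (f - m) * N (g - m')" unfolding eq by (intro N_mult_le diff_M_mem f g m m')
    also have "\<dots> \<le> (quot_norm f + d) * (quot_norm g + d)"
      using m m' quot_norm_nonneg[OF f] d
      by (intro mult_mono N_nonneg diff_M_mem f g) auto
    finally show ?thesis .
  qed
  have "((\<lambda>d. (quot_norm f + d) * (quot_norm g + d)) \<longlongrightarrow> (quot_norm f + 0) * (quot_norm g + 0)) (at_right 0)"
    by (intro tendsto_intros)
  hence "quot_norm (f * g) \<le> (quot_norm f + 0) * (quot_norm g + 0)"
    by (rule tendsto_lowerbound)
       (use le eventually_at_right_less[of "0::real"] in \<open>auto elim: eventually_mono\<close>)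
  thus ?thesis by simp
qed

lemma quot_norm_scale_le:
  assumes f: "f \<in> X" shows "quot_norm (cst c * f) \<le> cmod c * quot_norm f"
proof (rule field_le_epsilon)
  fix d :: real assume "d > 0"
  hence "d / (cmod c + 1) > 0" by (simp add: add_nonneg_pos)
  from quot_norm_approx[OF f this]
  obtain m where m: "m \<in> M" "N (f - m) < quot_norm f + d / (cmod c + 1)" .
  have eq: "cst c * f - cst c * m = cst c * (f - m)" by (simp add: fun_eq_iff algebra_simps)
  have "quot_norm (cst c * f) \<le> N (cst c * f - cst c * m)" by (intro quot_norm_le scale_mem M_scale f m)
  also have "\<dots> = cmod c * N (f - m)" unfolding eq by (intro N_scale diff_M_mem f m)
  also have "\<dots> \<le> cmod c * (quot_norm f + d / (cmod c + 1))" using m by (intro mult_left_mono) auto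
  also have "\<dots> = cmod c * quot_norm f + cmod c / (cmod c + 1) * d" by (simp add: algebra_simps)
  also have "cmod c / (cmod c + 1) * d \<le> 1 * d"
    using \<open>d > 0\<close> by (intro mult_right_mono) (auto simp: divide_le_eq_1 add_nonneg_pos)
  finally show "quot_norm (cst c * f) \<le> cmod c * quot_norm f + d" by simp
qed

lemma quot_norm_cong_le:
  assumes "f \<in> X" "g \<in> X" "f - g \<in> M" shows "quot_norm f \<le> quot_norm g"
  using quot_norm_add_le[OF assms(2) M_sub[OF assms(3)]] by (simp add: quot_norm_M[OF assms(3)])

lemma quot_norm_sum_le: "(\<And>i. i \<in> A \<Longrightarrow> f i \<in> X) \<Longrightarrow> quot_norm (sum f A) \<le> (\<Sum>i\<in>A. quot_norm (f i))"
proof (induction A rule: infinite_finite_induct)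
  case (insert i A)
  have "quot_norm (f i + sum f A) \<le> quot_norm (f i) + quot_norm (sum f A)"
    using insert by (intro quot_norm_add_le sum_mem) auto
  also have "\<dots> \<le> quot_norm (f i) + (\<Sum>i\<in>A. quot_norm (f i))" using insert by auto
  finally show ?case unfolding sum.insert[OF insert(1,2)] .
qed (simp_all add: quot_norm_M[OF M_zero])

text \<open>Otherwise \<open>e\<close> is congruent modulo \<open>M\<close> to an element of norm less than \<open>1\<close>, which has a
quasi-inverse, and \<open>e\<close> would lie in \<open>M\<close>.\<close>

lemma quot_norm_e: "1 \<le> quot_norm e"
proof (rule ccontr)
  assume "\<not> 1 \<le> quot_norm e"
  then obtain m where m: "m \<in> M" "N (e - m) < 1"
    using quot_norm_approx[OF e_mem, of "1 - quot_norm e"] by auto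
  obtain y where y: "y \<in> X" "(1 - (e - m)) * (1 - y) = 1"
    using quasi_inverse_small[OF diff_mem[OF e_mem M_sub[OF m(1)]] m(2)] .
  have "e = m + m * (- y) + (e * y - y)"
    using y(2) by (simp add: fun_eq_iff algebra_simps)
  moreover have "m + m * (- y) + (e * y - y) \<in> M"
    by (intro M_add M_mult M_unit uminus_mem m y)
  ultimately show False using e_notin by simp
qed

lemma power_mult_mem: "u \<in> X \<Longrightarrow> f \<in> X \<Longrightarrow> u ^ n * f \<in> X"
proof (induction n)
  case (Suc n)
  from mult_mem[OF Suc.prems(1) Suc.IH[OF Suc.prems]] show ?case by (simp only: power_Suc mult.assoc)
qed simp

lemma power_mult_M: "u \<in> X \<Longrightarrow> f \<in> M \<Longrightarrow> u ^ n * f \<in> M"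
proof (induction n)
  case (Suc n)
  from M_mult_left[OF Suc.IH[OF Suc.prems] Suc.prems(1)] show ?case by (simp only: power_Suc mult.assoc)
qed simp

lemma quot_norm_power_mult_le:
  assumes "u \<in> X" "f \<in> X" shows "quot_norm (u ^ n * f) \<le> quot_norm u ^ n * quot_norm f"
proof (induction n)
  case (Suc n)
  have "quot_norm (u * (u ^ n * f)) \<le> quot_norm u * quot_norm (u ^ n * f)"
    by (intro quot_norm_mult_le power_mult_mem assms)
  also have "\<dots> \<le> quot_norm u * (quot_norm u ^ n * quot_norm f)"
    using Suc by (intro mult_left_mono quot_norm_nonneg assms)
  finally show ?case by (simp only: power_Suc mult.assoc)
qed simp

text \<open>Modulo \<open>M\<close> the hypothesis reads \<open>(1 - c u) f = b\<close>; the conclusion is the expansion of \<open>f\<close> by \<open>n\<close>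
terms of the geometric series, with remainder.\<close>

lemma geometric_iterate:
  assumes "b \<in> X" "u \<in> X" "f \<in> X" and step: "f - b - cst c * (u * f) \<in> M"
  shows "f - ((\<Sum>j<n. cst (c ^ j) * (u ^ j * b)) + cst (c ^ n) * (u ^ n * f)) \<in> M"
proof (induction n)
  case 0
  have "f - ((\<Sum>j<0::nat. cst (c ^ j) * (u ^ j * b)) + cst (c ^ 0) * (u ^ 0 * f)) = 0"
    by (simp add: fun_eq_iff)
  thus ?case using M_zero by (simp only:)
next
  case (Suc n)
  have "f - ((\<Sum>j<Suc n. cst (c ^ j) * (u ^ j * b)) + cst (c ^ Suc n) * (u ^ Suc n * f)) =
      (f - ((\<Sum>j<n. cst (c ^ j) * (u ^ j * b)) + cst (c ^ n) * (u ^ n * f))) +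
      cst (c ^ n) * (u ^ n * (f - b - cst c * (u * f)))"
    unfolding sum.lessThan_Suc by (simp add: fun_eq_iff algebra_simps)
  moreover have "\<dots> \<in> M"
    by (intro M_add Suc M_scale power_mult_M assms)
  ultimately show ?case by (simp only:)
qed

end

lemma sum_roots_of_unity_power:
  assumes "0 < j" "j < n"
  shows "(\<Sum>k<n. exp (2 * of_real pi * \<i> * of_nat k / of_nat n) ^ j) = 0"
proof -
  let ?w = "exp (2 * of_real pi * \<i> * of_nat j / of_nat n)"
  have "exp (2 * of_real pi * \<i> * of_nat k / of_nat n) ^ j = ?w ^ k" for k
    by (simp flip: exp_of_nat_mult add: mult_ac)
  hence "(\<Sum>k<n. exp (2 * of_real pi * \<i> * of_nat k / of_nat n) ^ j) = (\<Sum>k<n. ?w ^ k)" by simp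
  moreover have "?w \<noteq> 1" using assms by (subst complex_root_unity_eq_1) (auto dest: dvd_imp_le)
  moreover have "?w ^ n = 1" using assms by (intro complex_root_unity) auto
  ultimately show ?thesis by (simp add: geometric_sum)
qed

context maximal_modular_ideal
begin

text \<open>Averaging the resolvents \<open>r\<close> over the vertices of a regular \<open>n\<close>-gon around \<open>l0\<close> gives the resolvent
at the centre, up to the factor \<open>1 - u ^ n\<close> with \<open>u = \<mu> * r l0\<close>: in the expansions of the resolvents by
\<open>geometric_iterate\<close> the sums over roots of unity cancel all terms but the first and the remainder. This is an
algebraic substitute for the mean value property of holomorphic functions with values in the quotient.\<close>

lemma resolvent_mean_value:
  assumes a: "a \<in> X" and r: "\<And>l. r l \<in> X" "\<And>l. (a - cst l * e) * r l - e \<in> M"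
    and n: "n > 0"
  shows "real n * quot_norm (r l0) \<le> (1 + (cmod \<mu> * quot_norm (r l0)) ^ n) *
     (\<Sum>k<n. quot_norm (r (l0 + exp (2 * of_real pi * \<i> * of_nat k / of_nat n) * \<mu>)))"
proof -
  let ?c = "\<lambda>k. exp (2 * of_real pi * \<i> * of_nat k / of_nat n)"
  define b where "b = r l0"
  define f where "f k = r (l0 + ?c k * \<mu>)" for k
  define u where "u = cst \<mu> * b"
  have bX: "b \<in> X" and fX: "f k \<in> X" and uX: "u \<in> X" for k
    unfolding b_def f_def u_def by (intro scale_mem r)+
  have step: "f k - b - cst (?c k) * (u * f k) \<in> M" for k
  proof -
    define c where "c = ?c k"
    define p where "p = (a - cst l0 * e) * b - e"
    define p' where "p' = (a - cst (l0 + c * \<mu>) * e) * f k - e"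
    have pM: "p \<in> M" "p' \<in> M" unfolding p_def p'_def b_def f_def c_def by (rule r)+
    have "f k - b - cst c * (u * f k) =
        (b * p' - p * f k) - (e * f k - f k) + cst (c * \<mu>) * (e * (b * f k) - b * f k) + (e * b - b)"
      unfolding p_def p'_def u_def by (simp add: fun_eq_iff algebra_simps)
    moreover have "\<dots> \<in> M"
      by (intro M_add M_diff M_scale M_unit M_mult M_mult_left mult_mem pM bX fX)
    ultimately show ?thesis unfolding c_def by (simp only:)
  qed
  have cn: "?c k ^ n = 1" for k using n by (intro complex_root_unity) auto
  define S where "S = (\<Sum>k<n. f k)"
  have SX: "S \<in> X" unfolding S_def by (intro sum_mem fX)
  have "(\<Sum>k<n. f k - ((\<Sum>j<n. cst (?c k ^ j) * (u ^ j * b)) + cst (?c k ^ n) * (u ^ n * f k))) \<in> M"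
    by (intro M_sum geometric_iterate bX uX fX step)
  also have "(\<Sum>k<n. f k - ((\<Sum>j<n. cst (?c k ^ j) * (u ^ j * b)) + cst (?c k ^ n) * (u ^ n * f k))) =
      S - (cst (of_nat n) * b + u ^ n * S)"
  proof -
    have "(\<Sum>k<n. \<Sum>j<n. cst (?c k ^ j) * (u ^ j * b)) = (\<Sum>j<n. \<Sum>k<n. cst (?c k ^ j) * (u ^ j * b))"
      by (rule sum.swap)
    also have "\<dots> = (\<Sum>j<n. if j = 0 then cst (of_nat n) * b else 0)"
    proof (intro sum.cong refl)
      fix j assume j: "j \<in> {..<n}"
      have sm: "(sum g A) z = (\<Sum>k\<in>A. g k z)" for g :: "nat \<Rightarrow> circle \<Rightarrow> complex" and A z
        by (induction A rule: infinite_finite_induct) auto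
      have "(\<Sum>k<n. cst (?c k ^ j) * (u ^ j * b)) = cst (\<Sum>k<n. ?c k ^ j) * (u ^ j * b)"
        by (rule ext) (simp add: sm sum_distrib_right)
      also have "\<dots> = (if j = 0 then cst (of_nat n) * b else 0)"
        using j sum_roots_of_unity_power[of j n] by (auto simp: fun_eq_iff)
      finally show "(\<Sum>k<n. cst (?c k ^ j) * (u ^ j * b)) = (if j = 0 then cst (of_nat n) * b else 0)" .
    qed
    also have "\<dots> = cst (of_nat n) * b" using n by (simp add: sum.delta)
    finally have 1: "(\<Sum>k<n. \<Sum>j<n. cst (?c k ^ j) * (u ^ j * b)) = cst (of_nat n) * b" .
    have 2: "(\<Sum>k<n. cst (?c k ^ n) * (u ^ n * f k)) = u ^ n * S"
      unfolding cn S_def sum_distrib_left by (intro sum.cong refl) (simp add: fun_eq_iff)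
    show ?thesis unfolding sum_subtractf sum.distrib 1 2 S_def[symmetric] by simp
  qed
  finally have mem: "S - (cst (of_nat n) * b + u ^ n * S) \<in> M" .
  have sX: "S - u ^ n * S \<in> X" and nbX: "cst (of_nat n) * b \<in> X"
    by (intro diff_mem power_mult_mem scale_mem SX uX bX)+
  have "quot_norm b = quot_norm (cst (1 / of_nat n) * (cst (of_nat n) * b))"
    using n by (intro arg_cong[of _ _ quot_norm]) (simp add: fun_eq_iff)
  also have "\<dots> \<le> cmod (1 / of_nat n) * quot_norm (cst (of_nat n) * b)"
    by (intro quot_norm_scale_le nbX)
  finally have "real n * quot_norm b \<le> quot_norm (cst (of_nat n) * b)"
    using n by (simp add: norm_divide field_simps)
  also have "\<dots> \<le> quot_norm (S - u ^ n * S)"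
  proof (intro quot_norm_cong_le nbX sX)
    have "cst (of_nat n) * b - (S - u ^ n * S) = - (S - (cst (of_nat n) * b + u ^ n * S))"
      by (simp add: fun_eq_iff)
    thus "cst (of_nat n) * b - (S - u ^ n * S) \<in> M" using M_minus[OF mem] by (simp only:)
  qed
  also have "S - u ^ n * S = S + u ^ n * (- S)" by (simp add: fun_eq_iff)
  also have "quot_norm \<dots> \<le> quot_norm S + quot_norm (u ^ n * (- S))"
    by (intro quot_norm_add_le power_mult_mem uminus_mem SX uX)
  also have "quot_norm (u ^ n * (- S)) \<le> quot_norm u ^ n * quot_norm (- S)"
    by (intro quot_norm_power_mult_le uminus_mem SX uX)
  also have "\<dots> \<le> (cmod \<mu> * quot_norm b) ^ n * quot_norm S"
  proof (intro mult_mono power_mono)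
    show "quot_norm u \<le> cmod \<mu> * quot_norm b" unfolding u_def by (rule quot_norm_scale_le[OF bX])
    show "quot_norm (- S) \<le> quot_norm S" using quot_norm_scale_le[OF SX, of "-1"] by (simp add: uminus_eq_scale[symmetric])
  qed (auto intro!: quot_norm_nonneg zero_le_power mult_nonneg_nonneg uX bX uminus_mem SX)
  also have "quot_norm S + (cmod \<mu> * quot_norm b) ^ n * quot_norm S = (1 + (cmod \<mu> * quot_norm b) ^ n) * quot_norm S"
    by (simp add: algebra_simps)
  also have "\<dots> \<le> (1 + (cmod \<mu> * quot_norm b) ^ n) * (\<Sum>k<n. quot_norm (f k))"
    unfolding S_def
    by (intro mult_left_mono quot_norm_sum_le fX add_nonneg_nonneg zero_le_power mult_nonneg_nonneg
        quot_norm_nonneg bX) auto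
  finally show ?thesis by (simp add: b_def f_def)
qed

text \<open>Otherwise every \<open>a - l e\<close> is invertible modulo \<open>M\<close>, and the norm \<open>g\<close> of the resolvent is a
continuous function on the plane that tends to \<open>0\<close> at infinity. It attains its maximum; let \<open>l0\<close> be a
maximum point of largest real part. On a small circle around \<open>l0\<close>, an arc to the right of \<open>l0\<close>
stays strictly below the maximum, and this contradicts \<open>resolvent_mean_value\<close> for large \<open>n\<close>.\<close>

theorem gelfand_mazur:
  assumes a: "a \<in> X" obtains l where "a - cst l * e \<in> M"
proof (rule ccontr)
  assume "\<not> thesis"
  hence no: "a - cst l * e \<notin> M" for l using that by blast
  have aX: "a - cst l * e \<in> X" for l by (intro diff_mem scale_mem a e_mem)
  have "\<exists>w. w \<in> X \<and> (a - cst l * e) * w - e \<in> M" for l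
    using inverse_mod[OF aX no] by blast
  then obtain r where r: "\<And>l. r l \<in> X" "\<And>l. (a - cst l * e) * r l - e \<in> M" by metis
  define g where "g l = quot_norm (r l)" for l
  have g_nonneg: "0 \<le> g l" for l unfolding g_def by (intro quot_norm_nonneg r)
  have g_pos: "0 < g l" for l
  proof -
    have "1 \<le> quot_norm e" by (rule quot_norm_e)
    also have "\<dots> \<le> quot_norm ((a - cst l * e) * r l)"
    proof (intro quot_norm_cong_le e_mem mult_mem aX r)
      have "e - (a - cst l * e) * r l = - ((a - cst l * e) * r l - e)" by simp
      thus "e - (a - cst l * e) * r l \<in> M" using M_minus[OF r(2)[of l]] by (simp only:)
    qed
    also have "\<dots> \<le> quot_norm (a - cst l * e) * g l" unfolding g_def by (intro quot_norm_mult_le aX r)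
    finally have "g l \<noteq> 0" by auto
    with g_nonneg[of l] show ?thesis by simp
  qed
  have g_far: "g l \<le> quot_norm e / (cmod l - quot_norm a)" if "cmod l > quot_norm a" for l
  proof -
    have l: "l \<noteq> 0" using that quot_norm_nonneg[OF a] by auto
    have "cst l * r l - (a * r l - e) = - ((a - cst l * e) * r l - e) - cst l * (e * r l - r l)"
      by (simp add: fun_eq_iff algebra_simps)
    moreover have "\<dots> \<in> M" by (intro M_diff M_minus M_scale M_unit r)
    ultimately have mem: "cst l * r l - (a * r l - e) \<in> M" by (simp only:)
    have "g l = quot_norm (cst (1 / l) * (cst l * r l))"
      unfolding g_def using l by (intro arg_cong[of _ _ quot_norm]) (simp add: fun_eq_iff)
    also have "\<dots> \<le> cmod (1 / l) * quot_norm (cst l * r l)" by (intro quot_norm_scale_le scale_mem r)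
    finally have "cmod l * g l \<le> quot_norm (cst l * r l)" using l by (simp add: norm_divide field_simps)
    also have "\<dots> \<le> quot_norm (a * r l - e)"
      by (intro quot_norm_cong_le mem scale_mem diff_mem mult_mem a r e_mem)
    also have "a * r l - e = a * r l + cst (- 1) * e" by (simp add: fun_eq_iff)
    also have "quot_norm \<dots> \<le> quot_norm (a * r l) + quot_norm (cst (- 1) * e)"
      by (intro quot_norm_add_le mult_mem scale_mem a r e_mem)
    also have "\<dots> \<le> quot_norm a * g l + quot_norm e"
      unfolding g_def using quot_norm_scale_le[OF e_mem, of "-1"]
      by (intro add_mono quot_norm_mult_le a r) auto
    finally show ?thesis using that by (simp add: field_simps)
  qed
  have g_lip: "g l \<le> g m + cmod (l - m) * (g l * g m)" for l m
  proof -
    let ?p = "\<lambda>l. (a - cst l * e) * r l - e"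
    have "r l - (r m + cst (l - m) * (r l * r m)) =
        r m * ?p l - r l * ?p m + cst (l - m) * (e * (r l * r m) - r l * r m) - (e * r l - r l) + (e * r m - r m)"
      by (simp add: fun_eq_iff algebra_simps)
    moreover have "\<dots> \<in> M"
      by (intro M_add M_diff M_scale M_unit M_mult_left mult_mem r)
    ultimately have mem: "r l - (r m + cst (l - m) * (r l * r m)) \<in> M" by (simp only:)
    have "g l \<le> quot_norm (r m + cst (l - m) * (r l * r m))"
      unfolding g_def by (intro quot_norm_cong_le mem add_mem scale_mem mult_mem r)
    also have "\<dots> \<le> g m + quot_norm (cst (l - m) * (r l * r m))"
      unfolding g_def by (intro quot_norm_add_le scale_mem mult_mem r)
    also have "quot_norm (cst (l - m) * (r l * r m)) \<le> cmod (l - m) * quot_norm (r l * r m)"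
      by (intro quot_norm_scale_le mult_mem r)
    also have "\<dots> \<le> cmod (l - m) * (g l * g m)"
      unfolding g_def by (intro mult_left_mono quot_norm_mult_le r) auto
    finally show ?thesis by simp
  qed
  have g_cont: "continuous_on UNIV g"
  proof -
    have "(g \<longlongrightarrow> g m) (at m)" for m
    proof (rule LIM_zero_cancel, rule Lim_null_comparison)
      have lim: "((\<lambda>l. cmod (l - m) * (2 * g m * g m)) \<longlongrightarrow> cmod (m - m) * (2 * g m * g m)) (at m)"
        by (intro tendsto_intros)
      thus "((\<lambda>l. cmod (l - m) * (2 * g m * g m)) \<longlongrightarrow> 0) (at m)" by simp
      have "((\<lambda>l. cmod (l - m) * g m) \<longlongrightarrow> cmod (m - m) * g m) (at m)"
        by (intro tendsto_intros)
      hence "\<forall>\<^sub>F l in at m. cmod (l - m) * g m < 1 / 2" by (rule order_tendstoD) simp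
      thus "\<forall>\<^sub>F l in at m. norm (g l - g m) \<le> cmod (l - m) * (2 * g m * g m)"
      proof eventually_elim
        case (elim l)
        have "g l * (cmod (l - m) * g m) \<le> g l * (1 / 2)" using elim g_nonneg by (intro mult_left_mono) auto
        hence "g l \<le> 2 * g m" using g_lip[of l m] by (simp add: mult_ac)
        hence "cmod (l - m) * (g l * g m) \<le> cmod (l - m) * (2 * g m * g m)"
          using g_nonneg by (intro mult_left_mono mult_right_mono) auto
        moreover have "g m \<le> g l + cmod (l - m) * (g l * g m)"
          using g_lip[of m l] by (simp add: norm_minus_commute mult.commute)
        ultimately show ?case using g_lip[of l m] by (simp add: abs_le_iff)
      qed
    qed
    thus ?thesis by (simp add: continuous_on_eq_continuous_at isCont_def)
  qed
  define R where "R = quot_norm a + quot_norm e / g 0 + 1"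
  have qe: "quot_norm e / g 0 > 0" using quot_norm_e g_pos[of 0] by simp
  have far: "g l < g 0" if "cmod l > R" for l
  proof -
    have *: "cmod l - quot_norm a > quot_norm e / g 0" using that unfolding R_def by simp
    hence "g l \<le> quot_norm e / (cmod l - quot_norm a)" using qe by (intro g_far) simp
    also have "\<dots> < quot_norm e / (quot_norm e / g 0)"
      using quot_norm_e by (intro divide_strict_left_mono mult_pos_pos qe *) (use * qe in linarith)+
    also have "\<dots> = g 0" using quot_norm_e by simp
    finally show ?thesis .
  qed
  have R0: "R \<ge> 0" using qe quot_norm_nonneg[OF a] unfolding R_def by simp
  have "\<exists>k\<in>cball 0 R. \<forall>l\<in>cball 0 R. g l \<le> g k"
    using R0 by (intro continuous_attains_sup continuous_on_subset[OF g_cont]) auto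
  then obtain k where k: "\<And>l. l \<in> cball 0 R \<Longrightarrow> g l \<le> g k" by blast
  have max: "g l \<le> g k" for l
    using k[of l] k[of 0] far[of l] R0 by (cases "cmod l \<le> R") auto
  define S where "S = {l. g l = g k}"
  have "cmod l \<le> R" if "l \<in> S" for l
  proof (rule ccontr)
    assume "\<not> cmod l \<le> R"
    hence "g l < g 0" by (intro far) simp
    thus False using max[of 0] that by (simp add: S_def)
  qed
  hence "bounded S" unfolding bounded_iff by blast
  moreover have "closed S"
    unfolding S_def using continuous_closed_preimage_constant[OF g_cont closed_UNIV, of "g k"] by simp
  ultimately have "compact S" by (simp add: compact_eq_bounded_closed)
  moreover have "k \<in> S" by (simp add: S_def)
  moreover have "continuous_on S Re" by (intro continuous_intros)
  ultimately obtain l0 where l0: "l0 \<in> S" "\<And>l. l \<in> S \<Longrightarrow> Re l \<le> Re l0"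
    using continuous_attains_sup[of S Re] by blast
  have g0: "g l0 = g k" using l0(1) by (simp add: S_def)
  \<comment> \<open>With this radius the error factor in the mean value inequality is \<open>(1 / 2) ^ n\<close>.\<close>
  define \<rho> where "\<rho> = 1 / (2 * g k)"
  have rho: "\<rho> > 0" using g_pos[of k] by (simp add: \<rho>_def)
  have "continuous_on {0..1} (\<lambda>t. g (l0 + of_real \<rho> * cis t))"
    by (intro continuous_on_compose2[OF g_cont] continuous_intros) auto
  hence "\<exists>t0\<in>{0..1}. \<forall>t\<in>{0..1}. g (l0 + of_real \<rho> * cis t) \<le> g (l0 + of_real \<rho> * cis t0)"
    by (intro continuous_attains_sup) auto
  then obtain t0 where t0: "t0 \<in> {0..1}" "\<And>t. t \<in> {0..1} \<Longrightarrow> g (l0 + of_real \<rho> * cis t) \<le> g (l0 + of_real \<rho> * cis t0)"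
    by blast
  define m where "m = g (l0 + of_real \<rho> * cis t0)"
  have "m < g k"
  proof -
    have "cos t0 > 0" using t0(1) pi_gt3 by (intro cos_gt_zero_pi) auto
    hence "\<rho> * cos t0 > 0" using rho by simp
    hence "l0 + of_real \<rho> * cis t0 \<notin> S" using l0(2)[of "l0 + of_real \<rho> * cis t0"] by auto
    thus ?thesis using max[of "l0 + of_real \<rho> * cis t0"] by (simp add: S_def m_def)
  qed
  \<comment> \<open>Since \<open>2 * pi < 7\<close>, the first \<open>j\<close> of \<open>7 * j\<close> equidistant points lie on the arc of length \<open>1\<close>
    on which \<open>g\<close> is at most \<open>m\<close>.\<close>
  have ineq: "7 * g k \<le> (1 + (1 / 2) ^ (7 * j)) * (m + 6 * g k)" if j: "j > 0" for j
  proof -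
    let ?c = "\<lambda>i. exp (2 * of_real pi * \<i> * of_nat i / of_nat (7 * j)) * of_real \<rho>"
    have "(\<Sum>i<7 * j. g (l0 + ?c i)) \<le> (\<Sum>i<7 * j. if i < j then m else g k)"
    proof (intro sum_mono)
      fix i show "g (l0 + ?c i) \<le> (if i < j then m else g k)"
      proof (cases "i < j")
        case True
        let ?t = "2 * pi * real i / real (7 * j)"
        have "?t \<le> 1"
        proof -
          have "2 * pi * real i \<le> 7 * real j" using True pi_less_4 pi_approx by (intro mult_mono) auto
          thus ?thesis using j by simp
        qed
        hence "g (l0 + of_real \<rho> * cis ?t) \<le> m" using t0(2)[of ?t] by (simp add: m_def)
        moreover have "?c i = of_real \<rho> * cis ?t"
          by (simp add: cis_conv_exp mult_ac)
        ultimately show ?thesis using True by (simp only: if_True)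
      qed (simp add: max)
    qed
    also have "\<dots> = real j * (m + 6 * g k)"
    proof -
      have "{..<7 * j} \<inter> {i. i < j} = {..<j}" "{..<7 * j} \<inter> - {i. i < j} = {j..<7 * j}" by auto
      thus ?thesis by (simp add: sum.If_cases algebra_simps of_nat_diff)
    qed
    finally have le: "(\<Sum>i<7 * j. g (l0 + ?c i)) \<le> real j * (m + 6 * g k)" .
    have half: "cmod (of_real \<rho>) * g l0 = 1 / 2" 
      using g_pos[of k] by (simp only: g0 norm_of_real abs_of_pos[OF rho]) (simp add: \<rho>_def)
    have "real (7 * j) * g l0 \<le> (1 + (cmod (of_real \<rho>) * g l0) ^ (7 * j)) * (\<Sum>i<7 * j. g (l0 + ?c i))"
      using resolvent_mean_value[OF a r, of "7 * j" l0 "of_real \<rho>"] j unfolding g_def by simp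
    also have "\<dots> \<le> (1 + (1 / 2) ^ (7 * j)) * (real j * (m + 6 * g k))"
      unfolding half using le by (intro mult_left_mono) auto
    finally have "real j * (7 * g k) \<le> real j * ((1 + (1 / 2) ^ (7 * j)) * (m + 6 * g k))"
      by (simp add: g0 algebra_simps)
    thus ?thesis using j by simp
  qed
  have "(\<lambda>j. (1 + ((1 / 2 :: real) ^ 7) ^ j) * (m + 6 * g k)) \<longlonglongrightarrow> (1 + 0) * (m + 6 * g k)"
    by (intro tendsto_intros LIMSEQ_power_zero) (simp add: power_one_over)
  hence "7 * g k \<le> (1 + 0) * (m + 6 * g k)"
    by (rule LIMSEQ_le_const) (use ineq in \<open>auto simp: power_mult intro!: exI[of _ 1]\<close>)
  thus False using \<open>m < g k\<close> by simp
qed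


lemma cst_mult_e_notin: "l \<noteq> 0 \<Longrightarrow> cst l * e \<notin> M"
proof
  assume "l \<noteq> 0" "cst l * e \<in> M"
  from M_scale[OF this(2), of "1 / l"] have "cst (1 / l) * (cst l * e) \<in> M" .
  also have "cst (1 / l) * (cst l * e) = e" using \<open>l \<noteq> 0\<close> by (simp add: fun_eq_iff)
  finally show False using e_notin by simp
qed

text \<open>The functional sends \<open>a\<close> to the number \<open>l\<close> with \<open>a - l e\<close> in \<open>M\<close>.\<close>

lemma multiplicative_functional_mod_ideal:
  obtains \<phi> where "multiplicative_functional X \<phi>" "\<phi> e = 1"
proof -
  have "\<exists>l. a - cst l * e \<in> M" if "a \<in> X" for a using gelfand_mazur[OF that] by blast
  then obtain \<phi> where \<phi>: "\<And>a. a \<in> X \<Longrightarrow> a - cst (\<phi> a) * e \<in> M" by metis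
  have unique: "\<phi> a = l" if "a \<in> X" "a - cst l * e \<in> M" for a l
  proof (rule ccontr)
    assume "\<phi> a \<noteq> l"
    have "cst (\<phi> a - l) * e = (a - cst l * e) - (a - cst (\<phi> a) * e)" by (simp add: fun_eq_iff algebra_simps)
    moreover have "\<dots> \<in> M" by (intro M_diff \<phi> that)
    ultimately show False using cst_mult_e_notin[of "\<phi> a - l"] \<open>\<phi> a \<noteq> l\<close> by simp
  qed
  have "\<phi> e = 1"
  proof (rule unique[OF e_mem])
    have "e - cst 1 * e = 0" by (simp add: fun_eq_iff)
    thus "e - cst 1 * e \<in> M" using M_zero by (simp only:)
  qed
  moreover have "multiplicative_functional X \<phi>"
    unfolding multiplicative_functional_def
  proof (intro conjI ballI allI)
    fix f g assume fg: "f \<in> X" "g \<in> X"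
    have "f + g - cst (\<phi> f + \<phi> g) * e = (f - cst (\<phi> f) * e) + (g - cst (\<phi> g) * e)"
      by (simp add: fun_eq_iff algebra_simps)
    moreover have "\<dots> \<in> M" by (intro M_add \<phi> fg)
    ultimately have "\<phi> (f + g) = \<phi> f + \<phi> g" by (intro unique add_mem fg) (simp only:)
    thus "\<phi> (\<lambda>z. f z + g z) = \<phi> f + \<phi> g" by (simp add: plus_fun_def)
    have "f * g - cst (\<phi> f * \<phi> g) * e =
        (f - cst (\<phi> f) * e) * g + cst (\<phi> f) * (e * g - g) + cst (\<phi> f) * (g - cst (\<phi> g) * e)"
      by (simp add: fun_eq_iff algebra_simps)
    moreover have "\<dots> \<in> M" by (intro M_add M_mult M_scale M_unit \<phi> fg)
    ultimately have "\<phi> (f * g) = \<phi> f * \<phi> g" by (intro unique mult_mem fg) (simp only:)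
    thus "\<phi> (\<lambda>z. f z * g z) = \<phi> f * \<phi> g" by (simp add: times_fun_def)
  next
    fix c f assume f: "f \<in> X"
    have "cst c * f - cst (c * \<phi> f) * e = cst c * (f - cst (\<phi> f) * e)"
      by (simp add: fun_eq_iff algebra_simps)
    moreover have "\<dots> \<in> M" by (intro M_scale \<phi> f)
    ultimately have "\<phi> (cst c * f) = c * \<phi> f" by (intro unique scale_mem f) (simp only:)
    thus "\<phi> (\<lambda>z. c * f z) = c * \<phi> f" by (simp add: times_fun_def)
  next
    show "\<exists>f\<in>X. \<phi> f \<noteq> 0" using e_mem \<open>\<phi> e = 1\<close> by (intro bexI[of _ e]) auto
  qed
  ultimately show ?thesis using that by blast
qed

end

context continuous_function_algebra
begin

lemma modular_ideal_Union_chain: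
  assumes ne: "C \<noteq> {}" and chain: "subset.chain {I. modular_ideal e I} C"
  shows "modular_ideal e (\<Union>C)"
proof -
  have I: "modular_ideal e I" if "I \<in> C" for I using chain that by (auto simp: subset.chain_def)
  have up: "\<exists>I\<in>C. a \<in> I \<and> b \<in> I" if "a \<in> \<Union>C" "b \<in> \<Union>C" for a b
    using chain that unfolding subset.chain_def by blast
  show ?thesis
    unfolding modular_ideal_def
  proof (intro conjI ballI allI)
    show "\<Union>C \<subseteq> X" using I unfolding modular_ideal_def by blast
    show "0 \<in> \<Union>C" using I ne unfolding modular_ideal_def by blast
    show "e \<notin> \<Union>C" using I unfolding modular_ideal_def by blast
  next
    fix a b assume "a \<in> \<Union>C" "b \<in> \<Union>C"
    then obtain J where "J \<in> C" "a \<in> J" "b \<in> J" using up by blast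
    thus "a + b \<in> \<Union>C" using I[of J] unfolding modular_ideal_def by blast
  next
    fix c a assume "a \<in> \<Union>C"
    thus "cst c * a \<in> \<Union>C" using I unfolding modular_ideal_def by blast
  next
    fix a x assume "a \<in> \<Union>C" "x \<in> X"
    thus "a * x \<in> \<Union>C" using I unfolding modular_ideal_def by blast
  next
    fix x assume "x \<in> X"
    thus "e * x - x \<in> \<Union>C" using I ne unfolding modular_ideal_def by blast
  qed
qed

text \<open>If \<open>e\<close> had no quasi-inverse, the elements \<open>w - e w\<close> would form a modular ideal for \<open>e\<close>. By Zorn's
lemma it lies in a maximal one, which gives a multiplicative functional with value \<open>1\<close> at \<open>e\<close>. But such a
functional is evaluation at a point, where \<open>e\<close> does not take the value \<open>1\<close>.\<close>

theorem quasi_inverse: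
  assumes chars: "\<forall>\<phi>. multiplicative_functional X \<phi> \<longrightarrow> (\<exists>\<zeta>. \<forall>f\<in>X. \<phi> f = f \<zeta>)"
    and e: "e \<in> X" "\<And>z. e z \<noteq> 1"
  obtains y where "y \<in> X" "(1 - e) * (1 - y) = 1"
proof (rule ccontr)
  assume "\<not> thesis"
  note found = that
  have no: "(1 - e) * (1 - y) \<noteq> 1" if "y \<in> X" for y
    using found[OF that] \<open>\<not> thesis\<close> by blast
  define J where "J = (\<lambda>w. w - e * w) ` X"
  have J: "w - e * w \<in> J" if "w \<in> X" for w unfolding J_def using that by blast
  have "modular_ideal e J"
    unfolding modular_ideal_def
  proof (intro conjI ballI allI)
    show "J \<subseteq> X" unfolding J_def using e(1) by (auto intro!: diff_mem mult_mem)
    show "0 \<in> J" using J[OF zero_mem] by simp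
    show "e \<notin> J"
    proof
      assume "e \<in> J"
      then obtain w where w: "w \<in> X" "e = w - e * w" unfolding J_def by blast
      have "(1 - e) * (1 - - w) = 1 + (w - e * w) - e" by (simp add: fun_eq_iff algebra_simps)
      also have "\<dots> = 1" using w(2) by simp
      finally show False using no[OF uminus_mem[OF w(1)]] by simp
    qed
  next
    fix a b assume "a \<in> J" "b \<in> J"
    then obtain w v where wv: "w \<in> X" "v \<in> X" "a = w - e * w" "b = v - e * v" unfolding J_def by blast
    have "a + b = (w + v) - e * (w + v)" unfolding wv by (simp add: fun_eq_iff algebra_simps)
    thus "a + b \<in> J" using J[OF add_mem[OF wv(1,2)]] by simp
  next
    fix c a assume "a \<in> J"
    then obtain w where w: "w \<in> X" "a = w - e * w" unfolding J_def by blast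
    have "cst c * a = cst c * w - e * (cst c * w)" unfolding w by (simp add: fun_eq_iff algebra_simps)
    thus "cst c * a \<in> J" using J[OF scale_mem[OF w(1)]] by simp
  next
    fix a x assume "a \<in> J" "x \<in> X"
    then obtain w where w: "w \<in> X" "a = w - e * w" unfolding J_def by blast
    have "a * x = w * x - e * (w * x)" unfolding w by (simp add: fun_eq_iff algebra_simps)
    thus "a * x \<in> J" using J[OF mult_mem[OF w(1) \<open>x \<in> X\<close>]] by simp
  next
    fix x assume "x \<in> X"
    have "e * x - x = - x - e * (- x)" by simp
    thus "e * x - x \<in> J" using J[OF uminus_mem[OF \<open>x \<in> X\<close>]] by simp
  qed
  hence "{I. modular_ideal e I} \<noteq> {}" by blast
  moreover have "\<Union>C \<in> {I. modular_ideal e I}" if "C \<noteq> {}" "subset.chain {I. modular_ideal e I} C" for C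
    using modular_ideal_Union_chain[OF that] by simp
  ultimately have "\<exists>M\<in>{I. modular_ideal e I}. \<forall>I\<in>{I. modular_ideal e I}. M \<subseteq> I \<longrightarrow> I = M"
    by (rule subset_Zorn_nonempty)
  then obtain M where M: "modular_ideal e M" "\<And>I. modular_ideal e I \<Longrightarrow> M \<subseteq> I \<Longrightarrow> I = M" by blast
  interpret maximal_modular_ideal X N e M by unfold_locales (use e M in auto)
  obtain \<phi> where "multiplicative_functional X \<phi>" "\<phi> e = 1" by (rule multiplicative_functional_mod_ideal)
  with chars e show False by metis
qed

text \<open>For \<open>|k| > N F\<close> the logarithm of \<open>1 - F / k\<close> is a power series in \<open>F\<close>. Having a logarithm in the
algebra is a locally constant property of \<open>l\<close> on \<open>C\<close>: by \<open>quasi_inverse\<close> the quotient of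
\<open>1 - F / l\<close> by \<open>1 - F / m\<close> is \<open>1 - x\<close> with \<open>x\<close> in the algebra, and \<open>x\<close> is small for \<open>l\<close> near \<open>m\<close>.
If the algebra has no unit, then \<open>0\<close> lies in the spectrum of \<open>F\<close> as an element of the unitisation;
therefore \<open>C\<close> has to avoid \<open>0\<close>.\<close>

theorem logarithm_on_connected_set:
  assumes chars: "\<forall>\<phi>. multiplicative_functional X \<phi> \<longrightarrow> (\<exists>\<zeta>. \<forall>f\<in>X. \<phi> f = f \<zeta>)"
    and F: "F \<in> X" and C: "connected C" "0 \<notin> C" "\<And>l z. l \<in> C \<Longrightarrow> F z \<noteq> l"
    and c: "c \<in> C" and k: "k \<in> C" "N F < cmod k"
  obtains g where "g \<in> X" "\<And>z. 1 - F z / c = exp (g z)"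
proof -
  define P where "P l \<longleftrightarrow> (\<exists>g\<in>X. \<forall>z. 1 - F z / l = exp (g z))" for l
  have "P k"
  proof -
    have k0: "k \<noteq> 0" using C k by auto
    have "N (cst (1 / k) * F) = cmod (1 / k) * N F" by (rule N_scale[OF F])
    also have "\<dots> < 1" using k k0 by (simp add: norm_divide field_simps)
    finally obtain g where "g \<in> X" "\<And>z. 1 - (cst (1 / k) * F) z = exp (g z)"
      using log_one_minus_small[OF scale_mem[OF F]] by blast
    thus ?thesis unfolding P_def by auto
  qed
  moreover have "P c = P k"
  proof (rule connected_local_const[OF C(1) c k(1)], rule ballI)
    fix m assume m: "m \<in> C"
    hence m0: "m \<noteq> 0" using C by auto
    have "(cst (1 / m) * F) z \<noteq> 1" for z using C(3)[OF m, of z] m0 by (simp add: field_simps)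
    then obtain y where y: "y \<in> X" "(1 - cst (1 / m) * F) * (1 - y) = 1"
      using quasi_inverse[OF chars scale_mem[OF F]] by blast
    have yz: "(1 - F z / m) * (1 - y z) = 1" for z using fun_cong[OF y(2), of z] by simp
    define G where "G = F - F * y"
    have GX: "G \<in> X" unfolding G_def by (intro diff_mem mult_mem F y)
    have "((\<lambda>l. cmod (1 / l - 1 / m) * N G) \<longlongrightarrow> cmod (1 / m - 1 / m) * N G) (at m within C)"
      using m0 by (intro tendsto_intros)
    hence "\<forall>\<^sub>F l in at m within C. cmod (1 / l - 1 / m) * N G < 1"
      by (rule order_tendstoD) simp
    moreover have "\<forall>\<^sub>F l in at m within C. l \<in> C"
      by (simp add: eventually_at_filter)
    ultimately show "\<forall>\<^sub>F l in at m within C. P m = P l"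
    proof eventually_elim
      case (elim l)
      have l0: "l \<noteq> 0" using elim C by auto
      have "N (cst (1 / l - 1 / m) * G) < 1" using elim by (simp only: N_scale[OF GX])
      then obtain h where h: "h \<in> X" "\<And>z. 1 - (cst (1 / l - 1 / m) * G) z = exp (h z)"
        using log_one_minus_small[OF scale_mem[OF GX]] by blast
      have fac: "1 - F z / l = (1 - F z / m) * exp (h z)" for z
      proof -
        have "1 - (1 / l - 1 / m) * (F z - F z * y z) = (1 - F z / l) * (1 - y z)"
        proof -
          have "1 - (1 / l - 1 / m) * (F z - F z * y z) =
              (1 - F z / l) * (1 - y z) + (1 - (1 - F z / m) * (1 - y z))"
            by (simp add: divide_inverse algebra_simps)
          thus ?thesis unfolding yz by simp
        qed
        hence "(1 - F z / m) * exp (h z) = (1 - F z / l) * ((1 - F z / m) * (1 - y z))"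
          unfolding h(2)[symmetric] by (simp add: G_def)
        thus ?thesis unfolding yz by simp
      qed
      show "P m = P l"
      proof
        assume "P m"
        then obtain g where "g \<in> X" "\<And>z. 1 - F z / m = exp (g z)" unfolding P_def by blast
        thus "P l" unfolding P_def using h(1) fac
          by (intro bexI[of _ "g + h"] add_mem) (auto simp: exp_add)
      next
        assume "P l"
        then obtain g where "g \<in> X" "\<And>z. 1 - F z / l = exp (g z)" unfolding P_def by blast
        thus "P m" unfolding P_def using h(1) fac
          by (intro bexI[of _ "g - h"] diff_mem) (auto simp: exp_diff field_simps)
      qed
    qed
  qed
  ultimately show ?thesis using that unfolding P_def by blast
qed

end

section \<open>Wiener-Hopf factorisation\<close>

lemma closure_range_similar:
  fixes S S' D :: "'a::{complex_banach,perfect_space} cop"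
  assumes S: "S * S' = 1" "S' * S = 1" and D: "closure (range (cop_apply D)) = UNIV"
  shows "closure (range (cop_apply (S' * D * S))) = UNIV"
proof -
  have inv: "cop_apply S (cop_apply S' x) = x" "cop_apply S' (cop_apply S x) = x" for x
    using arg_cong[OF S(1), of "\<lambda>B. cop_apply B x"] arg_cong[OF S(2), of "\<lambda>B. cop_apply B x"] by simp_all
  have "UNIV = cop_apply S' ` closure (range (cop_apply D))"
    unfolding D using inv(2) by (metis surjI)
  also have "\<dots> \<subseteq> closure (cop_apply S' ` range (cop_apply D))"
    using bounded_clinear_cop_apply[of S']
    by (intro continuous_image_closure_subset[of UNIV] linear_continuous_on) (auto simp: bounded_clinear_def)
  also have "cop_apply S' ` range (cop_apply D) \<subseteq> range (cop_apply (S' * D * S))"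
  proof safe
    fix x
    have "cop_apply S' (cop_apply D x) = cop_apply (S' * D * S) (cop_apply S' x)" by (simp add: inv)
    thus "cop_apply S' (cop_apply D x) \<in> range (cop_apply (S' * D * S))" by blast
  qed
  hence "closure (cop_apply S' ` range (cop_apply D)) \<subseteq> closure (range (cop_apply (S' * D * S)))"
    by (rule closure_mono)
  finally show ?thesis by blast
qed

lemma power_similar:
  fixes S S' V :: "'a::real_normed_algebra_1"
  assumes "S * S' = 1" "S' * S = 1" shows "(S' * V * S) ^ n = S' * V ^ n * S"
proof (induction n)
  case (Suc n)
  have "(S' * V * S) ^ Suc n = (S' * V * S) * (S' * V ^ n * S)" by (simp only: power_Suc Suc)
  also have "\<dots> = S' * V * (S * S') * V ^ n * S" by (simp only: mult.assoc)
  also have "\<dots> = S' * V ^ Suc n * S" by (simp add: assms mult.assoc)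
  finally show ?case .
qed (simp add: assms)

text \<open>With \<open>S = T\<^sub>a\<close> and \<open>B = T\<^sub>b\<close> for \<open>a = e\<^sup>u\<close> and \<open>b = e\<^sup>v\<close>, the operator \<open>T\<^sub>F - c\<close> is \<open>- c B S\<close>. The operator
\<open>W = S\<^sup>-\<^sup>1 B\<^sup>-\<^sup>1\<close> is conjugated by \<open>S\<close> into \<open>V = B\<^sup>-\<^sup>1 S\<^sup>-\<^sup>1\<close>. This order of the factors matters: with
the co-analytic one on the left, the product is the Toeplitz operator of the product symbol \<open>G\<close>.\<close>

theorem C0_embeddable_of_wiener_hopf:
  assumes F: "continuous_on UNIV F" and c: "c \<noteq> 0" "\<And>z. cmod c \<le> cmod (F z - c)"
    and pow: "has_powers_at (toeplitz_cop F) c"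
    and u: "analytic_symbol u" and v: "analytic_symbol (\<lambda>z. cnj (v z))"
    and fac: "\<And>z. 1 - F z / c = exp (u z + v z)" and nz: "F \<zeta> \<noteq> 0"
  shows "C0_embeddable (toeplitz F)"
proof -
  let ?T = toeplitz_cop
  have Fb: "bounded_measurable F" by (rule bounded_measurable_continuous[OF F])
  have u': "analytic_symbol (\<lambda>z. - u z)" by (rule analytic_symbol_uminus[OF u])
  have v': "analytic_symbol (\<lambda>z. cnj (- v z))" using analytic_symbol_uminus[OF v] by simp
  have exp_co: "analytic_symbol (\<lambda>z. cnj (exp (w z)))" if "analytic_symbol (\<lambda>z. cnj (w z))" for w
    using analytic_symbol_exp[OF that] by (simp add: exp_cnj)
  note ea = analytic_symbol_exp[OF u] analytic_symbol_exp[OF u'] and eb = exp_co[OF v] exp_co[OF v']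
  note ba = ea[THEN analytic_symbol_bm]
  have bb: "bounded_measurable (\<lambda>z. exp (v z))" "bounded_measurable (\<lambda>z. exp (- v z))"
    using eb[THEN analytic_symbol_bm, THEN bounded_measurable_cnj] by simp_all
  have one: "?T (\<lambda>_. 1) = 1" by (simp add: toeplitz_cop_const)
  define S where "S = ?T (\<lambda>z. exp (u z))"
  define S' where "S' = ?T (\<lambda>z. exp (- u z))"
  define B where "B = ?T (\<lambda>z. exp (v z))"
  define B' where "B' = ?T (\<lambda>z. exp (- v z))"
  have SS: "S * S' = 1" "S' * S = 1"
    unfolding S_def S'_def using toeplitz_cop_mult_analytic[OF ba(1) ea(2)] toeplitz_cop_mult_analytic[OF ba(2) ea(1)]
    by (simp_all add: one flip: exp_add)
  have BB: "B * B' = 1" "B' * B = 1"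
    unfolding B_def B'_def using toeplitz_cop_coanalytic_mult[OF bb(2) eb(1)] toeplitz_cop_coanalytic_mult[OF bb(1) eb(2)]
    by (simp_all add: one flip: exp_add)
  \<comment> \<open>The inverses of \<open>S\<close> and \<open>B\<close> in the opposite order give a Toeplitz operator.\<close>
  define V where "V = B' * S'"
  define G where "G z = exp (- v z) * exp (- u z)" for z
  have V: "V = ?T G"
    unfolding V_def B'_def S'_def G_def[abs_def] by (rule toeplitz_cop_mult_analytic[OF bb(2) ea(2), symmetric])
  have Geq: "G z = inverse (1 - F z / c)" for z
    unfolding fac G_def by (simp add: exp_minus exp_add)
  have AF: "?T F - scalar_cop c = scalar_cop (- c) * (B * S)"
  proof -
    have "F z = c + (- c) * (exp (v z) * exp (u z))" for z
    proof -
      have "F z = c - c * (1 - F z / c)" using c(1) by (simp add: field_simps)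
      also have "\<dots> = c + (- c) * (exp (v z) * exp (u z))" unfolding fac by (simp add: exp_add mult.commute)
      finally show ?thesis .
    qed
    hence "?T F = ?T (\<lambda>z. c + (- c) * (exp (v z) * exp (u z)))" by presburger
    also have "\<dots> = ?T (\<lambda>_. c) + ?T (\<lambda>z. (- c) * (exp (v z) * exp (u z)))"
      by (intro toeplitz_cop_add bounded_measurable_const bounded_measurable_mult bb ba)
    also have "?T (\<lambda>z. (- c) * (exp (v z) * exp (u z))) = ?T (\<lambda>_. - c) * ?T (\<lambda>z. exp (v z) * exp (u z))"
      by (rule toeplitz_cop_coanalytic_mult) (intro bounded_measurable_mult bb ba analytic_symbol_const)+
    also have "?T (\<lambda>z. exp (v z) * exp (u z)) = B * S"
      unfolding B_def S_def by (rule toeplitz_cop_mult_analytic[OF bb(1) ea(1)])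
    finally show ?thesis by (simp add: toeplitz_cop_const)
  qed
  define R where "R = scalar_cop (- 1 / c) * (S' * B')"
  have cc: "scalar_cop (- 1 / c) * scalar_cop (- c) = (1 :: H2 cop)" "scalar_cop (- c) * scalar_cop (- 1 / c) = (1 :: H2 cop)"
    using c(1) by (simp_all add: scalar_cop_mult)
  have R1: "R * (?T F - scalar_cop c) = 1"
  proof -
    have "R * (?T F - scalar_cop c) = scalar_cop (- 1 / c) * ((S' * B') * scalar_cop (- c)) * (B * S)"
      unfolding AF R_def by (simp only: mult.assoc)
    also have "(S' * B') * scalar_cop (- c) = scalar_cop (- c) * (S' * B')" by (rule scalar_cop_commute)
    also have "scalar_cop (- 1 / c) * (scalar_cop (- c) * (S' * B')) * (B * S) =
        (scalar_cop (- 1 / c) * scalar_cop (- c)) * (S' * (B' * B) * S)" by (simp only: mult.assoc)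
    also have "\<dots> = 1" unfolding cc BB by (simp add: SS)
    finally show ?thesis .
  qed
  have R2: "(?T F - scalar_cop c) * R = 1"
  proof -
    have "(?T F - scalar_cop c) * R = scalar_cop (- c) * ((B * S) * scalar_cop (- 1 / c)) * (S' * B')"
      unfolding AF R_def by (simp only: mult.assoc)
    also have "(B * S) * scalar_cop (- 1 / c) = scalar_cop (- 1 / c) * (B * S)" by (rule scalar_cop_commute)
    also have "scalar_cop (- c) * (scalar_cop (- 1 / c) * (B * S)) * (S' * B') =
        (scalar_cop (- c) * scalar_cop (- 1 / c)) * (B * (S * S') * B')" by (simp only: mult.assoc)
    also have "\<dots> = 1" unfolding cc SS by (simp add: BB)
    finally show ?thesis .
  qed
  have W: "S' * V * S = - (scalar_cop c * R)"
  proof -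
    have "- (scalar_cop c * R) = scalar_cop (- c) * scalar_cop (- 1 / c) * (S' * B')"
      unfolding R_def scalar_cop_minus by (simp only: mult.assoc mult_minus_left)
    also have "\<dots> = S' * B'" by (simp only: cc mult_1_left)
    also have "\<dots> = S' * B' * (S' * S)" by (simp only: SS mult_1_right)
    also have "\<dots> = S' * V * S" by (simp only: V_def mult.assoc)
    finally show ?thesis by simp
  qed
  have Gm: "G \<in> borel_measurable borel"
    using bounded_measurable_measurable[OF bounded_measurable_mult[OF bb(2) ba(2)]] by (simp add: G_def[abs_def])
  have G1: "cmod (G z) \<le> 1" for z
  proof -
    have "cmod (1 - F z / c) = cmod (F z - c) / cmod c"
    proof -
      have "1 - F z / c = (c - F z) / c" using c(1) by (simp add: field_simps)
      thus ?thesis by (simp add: norm_divide norm_minus_commute)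
    qed
    hence "cmod (1 - F z / c) \<ge> 1" using c by (simp add: le_divide_eq)
    thus ?thesis unfolding Geq norm_inverse using le_imp_inverse_le[of 1] by fastforce
  qed
  have "norm V \<le> 1" unfolding V by (rule norm_toeplitz_cop_le[OF Gm G1])
  have bound: "norm ((S' * V * S) ^ n) \<le> norm S' * norm S" for n
  proof -
    have "norm (V ^ n) \<le> 1"
      using norm_power_ineq[of V n] power_le_one[OF norm_ge_zero \<open>norm V \<le> 1\<close>, of n] by simp
    have "norm (S' * V ^ n * S) \<le> norm (S' * V ^ n) * norm S" by (rule norm_mult_ineq)
    also have "\<dots> \<le> (norm S' * norm (V ^ n)) * norm S" by (intro mult_right_mono norm_mult_ineq) simp
    also have "\<dots> \<le> (norm S' * 1) * norm S"
      using \<open>norm (V ^ n) \<le> 1\<close> by (intro mult_right_mono mult_left_mono) auto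
    finally show ?thesis unfolding power_similar[OF SS] by simp
  qed
  have "open {z. F z \<noteq> 0}" by (intro open_Collect_neq F continuous_on_const)
  hence "emeasure circle_measure {z. F z \<noteq> 0} > 0" using nz by (intro emeasure_circle_open_pos[of _ \<zeta>]) auto
  moreover have "{z. F z \<noteq> 0} = {z. G z \<noteq> 1}" unfolding Geq using c(1) by auto
  ultimately have "closure (range (cop_apply (1 - V))) = UNIV"
    unfolding V by (intro dense_range_one_minus_toeplitz Gm G1) simp
  hence "closure (range (cop_apply (S' * (1 - V) * S))) = UNIV" by (rule closure_range_similar[OF SS])
  also have "S' * (1 - V) * S = 1 - S' * V * S" by (simp add: left_diff_distrib right_diff_distrib SS)
  finally have "closure (range (cop_apply (1 - S' * V * S))) = UNIV" .
  from C0_embeddable_of_power_bounded[OF pow R1 R2 W bound this]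
  show ?thesis by (simp add: cop_apply_toeplitz[OF Fb])
qed

theorem theorem8p15:
  fixes X :: "(circle \<Rightarrow> complex) set"
    and N :: "(circle \<Rightarrow> complex) \<Rightarrow> real"
    and F :: "circle \<Rightarrow> complex"
  assumes "banach_function_algebra X N"
    and "cont_embedded_in_C X N"
    and "\<forall>f\<in>X. ess_bounded (riesz_proj (abs_L2 f))"
    and "\<forall>\<phi>. multiplicative_functional X \<phi> \<longrightarrow> (\<exists>\<zeta>. \<forall>f\<in>X. \<phi> f = f \<zeta>)"
    and "F \<in> X"
    and "\<exists>c r. r > 0 \<and> ball c r \<subseteq> outside (op_spectrum (toeplitz F)) \<and> 0 \<in> frontier (ball c r)"
  shows "C0_embeddable (toeplitz F)"
proof (cases "\<forall>z. F z = 0")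
  case True
  hence F0: "F = (\<lambda>_. 0)" by auto
  have "toeplitz F = (\<lambda>_. 0)"
  proof
    fix f
    have "of_H2 (toeplitz F f) = 0"
      unfolding F0 of_H2_toeplitz mult_op_const by (intro L2_eqI) (simp add: fourier_coeff_riesz_proj fourier_coeff_0)
    thus "toeplitz F f = 0" by (intro H2_eqI) (simp add: zero_H2.rep_eq)
  qed
  thus ?thesis using C0_embeddable_zero by simp
next
  case False
  then obtain \<zeta> where nz: "F \<zeta> \<noteq> 0" by blast
  interpret continuous_function_algebra X N by unfold_locales (fact assms)+
  let ?\<sigma> = "op_spectrum (toeplitz F)"
  have Fc: "continuous_on UNIV F" by (rule continuous[OF assms(5)])
  have app: "cop_apply (toeplitz_cop F) = toeplitz F"
    by (rule cop_apply_toeplitz[OF bounded_measurable_continuous[OF Fc]])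
  from assms(6) obtain c r where r: "r > 0" "ball c r \<subseteq> outside ?\<sigma>" "0 \<in> frontier (ball c r)" by blast
  have cr: "cmod c = r" using r(1,3) by (simp add: frontier_ball)
  have c0: "c \<noteq> 0" using cr r(1) by auto
  have c_out: "c \<in> outside ?\<sigma>" using r by auto
  have far: "cmod c \<le> cmod (F z - c)" for z
  proof (rule ccontr)
    assume "\<not> cmod c \<le> cmod (F z - c)"
    hence "F z \<in> ball c r" using cr by (simp add: dist_norm norm_minus_commute)
    thus False using r(2) symbol_value_in_spectrum[OF Fc, of z] outside_no_overlap[of ?\<sigma>] by blast
  qed
  have pow: "has_powers_at (toeplitz_cop F) c"
    by (rule has_powers_at_outside) (use c_out app in simp)
  \<comment> \<open>Removing one point leaves an open connected set in the plane connected.\<close>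
  define C where "C = connected_component_set (- ?\<sigma>) c - {0}"
  have "open (- ?\<sigma>)" using open_resolvent_set[of "toeplitz_cop F"] app by simp
  hence conn: "connected C"
    unfolding C_def by (intro connected_open_delete open_connected_component connected_connected_component) auto
  have comp: "connected_component_set (- ?\<sigma>) c \<subseteq> - ?\<sigma>" by (rule connected_component_subset)
  have "c \<in> C" using c_out c0 by (auto simp: C_def outside_def)
  have "\<not> bounded (connected_component_set (- ?\<sigma>) c)" using c_out by (simp add: outside_def)
  then obtain k where k: "k \<in> connected_component_set (- ?\<sigma>) c" "\<not> cmod k \<le> N F"
    unfolding bounded_iff by blast
  have "k \<in> C" using k N_nonneg[OF assms(5)] by (auto simp: C_def)
  obtain g where g: "g \<in> X" "\<And>z. 1 - F z / c = exp (g z)"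
  proof (rule logarithm_on_connected_set[OF assms(4,5) conn _ _ \<open>c \<in> C\<close> \<open>k \<in> C\<close>])
    show "0 \<notin> C" by (simp add: C_def)
    show "F z \<noteq> l" if "l \<in> C" for l z
      using that comp symbol_value_in_spectrum[OF Fc, of z] by (auto simp: C_def)
  qed (use k in auto)
  obtain u v where uv: "analytic_symbol u" "analytic_symbol (\<lambda>z. cnj (v z))" "\<And>z. g z = u z + v z"
    using riesz_proj_split[OF continuous[OF g(1)]] assms(3) g(1) by blast
  show ?thesis
    by (rule C0_embeddable_of_wiener_hopf[OF Fc c0 far pow uv(1,2) _ nz]) (simp add: g(2) uv(3))
qed

end
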